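(* Let $r\ge 0$ and let $W_B\in\mathbb R^{2\times4}$ be a matrix of full rank satisfying $W_B\Sigma W_B^\top\ge0$. Then the port-Hamiltonian operator $A_{\mathcal Q_0}:D(A_{\mathcal Q_0})\subset X\to X$, $$D(A_{\mathcal Q_0})=\left\{x\in X:\ \mathcal Q_0x\in D(\mathcal J_0),\ f_{I,\mathcal Q_0x}=r\,e_{I,\mathcal Q_0x},\ W_B\begin{bmatrix}f_{\partial,\mathcal Q_0x}\\ e_{\partial,\mathcal Q_0x}\end{bmatrix}=0\right\},\qquad A_{\mathcal Q_0}x=\mathcal J_0(\mathcal Q_0x),$$ is the infinitesimal generator of a contraction semigroup on the energy space $(X,\|\cdot\|_{\mathcal Q_0})$. In particular, the abstract Cauchy problem $$\dot x(t)=A_{\mathcal Q_0}x(t),\ t>0,\qquad x(0)=x_0\in X,$$ is well-posed.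
   Context: Let $a<0<b$ and $X=L^2([a,b],\mathbb R^2)$. Let $c_0=\mathbf 1_{[a,0)}$, $\overline c_0=\mathbf 1_{(0,b]}$. Let $\mathcal Q_0=c_0\mathcal Q^-+\overline c_0\mathcal Q^+\in\mathcal L(X)$ be a coercive matrix multiplication operator, where $\mathcal Q^\pm$ are symmetric $2\times2$-matrix-valued functions on $[a,b]$ and there are constants $0<m\le M$ with $mI\le\mathcal Q^\pm(z)\le MI$ for almost all $z\in[a,b]$. $X$ is endowed with $\langle x,y\rangle_{\mathcal Q_0}=\frac12\int_a^by^\top(z)\mathcal Q_0(z)x(z)\,dz$ and its norm $\|\cdot\|_{\mathcal Q_0}$ (the energy space). The operator $\mathcal J_0$ on $X$ has domain $D(\mathcal J_0)=\{e=(e_1,e_2)\in X: e_1|_{(a,0)}\in H^1((a,0),\mathbb R),\ e_1|_{(0,b)}\in H^1((0,b),\mathbb R),\ e_2\in H^1([a,b],\mathbb R)\}$ and $\mathcal J_0e=(\mathbf d_0e_2,-\mathbf d_0^*e_1)$; here $\mathbf d_0e_2=-\frac{d}{dz}e_2$, and $\mathbf d_0^*e_1\in L^2([a,b],\mathbb R)$ is the function equal to $\frac{d}{dz}e_1$ on $(a,0)$ and on $(0,b)$. So $\mathcal J_0$ acts as $P_1\frac{d}{dz}$ on each of $(a,0)$, $(0,b)$, with $P_1=\begin{bmatrix}0&-1\\-1&0\end{bmatrix}$. For $e\in D(\mathcal J_0)$ the boundary port variables are $f_{\partial,e}=\frac1{\sqrt2}(P_1e(b)-P_1e(a))\in\mathbb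 R^2$, $e_{\partial,e}=\frac1{\sqrt2}(e(b)+e(a))\in\mathbb R^2$, and the interface port variables are $f_{I,e}=e_2(0)\in\mathbb R$, $e_{I,e}=e_1(0^-)-e_1(0^+)\in\mathbb R$. $\Sigma=\begin{bmatrix}0&I\\ I&0\end{bmatrix}\in\mathbb R^{4\times4}$ with $2\times 2$ identity blocks. $M\ge0$ means positive semidefinite. A contraction semigroup is a strongly continuous semigroup $(T(t))_{t\ge0}$ with $\|T(t)\|\le1$ for all $t\ge0$. The Cauchy problem $\dot x=Ax$, $x(0)=x_0$ is well-posed if $A$ is densely defined, for every $x_0\in D(A)$ there is a unique classical solution $x(\cdot;x_0)$ (that is, $x\in\mathcal C([0,\infty),X)$, $x|_{(0,\infty)}\in\mathcal C^1((0,\infty),X)$, $x(t)\in D(A)$ for $t>0$, and the equation and initial condition hold), and for all $\epsilon>0$, $\tau>0$, $x_0\in D(A)$ there is $\delta>0$ such that for $x_1\in D(A)$, $\|x_0-x_1\|\le\delta$ implies $\sup_{t\in[0,\tau]}\|x(t;x_0)-x(t;x_1)\|\le\epsilon$. *)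

theory Defs
  imports "HOL-Analysis.Analysis"
begin

section \<open>The space $L^2$\<close>

definition square_integrable :: "(real \<Rightarrow> real^2) \<Rightarrow> bool" where
  "square_integrable f \<longleftrightarrow>
     f \<in> borel_measurable lebesgue \<and> integrable lebesgue (\<lambda>z. (norm (f z))\<^sup>2)"

lemma square_integrable_zero: "square_integrable (\<lambda>z. 0)"
  by (simp add: square_integrable_def)

lemma square_integrable_scaleR: "square_integrable f \<Longrightarrow> square_integrable (\<lambda>z. c *\<^sub>R f z)"
  by (auto simp: square_integrable_def power_mult_distrib)

lemma square_integrable_add:
  assumes "square_integrable f" "square_integrable g"
  shows "square_integrable (\<lambda>z. f z + g z)"
proof -
  have mf: "f \<in> borel_measurable lebesgue" and mg: "g \<in> borel_measurable lebesgue"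
    using assms by (auto simp: square_integrable_def)
  have "integrable lebesgue (\<lambda>z. 2 * ((norm (f z))\<^sup>2 + (norm (g z))\<^sup>2))"
    using assms by (auto simp: square_integrable_def)
  moreover have "(norm (f z + g z))\<^sup>2 \<le> 2 * ((norm (f z))\<^sup>2 + (norm (g z))\<^sup>2)" for z
  proof -
    have "(norm (f z + g z))\<^sup>2 \<le> (norm (f z) + norm (g z))\<^sup>2"
      by (simp add: norm_triangle_ineq power_mono)
    also have "\<dots> \<le> 2 * ((norm (f z))\<^sup>2 + (norm (g z))\<^sup>2)"
      using sum_squares_bound[of "norm (f z)" "norm (g z)"] by (simp add: power2_sum)
    finally show ?thesis .
  qed
  ultimately have "integrable lebesgue (\<lambda>z. (norm (f z + g z))\<^sup>2)"
    by (intro Bochner_Integration.integrable_bound[OF \<open>integrable _ _\<close>] AE_I2)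
      (use mf mg in \<open>auto\<close>)
  then show ?thesis
    using mf mg by (simp add: square_integrable_def)
qed

text \<open>The type \<open>l2\<close> is $L^2(\mathbb R,\mathbb R^2)$, as classes modulo almost everywhere equality.\<close>

quotient_type l2 = "real \<Rightarrow> real^2" / partial:
  "\<lambda>f g. square_integrable f \<and> square_integrable g \<and> (AE z in lebesgue. f z = g z)"
proof (rule part_equivpI)
  show "\<exists>x. square_integrable x \<and> square_integrable x \<and> (AE z in lebesgue. x z = x z)"
    using square_integrable_zero by auto
  show "symp (\<lambda>f g. square_integrable f \<and> square_integrable g \<and> (AE z in lebesgue. f z = g z))"
    by (auto simp: symp_def elim: eventually_mono)
  show "transp (\<lambda>f g. square_integrable f \<and> square_integrable g \<and> (AE z in lebesgue. f z = g z))"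
    by (auto simp: transp_def elim: eventually_elim2)
qed

instantiation l2 :: real_vector
begin

lift_definition zero_l2 :: l2 is "\<lambda>z. 0"
  by (simp add: square_integrable_zero)

lift_definition plus_l2 :: "l2 \<Rightarrow> l2 \<Rightarrow> l2" is "\<lambda>f g z. f z + g z"
  by (auto intro: square_integrable_add elim: eventually_elim2)

lift_definition scaleR_l2 :: "real \<Rightarrow> l2 \<Rightarrow> l2" is "\<lambda>c f z. c *\<^sub>R f z"
  by (auto intro: square_integrable_scaleR elim: eventually_mono)

lift_definition uminus_l2 :: "l2 \<Rightarrow> l2" is "\<lambda>f z. - f z"
  using square_integrable_scaleR[where c="-1"] by (auto elim: eventually_mono)

definition minus_l2 :: "l2 \<Rightarrow> l2 \<Rightarrow> l2" where "minus_l2 x y = x + - y"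

instance
proof
  fix x y w :: l2 and c d :: real
  show "x + y + w = x + (y + w)"
    by transfer (auto intro!: square_integrable_add simp: add.assoc)
  show "x + y = y + x"
    by transfer (auto intro!: square_integrable_add simp: add.commute)
  show "0 + x = x"
    by transfer auto
  show "- x + x = 0"
    by transfer (auto simp: square_integrable_zero)
  show "x - y = x + - y"
    by (rule minus_l2_def)
  show "c *\<^sub>R (x + y) = c *\<^sub>R x + c *\<^sub>R y"
    by transfer
      (auto intro!: square_integrable_add square_integrable_scaleR
        simp: scaleR_add_right simp flip: scaleR_add_right)
  show "(c + d) *\<^sub>R x = c *\<^sub>R x + d *\<^sub>R x"
    by transfer
      (auto intro!: square_integrable_add square_integrable_scaleR
        simp: scaleR_add_left simp flip: scaleR_add_left)
  show "c *\<^sub>R d *\<^sub>R x = (c * d) *\<^sub>R x"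
    by transfer (auto intro!: square_integrable_scaleR)
  show "1 *\<^sub>R x = x"
    by transfer auto
qed

end

text \<open>
  $L^2([a,b],\mathbb R^2)$ is realised inside \<open>l2\<close> through extension by zero. Below, \<open>rep_l2\<close>
  chooses a representative of a class; it is only used where the choice does not matter.
\<close>

definition L2_on :: "real \<Rightarrow> real \<Rightarrow> l2 set" where
  "L2_on a b = {x. AE z in lebesgue. z \<notin> {a..b} \<longrightarrow> rep_l2 x z = 0}"


section \<open>Weak derivatives and traces on an interval\<close>

definition L2_fun :: "real \<Rightarrow> real \<Rightarrow> (real \<Rightarrow> real) \<Rightarrow> bool" where
  "L2_fun \<alpha> \<beta> f \<longleftrightarrow> f \<in> borel_measurable (lebesgue_on {\<alpha><..<\<beta>}) \<and>
     integrable (lebesgue_on {\<alpha><..<\<beta>}) (\<lambda>z. (f z)\<^sup>2)"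

definition test_fun :: "real \<Rightarrow> real \<Rightarrow> (real \<Rightarrow> real) \<Rightarrow> bool" where
  "test_fun \<alpha> \<beta> \<phi> \<longleftrightarrow> \<phi> C1_differentiable_on UNIV \<and>
     (\<exists>c d. \<alpha> < c \<and> c \<le> d \<and> d < \<beta> \<and> (\<forall>z. z \<notin> {c..d} \<longrightarrow> \<phi> z = 0))"

text \<open>
  Sobolev space $H^1(\alpha,\beta)$ as in Brezis, \<^emph>\<open>Functional Analysis, Sobolev Spaces and PDEs\<close>,
  Section 8.2, with test functions in $C^1_c(\alpha,\beta)$.
\<close>

definition has_weak_deriv :: "real \<Rightarrow> real \<Rightarrow> (real \<Rightarrow> real) \<Rightarrow> (real \<Rightarrow> real) \<Rightarrow> bool" where
  "has_weak_deriv \<alpha> \<beta> f g \<longleftrightarrow> L2_fun \<alpha> \<beta> f \<and> L2_fun \<alpha> \<beta> g \<and>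
     (\<forall>\<phi>. test_fun \<alpha> \<beta> \<phi> \<longrightarrow>
        (LINT z|lebesgue_on {\<alpha><..<\<beta>}. f z * deriv \<phi> z) =
        - (LINT z|lebesgue_on {\<alpha><..<\<beta>}. g z * \<phi> z))"

definition H1 :: "real \<Rightarrow> real \<Rightarrow> (real \<Rightarrow> real) \<Rightarrow> bool" where
  "H1 \<alpha> \<beta> f \<longleftrightarrow> (\<exists>g. has_weak_deriv \<alpha> \<beta> f g)"

definition weak_deriv :: "real \<Rightarrow> real \<Rightarrow> (real \<Rightarrow> real) \<Rightarrow> real \<Rightarrow> real" where
  "weak_deriv \<alpha> \<beta> f = (SOME g. has_weak_deriv \<alpha> \<beta> f g)"

text \<open>
  Point values of an $H^1$ function are those of its continuous representative, which is unique on
  $[\alpha,\beta]$ when $\alpha<\beta$; its values at the end points are the one-sided traces.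
\<close>

definition cont_rep :: "real \<Rightarrow> real \<Rightarrow> (real \<Rightarrow> real) \<Rightarrow> real \<Rightarrow> real" where
  "cont_rep \<alpha> \<beta> f = (SOME u. continuous_on {\<alpha>..\<beta>} u \<and>
     (AE z in lebesgue. z \<in> {\<alpha><..<\<beta>} \<longrightarrow> f z = u z))"


section \<open>The energy space\<close>

definition psd :: "real^'n^'n \<Rightarrow> bool" where
  "psd A \<longleftrightarrow> transpose A = A \<and> (\<forall>v. 0 \<le> v \<bullet> (A *v v))"

definition Q0 :: "real \<Rightarrow> real \<Rightarrow> (real \<Rightarrow> real^2^2) \<Rightarrow> (real \<Rightarrow> real^2^2) \<Rightarrow> real \<Rightarrow> real^2^2" where
  "Q0 a b Qm Qp z = indicator {a..<0} z *\<^sub>R Qm z + indicator {0<..b} z *\<^sub>R Qp z"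

definition mult_op :: "(real \<Rightarrow> real^2^2) \<Rightarrow> l2 \<Rightarrow> l2" where
  "mult_op Q x = abs_l2 (\<lambda>z. Q z *v rep_l2 x z)"

definition energy_inner :: "real \<Rightarrow> real \<Rightarrow> (real \<Rightarrow> real^2^2) \<Rightarrow> l2 \<Rightarrow> l2 \<Rightarrow> real" where
  "energy_inner a b Q x y =
     1/2 * (LINT z|lebesgue_on {a..b}. rep_l2 y z \<bullet> (Q z *v rep_l2 x z))"

definition energy_norm :: "real \<Rightarrow> real \<Rightarrow> (real \<Rightarrow> real^2^2) \<Rightarrow> l2 \<Rightarrow> real" where
  "energy_norm a b Q x = sqrt (energy_inner a b Q x x)"


section \<open>The port-Hamiltonian operator\<close>

definition comp1 :: "l2 \<Rightarrow> real \<Rightarrow> real" where "comp1 e z = rep_l2 e z $ 1"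

definition comp2 :: "l2 \<Rightarrow> real \<Rightarrow> real" where "comp2 e z = rep_l2 e z $ 2"

definition dom_J0 :: "real \<Rightarrow> real \<Rightarrow> l2 set" where
  "dom_J0 a b = {e \<in> L2_on a b. H1 a 0 (comp1 e) \<and> H1 0 b (comp1 e) \<and> H1 a b (comp2 e)}"

definition J0 :: "real \<Rightarrow> real \<Rightarrow> l2 \<Rightarrow> l2" where
  "J0 a b e = abs_l2 (\<lambda>z. vector
     [- (indicator {a<..<b} z * weak_deriv a b (comp2 e) z),
      - (indicator {a<..<0} z * weak_deriv a 0 (comp1 e) z
         + indicator {0<..<b} z * weak_deriv 0 b (comp1 e) z)])"

definition P1 :: "real^2^2" where
  "P1 = vector [vector [0, -1], vector [-1, 0]]"

definition left_value :: "real \<Rightarrow> real \<Rightarrow> l2 \<Rightarrow> real^2" where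
  "left_value a b e = vector [cont_rep a 0 (comp1 e) a, cont_rep a b (comp2 e) a]"

definition right_value :: "real \<Rightarrow> real \<Rightarrow> l2 \<Rightarrow> real^2" where
  "right_value a b e = vector [cont_rep 0 b (comp1 e) b, cont_rep a b (comp2 e) b]"

definition flow_bd :: "real \<Rightarrow> real \<Rightarrow> l2 \<Rightarrow> real^2" where
  "flow_bd a b e = (1 / sqrt 2) *\<^sub>R (P1 *v right_value a b e - P1 *v left_value a b e)"

definition effort_bd :: "real \<Rightarrow> real \<Rightarrow> l2 \<Rightarrow> real^2" where
  "effort_bd a b e = (1 / sqrt 2) *\<^sub>R (right_value a b e + left_value a b e)"

definition flow_if :: "real \<Rightarrow> real \<Rightarrow> l2 \<Rightarrow> real" where
  "flow_if a b e = cont_rep a b (comp2 e) 0"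

definition effort_if :: "real \<Rightarrow> real \<Rightarrow> l2 \<Rightarrow> real" where
  "effort_if a b e = cont_rep a 0 (comp1 e) 0 - cont_rep 0 b (comp1 e) 0"

definition stack :: "real^2 \<Rightarrow> real^2 \<Rightarrow> real^4" where
  "stack f e = vector [f$1, f$2, e$1, e$2]"

definition Sigma_mat :: "real^4^4" where
  "Sigma_mat = vector [vector [0, 0, 1, 0], vector [0, 0, 0, 1],
                       vector [1, 0, 0, 0], vector [0, 1, 0, 0]]"

lemma vector_4:
  "(vector [w, x, y, z] :: ('a::zero)^4) $ 1 = w"
  "(vector [w, x, y, z] :: ('a::zero)^4) $ 2 = x"
  "(vector [w, x, y, z] :: ('a::zero)^4) $ 3 = y"
  "(vector [w, x, y, z] :: ('a::zero)^4) $ 4 = z"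
  by (simp_all add: vector_def)

definition dom_AQ ::
  "real \<Rightarrow> real \<Rightarrow> (real \<Rightarrow> real^2^2) \<Rightarrow> real \<Rightarrow> real^4^2 \<Rightarrow> l2 set" where
  "dom_AQ a b Q r W =
     {x \<in> L2_on a b. mult_op Q x \<in> dom_J0 a b \<and>
        flow_if a b (mult_op Q x) = r * effort_if a b (mult_op Q x) \<and>
        W *v stack (flow_bd a b (mult_op Q x)) (effort_bd a b (mult_op Q x)) = 0}"

definition AQ :: "real \<Rightarrow> real \<Rightarrow> (real \<Rightarrow> real^2^2) \<Rightarrow> l2 \<Rightarrow> l2" where
  "AQ a b Q x = J0 a b (mult_op Q x)"


section \<open>Semigroups and Cauchy problems\<close>

text \<open>
  The normed space is a linear subspace \<open>X\<close> of an ambient vector space together with a norm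
  \<open>N\<close> on \<open>X\<close>. All limits are taken with respect to \<open>N\<close>, and semigroups are only relevant at
  times $t \ge 0$.
\<close>

definition C0_semigroup ::
  "'v::real_vector set \<Rightarrow> ('v \<Rightarrow> real) \<Rightarrow> (real \<Rightarrow> 'v \<Rightarrow> 'v) \<Rightarrow> bool" where
  "C0_semigroup X N T \<longleftrightarrow>
     (\<forall>t\<ge>0. (\<forall>x\<in>X. T t x \<in> X) \<and>
        (\<forall>x\<in>X. \<forall>y\<in>X. T t (x + y) = T t x + T t y) \<and>
        (\<forall>c. \<forall>x\<in>X. T t (c *\<^sub>R x) = c *\<^sub>R T t x) \<and>
        (\<exists>C. \<forall>x\<in>X. N (T t x) \<le> C * N x)) \<and>
     (\<forall>x\<in>X. T 0 x = x) \<and>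
     (\<forall>s\<ge>0. \<forall>t\<ge>0. \<forall>x\<in>X. T (s + t) x = T s (T t x)) \<and>
     (\<forall>x\<in>X. ((\<lambda>t. N (T t x - x)) \<longlongrightarrow> 0) (at_right 0))"

definition contraction_semigroup ::
  "'v::real_vector set \<Rightarrow> ('v \<Rightarrow> real) \<Rightarrow> (real \<Rightarrow> 'v \<Rightarrow> 'v) \<Rightarrow> bool" where
  "contraction_semigroup X N T \<longleftrightarrow>
     C0_semigroup X N T \<and> (\<forall>t\<ge>0. \<forall>x\<in>X. N (T t x) \<le> N x)"

definition semigroup_deriv ::
  "('v::real_vector \<Rightarrow> real) \<Rightarrow> (real \<Rightarrow> 'v \<Rightarrow> 'v) \<Rightarrow> 'v \<Rightarrow> 'v \<Rightarrow> bool" where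
  "semigroup_deriv N T x y \<longleftrightarrow>
     ((\<lambda>h. N ((1 / h) *\<^sub>R (T h x - x) - y)) \<longlongrightarrow> 0) (at_right 0)"

definition is_generator ::
  "'v::real_vector set \<Rightarrow> ('v \<Rightarrow> real) \<Rightarrow> (real \<Rightarrow> 'v \<Rightarrow> 'v) \<Rightarrow> 'v set \<Rightarrow> ('v \<Rightarrow> 'v) \<Rightarrow> bool" where
  "is_generator X N T D A \<longleftrightarrow>
     D = {x \<in> X. \<exists>y\<in>X. semigroup_deriv N T x y} \<and>
     (\<forall>x\<in>D. A x \<in> X \<and> semigroup_deriv N T x (A x))"

definition generates_contraction_semigroup ::
  "'v::real_vector set \<Rightarrow> ('v \<Rightarrow> real) \<Rightarrow> 'v set \<Rightarrow> ('v \<Rightarrow> 'v) \<Rightarrow> bool" where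
  "generates_contraction_semigroup X N D A \<longleftrightarrow>
     (\<exists>T. contraction_semigroup X N T \<and> is_generator X N T D A)"

definition norm_continuous_on ::
  "('v::real_vector \<Rightarrow> real) \<Rightarrow> real set \<Rightarrow> (real \<Rightarrow> 'v) \<Rightarrow> bool" where
  "norm_continuous_on N S u \<longleftrightarrow>
     (\<forall>t\<in>S. ((\<lambda>s. N (u s - u t)) \<longlongrightarrow> 0) (at t within S))"

definition norm_has_derivative ::
  "('v::real_vector \<Rightarrow> real) \<Rightarrow> (real \<Rightarrow> 'v) \<Rightarrow> 'v \<Rightarrow> real \<Rightarrow> bool" where
  "norm_has_derivative N u y t \<longleftrightarrow>
     ((\<lambda>h. N ((1 / h) *\<^sub>R (u (t + h) - u t) - y)) \<longlongrightarrow> 0) (at 0)"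

definition classical_solution ::
  "'v::real_vector set \<Rightarrow> ('v \<Rightarrow> real) \<Rightarrow> 'v set \<Rightarrow> ('v \<Rightarrow> 'v) \<Rightarrow> 'v \<Rightarrow> (real \<Rightarrow> 'v) \<Rightarrow> bool" where
  "classical_solution X N D A x0 u \<longleftrightarrow>
     (\<forall>t\<ge>0. u t \<in> X) \<and> norm_continuous_on N {0..} u \<and>
     (\<exists>u'. (\<forall>t>0. u' t \<in> X \<and> norm_has_derivative N u (u' t) t) \<and>
        norm_continuous_on N {0<..} u' \<and>
        (\<forall>t>0. u t \<in> D \<and> u' t = A (u t))) \<and>
     u 0 = x0"

text \<open>
  In the last clause, the condition that the supremum over $[0,\tau]$ is at most $\epsilon$ is
  written as a bound at every $t\in[0,\tau]$, which needs no boundedness side condition.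
\<close>

definition well_posed ::
  "'v::real_vector set \<Rightarrow> ('v \<Rightarrow> real) \<Rightarrow> 'v set \<Rightarrow> ('v \<Rightarrow> 'v) \<Rightarrow> bool" where
  "well_posed X N D A \<longleftrightarrow>
     D \<subseteq> X \<and> (\<forall>x\<in>X. \<forall>\<epsilon>>0. \<exists>y\<in>D. N (x - y) < \<epsilon>) \<and>
     (\<forall>x0\<in>D. (\<exists>u. classical_solution X N D A x0 u) \<and>
        (\<forall>u v. classical_solution X N D A x0 u \<longrightarrow> classical_solution X N D A x0 v \<longrightarrow>
           (\<forall>t\<ge>0. u t = v t))) \<and>
     (\<forall>\<epsilon>>0. \<forall>\<tau>>0. \<forall>x0\<in>D. \<exists>\<delta>>0. \<forall>x1\<in>D. N (x0 - x1) \<le> \<delta> \<longrightarrow>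
        (\<forall>u v. classical_solution X N D A x0 u \<longrightarrow> classical_solution X N D A x1 v \<longrightarrow>
           (\<forall>t\<in>{0..\<tau>}. N (u t - v t) \<le> \<epsilon>)))"

end

theory Submission
  imports Defs
begin

text \<open>
  On the energy space, $\langle A_{\mathcal Q_0}x,x\rangle_{\mathcal Q_0}=\frac12\langle f_\partial,e_\partial\rangle-\frac r2e_I^2$
  by integration by parts, and $\langle f_\partial,e_\partial\rangle\le0$ on $\ker W_B$ because $W_B\Sigma W_B^\top\ge0$; so the operator
  is dissipative. For $\mathcal Q_0=I$ the equation $\mu e-\mathcal J_0e=w$ has constant coefficients and an explicit
  three-parameter family of solutions; the three boundary and interface conditions are an affine
  map of the parameters whose linear part is injective by dissipativity, hence onto. A fixed point argument
  carries the range condition over to general $\mathcal Q_0$. The semigroup is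
  the limit of the implicit Euler scheme with dyadic steps, and in a Hilbert space
  maximal dissipativity alone gives a dense domain.
\<close>

section \<open>Maximal dissipative operators in Hilbert spaces\<close>

text \<open>The matrix function \<open>Q0\<close> is merely measurable, so its resolvent equation
  has no explicit solution. The ports, however, depend only on the effort e = Q0 x. The analysis of
  traces therefore takes place in the effort variable with the plain L2 product, where neither the
  domain nor the sign of the form involves \<open>Q0\<close>. The multiplier returns only through
  its inverse, which is bounded and strongly monotone: for small \<tau> the identity minus \<tau>
  times this inverse is a strict contraction, while the resolvents of \<open>J0\<close> are
  contractions for every step, so the range condition follows without a restriction on the step.
  Sobolev functions are handled as primitives of L2 functions. Traces then become ordinary values,
  and integration by parts becomes Fubini on triangles. Dyadic steps are used because halving a step
  is the one refinement whose error is a pure second-order term in the generator; the differences of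
  consecutive schemes then form a geometric series. The energy norm depends on a, b and
  \<open>Q0\<close>, so the Hilbert space arguments are carried out relative to a carrier set and a
  norm function.\<close>

locale energy_space =
  fixes X :: "'v::real_vector set" and ip :: "'v \<Rightarrow> 'v \<Rightarrow> real" and N :: "'v \<Rightarrow> real"
  assumes subspace_X: "subspace X"
    and ip_add: "\<And>x y z. x \<in> X \<Longrightarrow> y \<in> X \<Longrightarrow> z \<in> X \<Longrightarrow> ip (x + y) z = ip x z + ip y z"
    and ip_scale: "\<And>c x z. x \<in> X \<Longrightarrow> z \<in> X \<Longrightarrow> ip (c *\<^sub>R x) z = c * ip x z"
    and ip_sym: "\<And>x y. x \<in> X \<Longrightarrow> y \<in> X \<Longrightarrow> ip x y = ip y x"
    and ip_nonneg: "\<And>x. x \<in> X \<Longrightarrow> 0 \<le> ip x x"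
    and ip_definite: "\<And>x. x \<in> X \<Longrightarrow> ip x x = 0 \<Longrightarrow> x = 0"
    and N_eq: "\<And>x. N x = sqrt (ip x x)"
    and complete_X: "\<And>u. (\<And>n. u n \<in> X) \<Longrightarrow>
      (\<And>\<epsilon>. \<epsilon> > 0 \<Longrightarrow> \<exists>K. \<forall>i\<ge>K. \<forall>j\<ge>K. N (u i - u j) < \<epsilon>) \<Longrightarrow>
      \<exists>x\<in>X. (\<lambda>n. N (u n - x)) \<longlonglongrightarrow> 0"
begin

lemma X_add [simp, intro]: "x \<in> X \<Longrightarrow> y \<in> X \<Longrightarrow> x + y \<in> X"
  using subspace_X by (rule subspace_add)

lemma X_diff [simp, intro]: "x \<in> X \<Longrightarrow> y \<in> X \<Longrightarrow> x - y \<in> X"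
  using subspace_X by (rule subspace_diff)

lemma X_scale [simp, intro]: "x \<in> X \<Longrightarrow> c *\<^sub>R x \<in> X"
  using subspace_X by (rule subspace_scale)

lemma X_0 [simp, intro]: "0 \<in> X"
  using subspace_X by (rule subspace_0)

lemma X_neg [simp, intro]: "x \<in> X \<Longrightarrow> - x \<in> X"
  using subspace_X by (rule subspace_neg)

lemma ip_add_right: "x \<in> X \<Longrightarrow> y \<in> X \<Longrightarrow> z \<in> X \<Longrightarrow> ip z (x + y) = ip z x + ip z y"
  using ip_add ip_sym by (metis X_add)

lemma ip_scale_right: "x \<in> X \<Longrightarrow> z \<in> X \<Longrightarrow> ip z (c *\<^sub>R x) = c * ip z x"
  using ip_scale ip_sym by (metis X_scale)

lemma ip_diff: "x \<in> X \<Longrightarrow> y \<in> X \<Longrightarrow> z \<in> X \<Longrightarrow> ip (x - y) z = ip x z - ip y z"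
  using ip_add[of x "(-1) *\<^sub>R y" z] ip_scale[of y z "-1"] by simp

lemma ip_diff_right: "x \<in> X \<Longrightarrow> y \<in> X \<Longrightarrow> z \<in> X \<Longrightarrow> ip z (x - y) = ip z x - ip z y"
  using ip_diff ip_sym by (metis X_diff)

lemmas ip_simps = ip_add ip_add_right ip_scale ip_scale_right ip_diff ip_diff_right

lemma N_nonneg [simp]: "x \<in> X \<Longrightarrow> 0 \<le> N x"
  by (simp add: N_eq ip_nonneg)

lemma N_sq: "x \<in> X \<Longrightarrow> (N x)\<^sup>2 = ip x x"
  by (simp add: N_eq ip_nonneg)

lemma N_zero [simp]: "N 0 = 0"
  using ip_scale[of 0 0 0] by (simp add: N_eq)

lemma N_eq_0: "x \<in> X \<Longrightarrow> N x = 0 \<Longrightarrow> x = 0"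
  using ip_definite by (simp add: N_eq)

lemma N_scale: "x \<in> X \<Longrightarrow> N (c *\<^sub>R x) = \<bar>c\<bar> * N x"
  by (simp add: N_eq ip_scale ip_scale_right real_sqrt_mult flip: mult.assoc power2_eq_square)

lemma N_minus: "x \<in> X \<Longrightarrow> N (- x) = N x"
  using N_scale[of x "-1"] by simp

lemma N_commute: "x \<in> X \<Longrightarrow> y \<in> X \<Longrightarrow> N (x - y) = N (y - x)"
  using N_minus[of "x - y"] by simp

lemma cauchy_schwarz:
  assumes x: "x \<in> X" and y: "y \<in> X"
  shows "\<bar>ip x y\<bar> \<le> N x * N y"
proof (cases "y = 0")
  case True
  then show ?thesis using ip_scale_right[of 0 x 0] x by simp
next
  case False
  then have p: "ip y y > 0" using ip_definite[OF y] ip_nonneg[OF y] by force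
  define t where "t = ip x y / ip y y"
  have "0 \<le> ip (x - t *\<^sub>R y) (x - t *\<^sub>R y)"
    using x y by (intro ip_nonneg) auto
  also have "\<dots> = ip x x - 2 * t * ip x y + t * t * ip y y"
    using x y by (simp add: ip_simps ip_sym[OF y x] algebra_simps)
  also have "\<dots> = ip x x - (ip x y)\<^sup>2 / ip y y"
    using p by (simp add: t_def field_simps power2_eq_square)
  finally have "(ip x y)\<^sup>2 \<le> ip x x * ip y y"
    using p by (simp add: field_simps)
  then have "(ip x y)\<^sup>2 \<le> (N x * N y)\<^sup>2"
    using x y by (simp add: N_sq power_mult_distrib)
  then show ?thesis
    using x y by (metis N_nonneg abs_le_square_iff abs_of_nonneg mult_nonneg_nonneg)
qed

lemma N_triangle: "x \<in> X \<Longrightarrow> y \<in> X \<Longrightarrow> N (x + y) \<le> N x + N y"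
proof -
  assume x: "x \<in> X" and y: "y \<in> X"
  have "(N (x + y))\<^sup>2 = ip x x + 2 * ip x y + ip y y"
    using x y by (simp add: N_sq ip_simps ip_sym[OF y x])
  also have "\<dots> \<le> (N x + N y)\<^sup>2"
    using cauchy_schwarz[OF x y] x y by (simp add: power2_sum N_sq)
  finally show ?thesis using x y by (meson N_nonneg add_nonneg_nonneg power2_le_imp_le)
qed

lemma N_diff_le: "x \<in> X \<Longrightarrow> y \<in> X \<Longrightarrow> N (x - y) \<le> N x + N y"
  using N_triangle[of x "- y"] by (simp add: N_minus)

lemma N_diff_triangle: "x \<in> X \<Longrightarrow> y \<in> X \<Longrightarrow> z \<in> X \<Longrightarrow> N (x - y) \<le> N (x - z) + N (z - y)"
  using N_triangle[of "x - z" "z - y"] by simp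

lemma N_le_diff: "x \<in> X \<Longrightarrow> y \<in> X \<Longrightarrow> N x \<le> N y + N (x - y)"
  using N_triangle[of y "x - y"] by simp

text \<open>Membership in \<open>X\<close> is part of the notion because the laws of
  \<open>ip\<close> and \<open>N\<close> are available only on the carrier.\<close>

definition converges :: "(nat \<Rightarrow> 'v) \<Rightarrow> 'v \<Rightarrow> bool" where
  "converges u x \<longleftrightarrow> (\<forall>k. u k \<in> X) \<and> x \<in> X \<and> (\<lambda>k. N (u k - x)) \<longlonglongrightarrow> 0"

lemma convergesI:
  assumes "\<And>k. u k \<in> X" "x \<in> X" "\<And>k. N (u k - x) \<le> c k" "c \<longlonglongrightarrow> 0"
  shows "converges u x"
  unfolding converges_def
  using assms by (auto intro!: tendsto_sandwich[OF _ _ tendsto_const assms(4)])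

lemma converges_const: "x \<in> X \<Longrightarrow> converges (\<lambda>_. x) x"
  by (simp add: converges_def)

lemma converges_add: "converges u x \<Longrightarrow> converges v y \<Longrightarrow> converges (\<lambda>k. u k + v k) (x + y)"
proof -
  assume u: "converges u x" and v: "converges v y"
  show ?thesis
  proof (rule convergesI)
    show "N (u k + v k - (x + y)) \<le> N (u k - x) + N (v k - y)" for k
      using N_triangle[of "u k - x" "v k - y"] u v by (simp add: converges_def algebra_simps)
    show "(\<lambda>k. N (u k - x) + N (v k - y)) \<longlonglongrightarrow> 0"
      using u v unfolding converges_def by (auto intro: tendsto_add_zero)
  qed (use u v in \<open>auto simp: converges_def\<close>)
qed

lemma converges_scale: "converges u x \<Longrightarrow> converges (\<lambda>k. c *\<^sub>R u k) (c *\<^sub>R x)"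
proof -
  assume u: "converges u x"
  show ?thesis
  proof (rule convergesI)
    show "N (c *\<^sub>R u k - c *\<^sub>R x) \<le> \<bar>c\<bar> * N (u k - x)" for k
      using N_scale[of "u k - x" c] u by (simp add: converges_def scaleR_diff_right)
    show "(\<lambda>k. \<bar>c\<bar> * N (u k - x)) \<longlonglongrightarrow> 0"
      using u unfolding converges_def by (auto intro: tendsto_mult_right_zero)
  qed (use u in \<open>auto simp: converges_def\<close>)
qed

lemma converges_diff: "converges u x \<Longrightarrow> converges v y \<Longrightarrow> converges (\<lambda>k. u k - v k) (x - y)"
  using converges_add[of u x "\<lambda>k. (-1) *\<^sub>R v k" "(-1) *\<^sub>R y"] converges_scale[of v y "-1"] by simp

lemma converges_norm: "converges u x \<Longrightarrow> (\<lambda>k. N (u k)) \<longlonglongrightarrow> N x"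
proof -
  assume u: "converges u x"
  have "(\<lambda>k. N (u k) - N x) \<longlonglongrightarrow> 0"
  proof (rule tendsto_sandwich)
    have X: "u k \<in> X" "x \<in> X" for k using u by (auto simp: converges_def)
    have "- N (u k - x) \<le> N (u k) - N x" "N (u k) - N x \<le> N (u k - x)" for k
      using N_le_diff[OF X(1) X(2), of k] N_le_diff[OF X(2) X(1), of k] N_commute[OF X(1) X(2), of k]
      by linarith+
    then show "\<forall>\<^sub>F k in sequentially. - N (u k - x) \<le> N (u k) - N x"
      "\<forall>\<^sub>F k in sequentially. N (u k) - N x \<le> N (u k - x)" by simp_all
    show "(\<lambda>k. - N (u k - x)) \<longlonglongrightarrow> 0" "(\<lambda>k. N (u k - x)) \<longlonglongrightarrow> 0"
      using u tendsto_minus[of "\<lambda>k. N (u k - x)" 0] unfolding converges_def by auto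
  qed
  then show ?thesis by (simp add: LIM_zero_iff)
qed

lemma converges_ip: "converges u x \<Longrightarrow> y \<in> X \<Longrightarrow> (\<lambda>k. ip (u k) y) \<longlonglongrightarrow> ip x y"
proof -
  assume u: "converges u x" and y: "y \<in> X"
  have "(\<lambda>k. ip (u k) y - ip x y) \<longlonglongrightarrow> 0"
  proof (rule Lim_null_comparison)
    show "\<forall>\<^sub>F k in sequentially. norm (ip (u k) y - ip x y) \<le> N (u k - x) * N y"
      using u y cauchy_schwarz[of "u _ - x" y] by (auto simp: converges_def ip_simps)
    show "(\<lambda>k. N (u k - x) * N y) \<longlonglongrightarrow> 0"
      using u unfolding converges_def by (auto intro: tendsto_mult_left_zero)
  qed
  then show ?thesis by (simp add: LIM_zero_iff)
qed

lemma converges_unique: "converges u x \<Longrightarrow> converges u y \<Longrightarrow> x = y"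
proof -
  assume u: "converges u x" "converges u y"
  then have "(\<lambda>k. N (u k - u k)) \<longlonglongrightarrow> N (x - y)"
    by (intro converges_norm converges_diff)
  then have "N (x - y) = 0" by (simp add: LIMSEQ_const_iff)
  then show ?thesis using N_eq_0[of "x - y"] u by (auto simp: converges_def)
qed

lemma converges_norm_le:
  assumes "converges u x" "\<And>k. N (u k) \<le> c k" "c \<longlonglongrightarrow> C"
  shows "N x \<le> C"
  using LIMSEQ_le[OF converges_norm[OF assms(1)] assms(3)] assms(2) by auto

lemma converges_close:
  assumes "converges u x" "\<And>k. v k \<in> X" "\<And>k. N (v k - u k) \<le> c k" "c \<longlonglongrightarrow> 0"
  shows "converges v x"
proof -
  have "converges (\<lambda>k. v k - u k) 0"
    using assms by (intro convergesI[where c = c]) (auto simp: converges_def)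
  from converges_add[OF this assms(1)] show ?thesis by simp
qed

lemma converges_Cauchy:
  assumes "\<And>n. u n \<in> X" "\<And>\<epsilon>. \<epsilon> > 0 \<Longrightarrow> \<exists>K. \<forall>i\<ge>K. \<forall>j\<ge>K. N (u i - u j) < \<epsilon>"
  shows "\<exists>x. converges u x"
  using complete_X[OF assms] assms(1) by (auto simp: converges_def)

lemma converges_geometric:
  assumes u: "\<And>n. u n \<in> X" and q: "0 \<le> q" "q < 1"
    and d: "\<And>n. N (u (Suc n) - u n) \<le> C * q ^ n"
  shows "\<exists>x. converges u x"
proof (rule converges_Cauchy[OF u])
  have C: "0 \<le> C" using d[of 0] N_nonneg[OF X_diff[OF u[of "Suc 0"] u[of 0]]] by simp
  have tail: "N (u (n + k) - u n) \<le> C * q ^ n / (1 - q) * (1 - q ^ k)" for n k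
  proof (induction k)
    case 0
    then show ?case by simp
  next
    case (Suc k)
    have "N (u (n + Suc k) - u n) \<le> N (u (n + Suc k) - u (n + k)) + N (u (n + k) - u n)"
      using u by (intro N_diff_triangle)
    also have "\<dots> \<le> C * q ^ (n + k) + C * q ^ n / (1 - q) * (1 - q ^ k)"
      using d[of "n + k"] Suc by simp
    also have "\<dots> = C * q ^ n / (1 - q) * (1 - q ^ Suc k)"
      using q by (simp add: field_simps power_add)
    finally show ?case .
  qed
  have tail': "N (u i - u n) \<le> C / (1 - q) * q ^ n" if "n \<le> i" for i n
  proof -
    have "N (u i - u n) \<le> C * q ^ n / (1 - q) * (1 - q ^ (i - n))"
      using tail[of n "i - n"] that by simp
    also have "\<dots> \<le> C * q ^ n / (1 - q) * 1"
      using C q by (intro mult_left_mono) auto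
    finally show ?thesis by simp
  qed
  fix \<epsilon> :: real assume e: "\<epsilon> > 0"
  have "(\<lambda>n. C / (1 - q) * q ^ n) \<longlonglongrightarrow> 0"
    using q by (intro tendsto_mult_right_zero LIMSEQ_realpow_zero) auto
  then have "\<forall>\<^sub>F n in sequentially. C / (1 - q) * q ^ n < \<epsilon> / 2"
    using e by (intro order_tendstoD(2)) auto
  then obtain K where K: "C / (1 - q) * q ^ K < \<epsilon> / 2"
    by (auto simp: eventually_sequentially)
  have "N (u i - u j) < \<epsilon>" if "i \<ge> K" "j \<ge> K" for i j
  proof -
    have "N (u i - u j) \<le> N (u i - u K) + N (u K - u j)" using u by (intro N_diff_triangle)
    then show ?thesis using tail'[OF that(1)] tail'[OF that(2)] K N_commute[OF u[of K] u[of j]] by linarith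
  qed
  then show "\<exists>K. \<forall>i\<ge>K. \<forall>j\<ge>K. N (u i - u j) < \<epsilon>" by blast
qed

text \<open>Banach's fixed point theorem relative to the carrier, proved by Picard iteration from 0.
  It serves twice: to invert the multiplication operator and to solve the resolvent equation with
  variable coefficients.\<close>

lemma contraction_fixpoint:
  assumes F: "\<And>x. x \<in> X \<Longrightarrow> F x \<in> X" and q: "0 \<le> q" "q < 1"
    and c: "\<And>x y. x \<in> X \<Longrightarrow> y \<in> X \<Longrightarrow> N (F x - F y) \<le> q * N (x - y)"
  shows "\<exists>x\<in>X. F x = x"
proof -
  define u where "u n = (F ^^ n) 0" for n
  have u: "u n \<in> X" for n by (induction n) (auto simp: u_def F)
  have "N (u (Suc n) - u n) \<le> N (u 1 - u 0) * q ^ n" for n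
  proof (induction n)
    case (Suc n)
    have "N (u (Suc (Suc n)) - u (Suc n)) \<le> q * N (u (Suc n) - u n)"
      using c[OF u[of "Suc n"] u[of n]] by (simp add: u_def)
    also have "\<dots> \<le> q * (N (u 1 - u 0) * q ^ n)"
      using Suc q by (intro mult_left_mono) auto
    finally show ?case by (simp add: algebra_simps)
  qed simp
  from converges_geometric[OF u q this] obtain x where x: "converges u x" by blast
  have "converges (\<lambda>n. u (Suc n)) x"
    using x unfolding converges_def by (auto intro: LIMSEQ_Suc)
  moreover have "converges (\<lambda>n. u (Suc n)) (F x)"
  proof (rule convergesI)
    show "N (u (Suc k) - F x) \<le> q * N (u k - x)" for k
      using c[OF u[of k], of x] x by (simp add: u_def converges_def)
    show "(\<lambda>k. q * N (u k - x)) \<longlonglongrightarrow> 0"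
      using x unfolding converges_def by (auto intro: tendsto_mult_right_zero)
  qed (use u F x in \<open>auto simp: converges_def\<close>)
  ultimately have "F x = x" using converges_unique by blast
  then show ?thesis using x by (auto simp: converges_def)
qed

end

text \<open>Maximality enters as surjectivity of I - hA for every h > 0, since the Euler scheme uses
  all the steps \<open>1 / 2 ^ k\<close>.\<close>

locale dissipative_operator = energy_space X ip N
  for X :: "'v::real_vector set" and ip :: "'v \<Rightarrow> 'v \<Rightarrow> real" and N :: "'v \<Rightarrow> real" +
  fixes D :: "'v set" and A :: "'v \<Rightarrow> 'v"
  assumes subspace_D: "subspace D" and D_X: "D \<subseteq> X"
    and A_X: "\<And>x. x \<in> D \<Longrightarrow> A x \<in> X"
    and A_add: "\<And>x y. x \<in> D \<Longrightarrow> y \<in> D \<Longrightarrow> A (x + y) = A x + A y"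
    and A_scale: "\<And>c x. x \<in> D \<Longrightarrow> A (c *\<^sub>R x) = c *\<^sub>R A x"
    and dissipative: "\<And>x. x \<in> D \<Longrightarrow> ip (A x) x \<le> 0"
    and range_condition: "\<And>h y. h > 0 \<Longrightarrow> y \<in> X \<Longrightarrow> \<exists>x\<in>D. x - h *\<^sub>R A x = y"
begin

lemma DX [simp]: "x \<in> D \<Longrightarrow> x \<in> X"
  using D_X by blast

lemma D_add [simp]: "x \<in> D \<Longrightarrow> y \<in> D \<Longrightarrow> x + y \<in> D"
  using subspace_D by (rule subspace_add)

lemma D_diff [simp]: "x \<in> D \<Longrightarrow> y \<in> D \<Longrightarrow> x - y \<in> D"
  using subspace_D by (rule subspace_diff)

lemma D_scale [simp]: "x \<in> D \<Longrightarrow> c *\<^sub>R x \<in> D"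
  using subspace_D by (rule subspace_scale)

lemma D_neg [simp]: "x \<in> D \<Longrightarrow> - x \<in> D"
  using subspace_D by (rule subspace_neg)

lemma A_diff: "x \<in> D \<Longrightarrow> y \<in> D \<Longrightarrow> A (x - y) = A x - A y"
  using A_add[of x "(-1) *\<^sub>R y"] A_scale[of y "-1"] by simp

declare A_X [simp]

text \<open>Pairing x - hAx with x and discarding the dissipative term leaves the square of the norm
  of x; Cauchy-Schwarz then cancels one factor.\<close>

lemma resolvent_bound:
  assumes x: "x \<in> D" and h: "h \<ge> 0"
  shows "N x \<le> N (x - h *\<^sub>R A x)"
proof -
  have "ip x x \<le> ip x x - h * ip (A x) x"
    using mult_nonneg_nonpos[OF h dissipative[OF x]] by simp
  also have "\<dots> = ip (x - h *\<^sub>R A x) x"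
    using x by (simp add: ip_simps)
  also have "\<dots> \<le> N (x - h *\<^sub>R A x) * N x"
    using cauchy_schwarz[of "x - h *\<^sub>R A x" x] x by simp
  finally have "N x * N x \<le> N (x - h *\<^sub>R A x) * N x"
    using N_sq[of x] x by (simp add: power2_eq_square)
  then show ?thesis
    using x by (metis A_X DX N_nonneg X_diff X_scale antisym_conv1 less_eq_real_def mult_right_le_imp_le)
qed

text \<open>The resolvent of \<open>A\<close>, that is, one implicit Euler step of length
  \<open>h\<close>. \<open>J_unique\<close> shows that the choice is forced.\<close>

definition J :: "real \<Rightarrow> 'v \<Rightarrow> 'v" where
  "J h y = (SOME x. x \<in> D \<and> x - h *\<^sub>R A x = y)"

lemma J_D [simp]: "h > 0 \<Longrightarrow> y \<in> X \<Longrightarrow> J h y \<in> D"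
  and J_eq: "h > 0 \<Longrightarrow> y \<in> X \<Longrightarrow> J h y - h *\<^sub>R A (J h y) = y"
proof -
  assume a: "h > 0" "y \<in> X"
  have "\<exists>x. x \<in> D \<and> x - h *\<^sub>R A x = y"
    using range_condition[OF a] by blast
  from someI_ex[OF this] show "J h y \<in> D" "J h y - h *\<^sub>R A (J h y) = y"
    by (simp_all add: J_def)
qed

lemma J_unique:
  assumes h: "h > 0" and x: "x \<in> D"
  shows "J h (x - h *\<^sub>R A x) = x"
proof -
  let ?y = "x - h *\<^sub>R A x"
  have y: "?y \<in> X" using x by simp
  have d: "J h ?y - x \<in> D" using x y h by simp
  have "N (J h ?y - x) \<le> N (J h ?y - x - h *\<^sub>R A (J h ?y - x))"
    using d h by (intro resolvent_bound) auto
  also have "J h ?y - x - h *\<^sub>R A (J h ?y - x) = (J h ?y - h *\<^sub>R A (J h ?y)) - ?y"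
    using x y h by (simp add: A_diff scaleR_diff_right)
  also have "\<dots> = 0" using J_eq[OF h y] by simp
  finally have "N (J h ?y - x) \<le> 0" by simp
  moreover have "0 \<le> N (J h ?y - x)" using DX[OF d] by (rule N_nonneg)
  ultimately have "N (J h ?y - x) = 0" by simp
  then show ?thesis using d N_eq_0[of "J h ?y - x"] by simp
qed

lemma J_contr: "h > 0 \<Longrightarrow> y \<in> X \<Longrightarrow> N (J h y) \<le> N y"
  using resolvent_bound[of "J h y" h] J_eq[of h y] by simp

lemma J_add: "h > 0 \<Longrightarrow> x \<in> X \<Longrightarrow> y \<in> X \<Longrightarrow> J h (x + y) = J h x + J h y"
proof -
  assume a: "h > 0" "x \<in> X" "y \<in> X"
  let ?z = "J h x + J h y"
  have "?z - h *\<^sub>R A ?z = (J h x - h *\<^sub>R A (J h x)) + (J h y - h *\<^sub>R A (J h y))"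
    using a by (simp add: A_add scaleR_add_right)
  also have "\<dots> = x + y" using a by (simp add: J_eq)
  finally show ?thesis using J_unique[of h ?z] a by simp
qed

lemma J_scale: "h > 0 \<Longrightarrow> x \<in> X \<Longrightarrow> J h (c *\<^sub>R x) = c *\<^sub>R J h x"
proof -
  assume a: "h > 0" "x \<in> X"
  let ?z = "c *\<^sub>R J h x"
  have "?z - h *\<^sub>R A ?z = c *\<^sub>R (J h x - h *\<^sub>R A (J h x))"
    using a by (simp add: A_scale scaleR_diff_right)
  also have "\<dots> = c *\<^sub>R x" using a by (simp add: J_eq)
  finally show ?thesis using J_unique[of h ?z] a by simp
qed

lemma J_diff: "h > 0 \<Longrightarrow> x \<in> X \<Longrightarrow> y \<in> X \<Longrightarrow> J h (x - y) = J h x - J h y"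
  using J_add[of h x "(-1) *\<^sub>R y"] J_scale[of h y "-1"] by simp

lemma A_J: "h > 0 \<Longrightarrow> y \<in> X \<Longrightarrow> h *\<^sub>R A (J h y) = J h y - y"
  using J_eq[of h y] by (simp add: algebra_simps)

text \<open>The resolvent equation expresses \<open>A (J h x)\<close> as a difference quotient of
  two elements of \<open>D\<close>. One step thus carries the domain into the domain of the square
  of \<open>A\<close>, where second-order error bounds make sense.\<close>

lemma A_J_D: "h > 0 \<Longrightarrow> x \<in> D \<Longrightarrow> A (J h x) \<in> D"
proof -
  assume a: "h > 0" "x \<in> D"
  have "A (J h x) = (1 / h) *\<^sub>R (J h x - x)"
    using A_J[of h x] a by (simp flip: A_J)
  then show ?thesis using a by simp
qed

text \<open>Both terms of the resolvent equation lie in \<open>D\<close>, so \<open>A\<close> may be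
  applied to it; the result says that \<open>A (J h x)\<close> solves the resolvent equation with
  datum \<open>A x\<close>.\<close>

lemma A_J_commute: "h > 0 \<Longrightarrow> x \<in> D \<Longrightarrow> A (J h x) = J h (A x)"
proof -
  assume a: "h > 0" "x \<in> D"
  have e: "A (J h x) - h *\<^sub>R A (A (J h x)) = A (J h x - h *\<^sub>R A (J h x))"
    using a A_J_D by (simp add: A_diff A_scale)
  also have "\<dots> = A x" using a by (simp add: J_eq)
  finally show ?thesis using J_unique[OF a(1) A_J_D[OF a]] by simp
qed

lemma J_near: "h > 0 \<Longrightarrow> x \<in> D \<Longrightarrow> N (J h x - x) \<le> h * N (A x)"
proof -
  assume a: "h > 0" "x \<in> D"
  have "N (J h x - x) = h * N (J h (A x))"
    using a A_J[of h x] by (simp flip: A_J add: N_scale A_J_commute)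
  also have "\<dots> \<le> h * N (A x)" using a by (intro mult_left_mono J_contr) auto
  finally show ?thesis .
qed

text \<open>
  The errors \<open>v\<^sub>h = J h y - y\<close> satisfy
  \<open>\<parallel>v\<^sub>h - v\<^sub>k\<parallel>\<^sup>2 \<le> \<parallel>v\<^sub>k\<parallel>\<^sup>2 - \<parallel>v\<^sub>h\<parallel>\<^sup>2\<close> for \<open>h \<le> k\<close>,
  so they converge as $h\to 0$, and the limit is orthogonal to the domain.
\<close>

lemma error_monotone:
  assumes h: "0 < h" "h \<le> k" and y: "y \<in> X"
  defines "v \<equiv> \<lambda>h. J h y - y"
  shows "(N (v h - v k))\<^sup>2 \<le> (N (v k))\<^sup>2 - (N (v h))\<^sup>2"
proof (cases "h = k")
  case True
  then show ?thesis by simp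
next
  case False
  then have hk: "0 < h" "h < k" "0 < k" using h by auto
  have vX: "v h \<in> X" "v k \<in> X" using hk y by (auto simp: v_def)
  have Ah: "A (J h y) = (1 / h) *\<^sub>R v h" and Ak: "A (J k y) = (1 / k) *\<^sub>R v k"
    using A_J[of h y] A_J[of k y] hk y by (simp_all add: v_def flip: A_J)
  \<comment> \<open>Dissipativity is applied to the difference of the two resolvents. On each of
    them \<open>A\<close> is the error divided by its own step, so a quadratic inequality in
    \<open>v h\<close> and \<open>v k\<close> results.\<close>
  have "0 \<ge> ip (A (J h y - J k y)) (J h y - J k y)"
    using hk y by (intro dissipative) auto
  also have "A (J h y - J k y) = (1 / h) *\<^sub>R v h - (1 / k) *\<^sub>R v k"
    using hk y by (simp add: A_diff Ah Ak)
  also have "J h y - J k y = v h - v k" by (simp add: v_def)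
  also have "ip ((1 / h) *\<^sub>R v h - (1 / k) *\<^sub>R v k) (v h - v k)
    = (1 / h) * ip (v h) (v h) + (1 / k) * ip (v k) (v k) - (1 / h + 1 / k) * ip (v h) (v k)"
    using vX by (simp add: ip_simps ip_sym[OF vX(2) vX(1)] algebra_simps)
  finally have "(1 / h) * ip (v h) (v h) + (1 / k) * ip (v k) (v k) - (1 / h + 1 / k) * ip (v h) (v k) \<le> 0"
    by simp
  then have "(h * k) * ((1 / h) * ip (v h) (v h) + (1 / k) * ip (v k) (v k) - (1 / h + 1 / k) * ip (v h) (v k)) \<le> 0"
    using hk by (simp add: mult_le_0_iff)
  then have main: "k * ip (v h) (v h) + h * ip (v k) (v k) - (h + k) * ip (v h) (v k) \<le> 0"
    using hk by (simp add: algebra_simps)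
  define a b c where "a = ip (v h) (v h)" and "b = ip (v k) (v k)" and "c = ip (v h) (v k)"
  have m: "k * a + h * b - (h + k) * c \<le> 0" using main by (simp add: a_def b_def c_def)
  have e: "ip (v h - v k) (v h - v k) = a + b - 2 * c"
    using vX by (simp add: ip_simps ip_sym[OF vX(2) vX(1)] a_def b_def c_def)
  then have p: "0 \<le> a + b - 2 * c" using ip_nonneg[of "v h - v k"] vX by simp
  \<comment> \<open>This weights the squared distance of the errors by h + k and the drop of the
    squared norms by k - h. It first forces the drop to be nonnegative; only then may k - h be
    enlarged to h + k.\<close>
  have q: "(h + k) * (a + b - 2 * c) \<le> (k - h) * (b - a)"
    using m by (simp add: algebra_simps)
  have "0 \<le> (h + k) * (a + b - 2 * c)" using p hk by simp
  then have "0 \<le> (k - h) * (b - a)" using q by linarith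
  then have ba: "0 \<le> b - a" using hk by (simp add: zero_le_mult_iff)
  have "(k - h) * (b - a) \<le> (h + k) * (b - a)" using ba hk by (intro mult_right_mono) auto
  then have "(h + k) * (a + b - 2 * c) \<le> (h + k) * (b - a)" using q by linarith
  then have "a + b - 2 * c \<le> b - a" using hk by (simp add: mult_le_cancel_left_pos)
  then show ?thesis using vX e by (simp add: N_sq a_def b_def)
qed

text \<open>The errors of the resolvents at \<open>y\<close> have a limit \<open>w\<close>, and
  \<open>w\<close> must vanish: \<open>J 1 w\<close> lies in \<open>D\<close> and is orthogonal to
  \<open>w\<close>, while pairing \<open>w = J 1 w - A (J 1 w)\<close> with \<open>J 1 w\<close>
  gives at least the squared norm of \<open>J 1 w\<close>.\<close>

lemma D_dense:
  assumes y: "y \<in> X" and e: "\<epsilon> > 0"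
  shows "\<exists>x\<in>D. N (y - x) < \<epsilon>"
proof -
  define v where "v n = J (1 / real (Suc n)) y - y" for n
  have vX: "v n \<in> X" for n using y by (simp add: v_def)
  have mono: "(N (v n - v l))\<^sup>2 \<le> (N (v l))\<^sup>2 - (N (v n))\<^sup>2" if "l \<le> n" for l n
    unfolding v_def using that y by (intro error_monotone) (auto simp: field_simps)
  have "decseq (\<lambda>n. (N (v n))\<^sup>2)"
    unfolding decseq_def using mono by (smt (verit) zero_le_power2)
  then have "convergent (\<lambda>n. (N (v n))\<^sup>2)"
    by (intro Bseq_monoseq_convergent decseq_imp_monoseq decseq_bounded[where B = 0]) auto
  then have Cau: "Cauchy (\<lambda>n. (N (v n))\<^sup>2)" by (rule convergent_Cauchy)
  have "\<exists>w. converges v w"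
  proof (rule converges_Cauchy[OF vX])
    fix \<delta> :: real assume d: "\<delta> > 0"
    then have "\<delta>\<^sup>2 > 0" by simp
    from CauchyD[OF Cau this] obtain K where K: "\<And>i j. i \<ge> K \<Longrightarrow> j \<ge> K \<Longrightarrow> norm ((N (v i))\<^sup>2 - (N (v j))\<^sup>2) < \<delta>\<^sup>2"
      by blast
    have "N (v i - v j) < \<delta>" if ij: "i \<ge> K" "j \<ge> K" for i j
    proof -
      have "(N (v i - v j))\<^sup>2 \<le> \<bar>(N (v i))\<^sup>2 - (N (v j))\<^sup>2\<bar>"
      proof (cases "j \<le> i")
        case True then show ?thesis using mono[of j i] by simp
      next
        case False then show ?thesis using mono[of i j] N_commute[OF vX[of i] vX[of j]] by simp
      qed
      also have "\<dots> < \<delta>\<^sup>2" using K[OF ij] by simp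
      finally show ?thesis using d by (meson less_eq_real_def power2_less_imp_less)
    qed
    then show "\<exists>K. \<forall>i\<ge>K. \<forall>j\<ge>K. N (v i - v j) < \<delta>" by blast
  qed
  then obtain w where w: "converges v w" by blast
  then have wX: "w \<in> X" by (simp add: converges_def)
  \<comment> \<open>Dissipativity at \<open>J ?h y - d\<close>, multiplied by the step. The only
    occurrence of \<open>A d\<close> then carries the factor \<open>?h\<close> and disappears in the
    limit.\<close>
  have key: "ip w w + ip w y \<le> ip w d" if d: "d \<in> D" for d
  proof -
    have bound: "ip (v n) (v n) + ip (v n) (y - d) - (1 / real (Suc n)) * ip (A d) (v n + y - d) \<le> 0" for n
    proof -
      let ?h = "1 / real (Suc n)"
      have J: "J ?h y \<in> D" using y by simp
      have AJ: "?h *\<^sub>R A (J ?h y) = v n" unfolding v_def using y by (intro A_J) auto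
      have "0 \<ge> ?h * ip (A (J ?h y - d)) (J ?h y - d)"
        using dissipative[of "J ?h y - d"] J d by (intro mult_nonneg_nonpos) auto
      also have "?h * ip (A (J ?h y - d)) (J ?h y - d) = ip (?h *\<^sub>R A (J ?h y) - ?h *\<^sub>R A d) (J ?h y - d)"
        using J d by (simp only: A_diff ip_scale[symmetric] scaleR_diff_right A_X X_diff DX)
      also have "\<dots> = ip (v n - ?h *\<^sub>R A d) (v n + y - d)"
        unfolding AJ by (simp add: v_def)
      also have "\<dots> = ip (v n) (v n) + ip (v n) (y - d) - ?h * ip (A d) (v n + y - d)"
        using vX[of n] y d by (simp add: ip_simps algebra_simps)
      finally show ?thesis by simp
    qed
    have l1: "(\<lambda>n. ip (v n) (y - d)) \<longlonglongrightarrow> ip w (y - d)"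
      using w y d by (intro converges_ip) auto
    have l2: "(\<lambda>n. ip (v n) (v n)) \<longlonglongrightarrow> ip w w"
      using tendsto_power[OF converges_norm[OF w], of 2] vX wX by (simp add: N_sq)
    have l3: "(\<lambda>n. ip (v n + y - d) (A d)) \<longlonglongrightarrow> ip (w + y - d) (A d)"
      using y d by (intro converges_ip converges_diff converges_add converges_const w) auto
    have l4: "(\<lambda>n. (1 / real (Suc n)) * ip (v n + y - d) (A d)) \<longlonglongrightarrow> 0 * ip (w + y - d) (A d)"
      by (intro tendsto_mult l3) (use LIMSEQ_inverse_real_of_nat in \<open>simp add: inverse_eq_divide\<close>)
    have eq: "ip (A d) (v n + y - d) = ip (v n + y - d) (A d)" for n
      using vX y d by (intro ip_sym) auto
    have "ip w w + ip w (y - d) - 0 * ip (w + y - d) (A d) \<le> 0"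
      using tendsto_diff[OF tendsto_add[OF l2 l1] l4] bound
      by (intro LIMSEQ_le_const2[where a = 0]) (auto simp: eq)
    then show ?thesis
      using wX y d by (simp add: ip_simps)
  qed
  \<comment> \<open>A linear functional bounded below on a subspace vanishes there. The factor
    \<open>t\<close> makes it take the value one below the bound.\<close>
  have orth: "ip w d = 0" if d: "d \<in> D" for d
  proof (rule ccontr)
    assume nz: "ip w d \<noteq> 0"
    define t where "t = (ip w w + ip w y - 1) / ip w d"
    have "ip w w + ip w y \<le> ip w (t *\<^sub>R d)" using d by (intro key) auto
    also have "\<dots> = ip w w + ip w y - 1" using nz d wX by (simp add: ip_simps t_def)
    finally show False by simp
  qed
  have J1: "J 1 w \<in> D" "J 1 w - A (J 1 w) = w" using J_eq[of 1 w] wX by auto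
  have "ip w (J 1 w) = ip (J 1 w) (J 1 w) - ip (A (J 1 w)) (J 1 w)"
    using J1 by (metis A_X DX ip_diff)
  then have "ip (J 1 w) (J 1 w) \<le> 0" using orth[OF J1(1)] dissipative[OF J1(1)] by simp
  then have "J 1 w = 0" using ip_definite ip_nonneg J1(1) by (metis DX antisym)
  moreover have "A 0 = 0" using A_scale[of 0 0] subspace_0[OF subspace_D] by simp
  ultimately have "w = 0" using J1(2) by simp
  then have "(\<lambda>n. N (v n)) \<longlonglongrightarrow> 0" using w by (simp add: converges_def)
  then have "\<forall>\<^sub>F n in sequentially. N (v n) < \<epsilon>" using e by (rule order_tendstoD)
  then obtain n where "N (v n) < \<epsilon>" by (auto simp: eventually_sequentially)
  then have "N (y - J (1 / real (Suc n)) y) < \<epsilon>"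
    using y N_commute[of y "J (1 / real (Suc n)) y"] by (simp add: v_def)
  then show ?thesis using y by (intro bexI[of _ "J (1 / real (Suc n)) y"]) auto
qed

section \<open>The implicit Euler scheme with dyadic steps\<close>

lemma Jn_X [simp]: "h > 0 \<Longrightarrow> x \<in> X \<Longrightarrow> (J h ^^ n) x \<in> X"
  by (induction n) auto

lemma Jn_D [simp]: "h > 0 \<Longrightarrow> x \<in> D \<Longrightarrow> (J h ^^ n) x \<in> D"
  by (induction n) auto

lemma Jn_contr: "h > 0 \<Longrightarrow> x \<in> X \<Longrightarrow> N ((J h ^^ n) x) \<le> N x"
  by (induction n) (auto intro: order_trans[OF J_contr])

lemma Jn_add: "h > 0 \<Longrightarrow> x \<in> X \<Longrightarrow> y \<in> X \<Longrightarrow> (J h ^^ n) (x + y) = (J h ^^ n) x + (J h ^^ n) y"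
  by (induction n) (auto simp: J_add)

lemma Jn_scale: "h > 0 \<Longrightarrow> x \<in> X \<Longrightarrow> (J h ^^ n) (c *\<^sub>R x) = c *\<^sub>R (J h ^^ n) x"
  by (induction n) (auto simp: J_scale)

lemma Jn_diff: "h > 0 \<Longrightarrow> x \<in> X \<Longrightarrow> y \<in> X \<Longrightarrow> (J h ^^ n) (x - y) = (J h ^^ n) x - (J h ^^ n) y"
  by (induction n) (auto simp: J_diff)

lemma A_Jn_commute: "h > 0 \<Longrightarrow> x \<in> D \<Longrightarrow> A ((J h ^^ n) x) = (J h ^^ n) (A x)"
  by (induction n) (auto simp: A_J_commute)

text \<open>Each step moves the current point by at most \<open>h\<close> times the norm of its
  image under \<open>A\<close>, and these images never grow because \<open>A\<close> commutes with
  the contraction \<open>J h\<close>.\<close>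

lemma Jn_near: "h > 0 \<Longrightarrow> x \<in> D \<Longrightarrow> N ((J h ^^ n) x - x) \<le> real n * h * N (A x)"
proof (induction n)
  case (Suc n)
  have "N ((J h ^^ Suc n) x - x) \<le> N (J h ((J h ^^ n) x) - (J h ^^ n) x) + N ((J h ^^ n) x - x)"
    using Suc.prems by (simp add: N_diff_triangle)
  also have "\<dots> \<le> h * N (A ((J h ^^ n) x)) + real n * h * N (A x)"
    using Suc by (intro add_mono J_near) auto
  also have "\<dots> \<le> h * N (A x) + real n * h * N (A x)"
    using Suc.prems by (intro add_right_mono mult_left_mono) (auto simp: A_Jn_commute Jn_contr)
  finally show ?case by (simp add: algebra_simps)
qed simp

text \<open>
  Two half steps differ from one step at second order because
  $(I-\frac h2 A)^2=(I-hA)+\frac{h^2}4A^2$.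
\<close>

lemma half_step:
  assumes h: "h > 0" and x: "x \<in> D" and Ax: "A x \<in> D"
  shows "N (J h x - J (h / 2) (J (h / 2) x)) \<le> h\<^sup>2 / 4 * N (A (A x))"
proof -
  let ?w = "J h x"
  have w: "?w \<in> D" "A ?w \<in> D" "A (A ?w) \<in> X" using A_J_D[OF h x] h x by auto
  have AAw: "A (A ?w) = J h (A (A x))" using A_J_commute h x Ax by metis
  \<comment> \<open>\<open>p\<close> is the intermediate value that a half step sends exactly to
    \<open>?w\<close>. Applying I - (h/2)A once more reveals the datum from which two half steps
    reach \<open>?w\<close>: it is \<open>x\<close> perturbed by a second-order term.\<close>
  define p where "p = ?w - (h / 2) *\<^sub>R A ?w"
  have p: "p \<in> D" using w by (simp add: p_def)
  have "p - (h / 2) *\<^sub>R A p = (?w - h *\<^sub>R A ?w) + (h\<^sup>2 / 4) *\<^sub>R A (A ?w)"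
    using w by (simp add: p_def A_diff A_scale scaleR_diff_right power2_eq_square algebra_simps
      flip: scaleR_add_left)
  also have "\<dots> = x + (h\<^sup>2 / 4) *\<^sub>R A (A ?w)"
    using h x by (simp add: J_eq)
  finally have "p = J (h / 2) (x + (h\<^sup>2 / 4) *\<^sub>R A (A ?w))"
    using J_unique[of "h / 2" p] p h by simp
  moreover have "?w = J (h / 2) p"
    using J_unique[of "h / 2" ?w] w h by (simp add: p_def)
  ultimately have "?w = J (h / 2) (J (h / 2) (x + (h\<^sup>2 / 4) *\<^sub>R A (A ?w)))" by metis
  also have "\<dots> = J (h / 2) (J (h / 2) x) + (h\<^sup>2 / 4) *\<^sub>R J (h / 2) (J (h / 2) (A (A ?w)))"
    using h x w(3) by (simp add: J_add J_scale)
  finally have "?w = J (h / 2) (J (h / 2) x) + (h\<^sup>2 / 4) *\<^sub>R J (h / 2) (J (h / 2) (A (A ?w)))" .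
  then have "?w - J (h / 2) (J (h / 2) x) = (h\<^sup>2 / 4) *\<^sub>R J (h / 2) (J (h / 2) (A (A ?w)))"
    by (metis add_diff_cancel_left')
  then have "N (?w - J (h / 2) (J (h / 2) x)) = h\<^sup>2 / 4 * N (J (h / 2) (J (h / 2) (A (A ?w))))"
    using h w by (simp add: N_scale)
  also have "\<dots> \<le> h\<^sup>2 / 4 * N (A (A x))"
    using h w Ax by (intro mult_left_mono)
      (auto simp: AAw intro!: order_trans[OF J_contr] J_contr)
  finally show ?thesis .
qed

text \<open>Local errors add up without amplification, since a pair of half steps is a contraction,
  and each local error is bounded by the norm of \<open>A (A x)\<close> because \<open>A\<close>
  commutes with the powers of \<open>J h\<close>.\<close>

lemma half_steps:
  assumes h: "h > 0" and x: "x \<in> D" and Ax: "A x \<in> D"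
  shows "N ((J h ^^ n) x - (J (h / 2) ^^ (2 * n)) x) \<le> real n * (h\<^sup>2 / 4) * N (A (A x))"
proof (induction n)
  case (Suc n)
  let ?K = "\<lambda>y. J (h / 2) (J (h / 2) y)"
  let ?u = "(J h ^^ n) x" and ?v = "(J (h / 2) ^^ (2 * n)) x"
  have X: "?u \<in> D" "?v \<in> X" "A ?u \<in> D" "A (A ?u) = (J h ^^ n) (A (A x))"
    using h x Ax by (auto simp: A_Jn_commute)
  have "N (J h ?u - ?K ?v) \<le> N (J h ?u - ?K ?u) + N (?K ?u - ?K ?v)"
    using X h by (intro N_diff_triangle) auto
  also have "N (J h ?u - ?K ?u) \<le> h\<^sup>2 / 4 * N (A (A ?u))"
    using X h by (intro half_step)
  also have "N (A (A ?u)) \<le> N (A (A x))" using X h Ax by (simp add: Jn_contr)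
  also have "N (?K ?u - ?K ?v) \<le> N (?u - ?v)"
    using X h by (auto simp flip: J_diff intro!: order_trans[OF J_contr] J_contr)
  also note Suc
  finally have "N (J h ?u - ?K ?v) \<le> h\<^sup>2 / 4 * N (A (A x)) + real n * (h\<^sup>2 / 4) * N (A (A x))"
    by (simp add: mult_left_mono)
  then show ?case by (simp add: algebra_simps)
qed simp

definition step :: "nat \<Rightarrow> real" where "step k = 1 / 2 ^ k"

text \<open>The floor counts the whole steps that fit into the time interval from 0 to
  \<open>t\<close>. The remaining time is shorter than one step and is left out, at the cost of an
  error of order \<open>step k\<close> on \<open>D\<close>.\<close>

definition Euler :: "nat \<Rightarrow> real \<Rightarrow> 'v \<Rightarrow> 'v" where
  "Euler k t x = (J (step k) ^^ nat \<lfloor>t * 2 ^ k\<rfloor>) x"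

lemma step_pos [simp]: "step k > 0"
  by (simp add: step_def)

lemma step_nonneg [simp]: "step k \<ge> 0"
  by (simp add: step_def)

lemma step_lim: "step \<longlonglongrightarrow> 0"
  unfolding step_def using LIMSEQ_realpow_zero[of "1/2"] by (simp add: power_one_over)

lemma steps_le: "t \<ge> 0 \<Longrightarrow> real (nat \<lfloor>t * 2 ^ k\<rfloor>) * step k \<le> t"
  by (simp add: step_def field_simps)

lemma Euler_X [simp]: "x \<in> X \<Longrightarrow> Euler k t x \<in> X"
  by (simp add: Euler_def)

lemma Euler_contr: "x \<in> X \<Longrightarrow> N (Euler k t x) \<le> N x"
  by (simp add: Euler_def Jn_contr)

lemma Euler_diff: "x \<in> X \<Longrightarrow> y \<in> X \<Longrightarrow> Euler k t (x - y) = Euler k t x - Euler k t y"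
  by (simp add: Euler_def Jn_diff)

lemma Euler_near: "x \<in> D \<Longrightarrow> t \<ge> 0 \<Longrightarrow> N (Euler k t x - x) \<le> t * N (A x)"
  unfolding Euler_def
  by (rule order_trans[OF Jn_near mult_right_mono[OF steps_le]]) auto

text \<open>Passing to half the step costs one accumulated halving error and at most one additional
  half step. Both are of order \<open>step k\<close>, which makes the sequence of schemes
  geometric.\<close>

lemma Euler_refine:
  assumes x: "x \<in> D" "A x \<in> D" and t: "t \<ge> 0"
  shows "N (Euler (Suc k) t x - Euler k t x) \<le> (t * N (A (A x)) + N (A x)) * (1 / 2) ^ k"
proof -
  let ?n = "nat \<lfloor>t * 2 ^ k\<rfloor>" and ?h = "step k"
  have h2: "step (Suc k) = ?h / 2" by (simp add: step_def)
  have "\<lfloor>t * 2 ^ Suc k\<rfloor> = 2 * \<lfloor>t * 2 ^ k\<rfloor> \<or> \<lfloor>t * 2 ^ Suc k\<rfloor> = 2 * \<lfloor>t * 2 ^ k\<rfloor> + 1"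
    by (simp add: algebra_simps) linarith
  then have "nat \<lfloor>t * 2 ^ Suc k\<rfloor> = 2 * ?n \<or> nat \<lfloor>t * 2 ^ Suc k\<rfloor> = Suc (2 * ?n)"
    using t by (auto simp: nat_mult_distrib nat_add_distrib)
  \<comment> \<open>\<open>j\<close> is the possible additional half step: doubling a number doubles
    its floor or exceeds the doubled floor by 1.\<close>
  then obtain j where j: "nat \<lfloor>t * 2 ^ Suc k\<rfloor> = j + 2 * ?n" "j = 0 \<or> j = 1" by force
  let ?v = "(J (?h / 2) ^^ (2 * ?n)) x"
  have v: "?v \<in> D" "N (A ?v) \<le> N (A x)" using x by (auto simp: A_Jn_commute Jn_contr)
  have "N ((J (?h / 2) ^^ j) ?v - ?v) \<le> real j * (?h / 2) * N (A ?v)"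
    using v by (intro Jn_near) auto
  also have "\<dots> \<le> ?h * N (A x)"
    using v j x by (intro mult_mono) auto
  finally have 1: "N (Euler (Suc k) t x - ?v) \<le> ?h * N (A x)"
    unfolding Euler_def h2 j(1) by (simp add: funpow_add)
  have "N (?v - Euler k t x) \<le> real ?n * (?h\<^sup>2 / 4) * N (A (A x))"
    unfolding Euler_def using half_steps[of ?h x ?n] x N_commute[of ?v "(J ?h ^^ ?n) x"] by simp
  also have "\<dots> = (real ?n * ?h) * (?h / 4) * N (A (A x))" by (simp add: power2_eq_square)
  also have "\<dots> \<le> t * ?h * N (A (A x))"
    using steps_le[OF t, of k] x t step_pos[of k]
    by (intro mult_right_mono mult_mono) (auto simp: less_imp_le)
  finally have 2: "N (?v - Euler k t x) \<le> t * ?h * N (A (A x))" .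
  have "N (Euler (Suc k) t x - Euler k t x) \<le> N (Euler (Suc k) t x - ?v) + N (?v - Euler k t x)"
    using x v by (intro N_diff_triangle) auto
  also have "\<dots> \<le> ?h * N (A x) + t * ?h * N (A (A x))" using 1 2 by (rule add_mono)
  finally show ?thesis by (simp add: step_def field_simps power_one_over)
qed

lemma D2_dense:
  assumes y: "y \<in> X" and e: "\<epsilon> > 0"
  shows "\<exists>x\<in>D. A x \<in> D \<and> N (y - x) < \<epsilon>"
proof -
  obtain x where x: "x \<in> D" "N (y - x) < \<epsilon> / 2" using D_dense[OF y, of "\<epsilon> / 2"] e by auto
  \<comment> \<open>The summand 1 guards against a vanishing \<open>A x\<close>; the resolvent step
    then moves \<open>x\<close> by less than half of \<epsilon>.\<close>
  define h where "h = \<epsilon> / 2 / (N (A x) + 1)"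
  have "N (A x) \<ge> 0" using x by simp
  then have h: "h > 0" "h * N (A x) < \<epsilon> / 2" using e by (simp_all add: h_def field_simps)
  have "N (y - J h x) \<le> N (y - x) + N (x - J h x)"
    using y x h by (intro N_diff_triangle) auto
  also have "N (x - J h x) \<le> h * N (A x)"
    using J_near[OF h(1) x(1)] N_commute[of x "J h x"] x h by simp
  finally have "N (y - J h x) < \<epsilon>" using x h by simp
  then show ?thesis using A_J_D[OF h(1) x(1)] x h by (intro bexI[of _ "J h x"]) auto
qed

text \<open>\<open>Euler_refine\<close> settles data in the domain of the square of
  \<open>A\<close>. Such data are dense and every scheme is a contraction, so the Cauchy property
  extends to all of \<open>X\<close>.\<close>

lemma Euler_converges:
  assumes x: "x \<in> X" and t: "t \<ge> 0"
  shows "\<exists>y. converges (\<lambda>k. Euler k t x) y"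
proof (rule converges_Cauchy)
  show "Euler k t x \<in> X" for k using x by simp
  fix \<epsilon> :: real assume e: "\<epsilon> > 0"
  obtain z where z: "z \<in> D" "A z \<in> D" "N (x - z) < \<epsilon> / 4" using D2_dense[OF x, of "\<epsilon> / 4"] e by auto
  obtain w where w: "converges (\<lambda>k. Euler k t z) w"
    using converges_geometric[where q = "1/2", OF _ _ _ Euler_refine[OF z(1,2) t]] z by auto
  then have wX: "w \<in> X" by (simp add: converges_def)
  have "\<forall>\<^sub>F k in sequentially. N (Euler k t z - w) < \<epsilon> / 4"
    using w e unfolding converges_def by (intro order_tendstoD(2)[where y = 0]) auto
  then obtain K where K: "\<And>k. k \<ge> K \<Longrightarrow> N (Euler k t z - w) < \<epsilon> / 4"
    by (auto simp: eventually_sequentially)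
  have near: "N (Euler k t x - w) < \<epsilon> / 2" if "k \<ge> K" for k
  proof -
    have "N (Euler k t x - w) \<le> N (Euler k t x - Euler k t z) + N (Euler k t z - w)"
      using x z wX by (intro N_diff_triangle) auto
    also have "N (Euler k t x - Euler k t z) \<le> N (x - z)"
      using x z by (simp add: Euler_contr flip: Euler_diff)
    finally show ?thesis using K[OF that] z by simp
  qed
  have "N (Euler i t x - Euler j t x) < \<epsilon>" if "i \<ge> K" "j \<ge> K" for i j
  proof -
    have "N (Euler i t x - Euler j t x) \<le> N (Euler i t x - w) + N (w - Euler j t x)"
      using x wX by (intro N_diff_triangle) auto
    then show ?thesis
      using near[OF that(1)] near[OF that(2)] N_commute[of w "Euler j t x"] x wX by simp
  qed
  then show "\<exists>K. \<forall>i\<ge>K. \<forall>j\<ge>K. N (Euler i t x - Euler j t x) < \<epsilon>" by blast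
qed

section \<open>The limit semigroup\<close>

definition T :: "real \<Rightarrow> 'v \<Rightarrow> 'v" where
  "T t x = (SOME y. converges (\<lambda>k. Euler k t x) y)"

lemma T_converges: "x \<in> X \<Longrightarrow> t \<ge> 0 \<Longrightarrow> converges (\<lambda>k. Euler k t x) (T t x)"
  unfolding T_def by (rule someI_ex[OF Euler_converges])

lemma T_X [simp]: "x \<in> X \<Longrightarrow> t \<ge> 0 \<Longrightarrow> T t x \<in> X"
  using T_converges by (simp add: converges_def)

lemma T_contr: "x \<in> X \<Longrightarrow> t \<ge> 0 \<Longrightarrow> N (T t x) \<le> N x"
  by (rule converges_norm_le[OF T_converges _ tendsto_const]) (auto simp: Euler_contr)

lemma T_add: "x \<in> X \<Longrightarrow> y \<in> X \<Longrightarrow> t \<ge> 0 \<Longrightarrow> T t (x + y) = T t x + T t y"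
  using converges_unique[OF T_converges[of "x + y" t]] converges_add[OF T_converges[of x t] T_converges[of y t]]
  by (simp add: Euler_def Jn_add)

lemma T_scale: "x \<in> X \<Longrightarrow> t \<ge> 0 \<Longrightarrow> T t (c *\<^sub>R x) = c *\<^sub>R T t x"
  using converges_unique[OF T_converges[of "c *\<^sub>R x" t]] converges_scale[OF T_converges[of x t], of c]
  by (simp add: Euler_def Jn_scale)

lemma T_diff: "x \<in> X \<Longrightarrow> y \<in> X \<Longrightarrow> t \<ge> 0 \<Longrightarrow> T t (x - y) = T t x - T t y"
  using T_add[of x "(-1) *\<^sub>R y" t] T_scale[of y t "-1"] by simp

lemma T_0: "x \<in> X \<Longrightarrow> T 0 x = x"
  using converges_unique[OF T_converges[of x 0] ] converges_const[of x] by (simp add: Euler_def)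

lemma T_near: "x \<in> D \<Longrightarrow> t \<ge> 0 \<Longrightarrow> N (T t x - x) \<le> t * N (A x)"
  by (rule converges_norm_le[OF converges_diff[OF T_converges converges_const] _ tendsto_const]) (auto simp: Euler_near)

text \<open>The floor is additive up to 1, so the scheme at time s + t differs from the composed
  scheme by at most one Euler step, whose length on \<open>D\<close> is controlled. Contractivity
  allows the inner limit to be replaced by its approximations.\<close>

lemma T_semigroup_D:
  assumes x: "x \<in> D" and s: "s \<ge> 0" and t: "t \<ge> 0"
  shows "T (s + t) x = T s (T t x)"
proof (rule converges_unique)
  show "converges (\<lambda>k. Euler k (s + t) x) (T (s + t) x)" using x s t by (intro T_converges) auto
  have "converges (\<lambda>k. Euler k s (Euler k t x)) (T s (T t x))"
  proof (rule converges_close)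
    show "converges (\<lambda>k. Euler k s (T t x)) (T s (T t x))" using x s t by (intro T_converges) auto
    show "N (Euler k s (Euler k t x) - Euler k s (T t x)) \<le> N (Euler k t x - T t x)" for k
      using x t by (simp add: Euler_contr flip: Euler_diff)
    show "(\<lambda>k. N (Euler k t x - T t x)) \<longlonglongrightarrow> 0" using T_converges[of x t] x t by (simp add: converges_def)
  qed (use x in auto)
  then show "converges (\<lambda>k. Euler k (s + t) x) (T s (T t x))"
  proof (rule converges_close)
    show "(\<lambda>k. step k * N (A x)) \<longlonglongrightarrow> 0" by (intro tendsto_mult_left_zero step_lim)
    show "N (Euler k (s + t) x - Euler k s (Euler k t x)) \<le> step k * N (A x)" for k
    proof -
      let ?m = "nat \<lfloor>s * 2 ^ k\<rfloor>" and ?n = "nat \<lfloor>t * 2 ^ k\<rfloor>"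
      have "\<lfloor>(s + t) * 2 ^ k\<rfloor> = \<lfloor>s * 2 ^ k\<rfloor> + \<lfloor>t * 2 ^ k\<rfloor> \<or> \<lfloor>(s + t) * 2 ^ k\<rfloor> = \<lfloor>s * 2 ^ k\<rfloor> + \<lfloor>t * 2 ^ k\<rfloor> + 1"
        by (simp add: algebra_simps) linarith
      then have "nat \<lfloor>(s + t) * 2 ^ k\<rfloor> = ?m + ?n \<or> nat \<lfloor>(s + t) * 2 ^ k\<rfloor> = Suc (?m + ?n)"
        using s t by (auto simp: nat_add_distrib)
      then obtain j where j: "nat \<lfloor>(s + t) * 2 ^ k\<rfloor> = j + (?m + ?n)" "j = 0 \<or> j = 1" by force
      let ?v = "(J (step k) ^^ (?m + ?n)) x"
      have v: "?v \<in> D" "N (A ?v) \<le> N (A x)" using x by (auto simp: A_Jn_commute Jn_contr)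
      have "N ((J (step k) ^^ j) ?v - ?v) \<le> real j * step k * N (A ?v)"
        using v by (intro Jn_near) auto
      also have "\<dots> \<le> step k * N (A x)"
        using v j x by (intro mult_mono) auto
      finally show ?thesis unfolding Euler_def j(1) by (simp add: funpow_add)
    qed
  qed (use x in auto)
qed

lemma eq_by_small:
  assumes "x \<in> X" "y \<in> X" "\<And>\<epsilon>. \<epsilon> > 0 \<Longrightarrow> N (x - y) \<le> \<epsilon>"
  shows "x = y"
proof -
  have "N (x - y) \<le> 0" by (rule field_le_epsilon) (simp add: assms(3))
  then have "N (x - y) = 0" using assms by (intro antisym) auto
  then show ?thesis using N_eq_0[of "x - y"] assms by simp
qed

lemma T_semigroup:
  assumes x: "x \<in> X" and s: "s \<ge> 0" and t: "t \<ge> 0"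
  shows "T (s + t) x = T s (T t x)"
proof (rule eq_by_small)
  fix \<epsilon> :: real assume e: "\<epsilon> > 0"
  obtain z where z: "z \<in> D" "N (x - z) < \<epsilon> / 2" using D_dense[OF x, of "\<epsilon> / 2"] e by auto
  have "N (T (s + t) x - T s (T t x)) = N (T (s + t) (x - z) - T s (T t (x - z)))"
    using x z s t by (simp add: T_diff T_semigroup_D)
  also have "\<dots> \<le> N (T (s + t) (x - z)) + N (T s (T t (x - z)))"
    using x z s t by (intro N_diff_le) auto
  also have "\<dots> \<le> N (x - z) + N (x - z)"
    using x z s t by (intro add_mono T_contr order_trans[OF T_contr]) auto
  finally show "N (T (s + t) x - T s (T t x)) \<le> \<epsilon>" using z by simp
qed (use x s t in auto)

lemma T_continuous_0: "x \<in> X \<Longrightarrow> ((\<lambda>t. N (T t x - x)) \<longlongrightarrow> 0) (at_right 0)"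
proof (rule tendstoI)
  fix \<epsilon> :: real assume x: "x \<in> X" and e: "\<epsilon> > 0"
  obtain z where z: "z \<in> D" "N (x - z) < \<epsilon> / 4" using D_dense[OF x, of "\<epsilon> / 4"] e by auto
  define d where "d = \<epsilon> / 4 / (N (A z) + 1)"
  have NA: "N (A z) \<ge> 0" using z by simp
  then have d: "d > 0" using e by (simp add: d_def)
  have "dist (N (T t x - x)) 0 < \<epsilon>" if t: "t \<in> {0<..<d}" for t
  proof -
    have t0: "t \<ge> 0" using t by simp
    have "N (T t x - x) \<le> N (T t x - T t z) + N (T t z - x)"
      using x z t0 by (intro N_diff_triangle) auto
    also have "N (T t z - x) \<le> N (T t z - z) + N (z - x)"
      using x z t0 by (intro N_diff_triangle) auto
    also have "N (T t x - T t z) \<le> N (x - z)" using x z t0 by (simp add: T_contr flip: T_diff)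
    also have "N (T t z - z) \<le> t * N (A z)" using z t0 by (intro T_near)
    also have "t * N (A z) \<le> d * (N (A z) + 1)" using t NA by (intro mult_mono) auto
    also have "d * (N (A z) + 1) = \<epsilon> / 4"
    proof -
      have "N (A z) + 1 \<noteq> 0" using NA by simp
      then show ?thesis unfolding d_def by (rule nonzero_divide_eq_eq[THEN iffD1, OF _ refl, symmetric])
    qed
    finally show ?thesis using z N_commute[of z x] x t0 e by simp
  qed
  then show "\<forall>\<^sub>F t in at_right 0. dist (N (T t x - x)) 0 < \<epsilon>"
    using d by (auto simp: eventually_at_right_field intro!: exI[of _ d])
qed

text \<open>Every Euler increment is \<open>h\<close> times a resolvent power applied to
  \<open>A x\<close>, so its deviation from linear growth measures how far such powers move
  \<open>A x\<close>. Since \<open>A x\<close> may lie outside \<open>D\<close>, it is compared with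
  a nearby \<open>z\<close> in \<open>D\<close>.\<close>

lemma T_deriv:
  assumes x: "x \<in> D"
  shows "semigroup_deriv N T x (A x)"
  unfolding semigroup_deriv_def
proof (rule tendstoI)
  fix \<epsilon> :: real assume e: "\<epsilon> > 0"
  let ?y = "A x"
  have y: "?y \<in> X" using x by simp
  obtain z where z: "z \<in> D" "N (?y - z) < \<epsilon> / 4" using D_dense[OF y, of "\<epsilon> / 4"] e by auto
  have NA: "N (A z) \<ge> 0" using z by simp
  define d where "d = \<epsilon> / 4 / (N (A z) + 1)"
  have d: "d > 0" using e NA by (simp add: d_def)
  \<comment> \<open>In the bracket, the approximation error counts twice, once before and once after
    the resolvent powers are applied; the remaining term is \<open>Jn_near\<close> for
    \<open>z\<close>.\<close>
  have step: "N ((J h ^^ n) x - x - (real n * h) *\<^sub>R ?y)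
      \<le> real n * h * (2 * N (?y - z) + real n * h * N (A z))" if h: "h > 0" for h n
  proof (induction n)
    case (Suc n)
    let ?u = "(J h ^^ n) x"
    have u: "?u \<in> D" using h x by simp
    have "J h ?u - ?u = h *\<^sub>R (J h ^^ Suc n) ?y"
      using A_J[of h ?u] h u x by (simp add: A_J_commute A_Jn_commute)
    then have "(J h ^^ Suc n) x - x - (real (Suc n) * h) *\<^sub>R ?y
      = (?u - x - (real n * h) *\<^sub>R ?y) + h *\<^sub>R ((J h ^^ Suc n) ?y - ?y)"
      by (simp add: algebra_simps)
    then have "N ((J h ^^ Suc n) x - x - (real (Suc n) * h) *\<^sub>R ?y)
      \<le> N (?u - x - (real n * h) *\<^sub>R ?y) + N (h *\<^sub>R ((J h ^^ Suc n) ?y - ?y))"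
      using h x u y by (simp only:) (intro N_triangle, auto simp del: funpow.simps)
    also have "N (h *\<^sub>R ((J h ^^ Suc n) ?y - ?y)) = h * N ((J h ^^ Suc n) ?y - ?y)"
      using h y by (simp add: N_scale del: funpow.simps)
    also have "N ((J h ^^ Suc n) ?y - ?y) \<le> 2 * N (?y - z) + real (Suc n) * h * N (A z)"
    proof -
      have "N ((J h ^^ Suc n) ?y - ?y) \<le> N ((J h ^^ Suc n) ?y - (J h ^^ Suc n) z) + N ((J h ^^ Suc n) z - ?y)"
        using h y z by (intro N_diff_triangle Jn_X) auto
      also have "N ((J h ^^ Suc n) z - ?y) \<le> N ((J h ^^ Suc n) z - z) + N (z - ?y)"
        using h y z by (intro N_diff_triangle Jn_X) auto
      also have "N ((J h ^^ Suc n) ?y - (J h ^^ Suc n) z) \<le> N (?y - z)"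
        using h y z by (simp add: Jn_contr flip: Jn_diff del: funpow.simps)
      also have "N ((J h ^^ Suc n) z - z) \<le> real (Suc n) * h * N (A z)"
        using h z by (intro Jn_near)
      finally show ?thesis using N_commute[of z ?y] y z by simp
    qed
    also note Suc
    finally have "N ((J h ^^ Suc n) x - x - (real (Suc n) * h) *\<^sub>R ?y)
      \<le> real n * h * (2 * N (?y - z) + real n * h * N (A z)) + h * (2 * N (?y - z) + real (Suc n) * h * N (A z))"
      using h by (simp add: mult_left_mono)
    also have "\<dots> \<le> real n * h * (2 * N (?y - z) + real (Suc n) * h * N (A z)) + h * (2 * N (?y - z) + real (Suc n) * h * N (A z))"
      using h NA by (intro add_right_mono mult_left_mono add_left_mono mult_right_mono) auto
    also have "\<dots> = real (Suc n) * h * (2 * N (?y - z) + real (Suc n) * h * N (A z))"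
      by (simp add: algebra_simps)
    finally show ?case .
  qed simp
  have bound: "N (T t x - x - t *\<^sub>R ?y) \<le> t * (2 * N (?y - z) + t * N (A z))" if t: "t \<ge> 0" for t
  proof (rule converges_norm_le)
    \<comment> \<open>\<open>p k\<close> is the time that the scheme actually covers. It falls short
      of \<open>t\<close> by at most \<open>step k\<close>, which produces the additional term that
      vanishes with \<open>k\<close>.\<close>
    define p where "p k = real (nat \<lfloor>t * 2 ^ k\<rfloor>) * step k" for k
    have p: "p k \<le> t" "t - step k \<le> p k" "0 \<le> p k" for k
    proof -
      show "p k \<le> t" unfolding p_def by (rule steps_le[OF t])
      have "t * 2 ^ k - 1 \<le> real (nat \<lfloor>t * 2 ^ k\<rfloor>)" using t by linarith
      then have "(t * 2 ^ k - 1) * step k \<le> p k" unfolding p_def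
        by (intro mult_right_mono) (auto simp: less_imp_le)
      then show "t - step k \<le> p k" by (simp add: step_def field_simps)
      show "0 \<le> p k" by (simp add: p_def less_imp_le)
    qed
    show "converges (\<lambda>k. Euler k t x - x - t *\<^sub>R ?y) (T t x - x - t *\<^sub>R ?y)"
      using x t y by (intro converges_diff T_converges converges_const) auto
    show "N (Euler k t x - x - t *\<^sub>R ?y) \<le> t * (2 * N (?y - z) + t * N (A z)) + step k * N ?y" for k
    proof -
      have "Euler k t x - x - t *\<^sub>R ?y = (Euler k t x - x - p k *\<^sub>R ?y) - (t - p k) *\<^sub>R ?y"
        by (simp add: algebra_simps)
      then have "N (Euler k t x - x - t *\<^sub>R ?y) \<le> N (Euler k t x - x - p k *\<^sub>R ?y) + N ((t - p k) *\<^sub>R ?y)"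
        using x y by (simp only:) (intro N_diff_le, auto)
      also have "N (Euler k t x - x - p k *\<^sub>R ?y) \<le> p k * (2 * N (?y - z) + p k * N (A z))"
        unfolding Euler_def p_def by (rule step) simp
      also have "\<dots> \<le> t * (2 * N (?y - z) + t * N (A z))"
        using p t NA y z by (intro mult_mono add_left_mono add_nonneg_nonneg) auto
      also have "N ((t - p k) *\<^sub>R ?y) = (t - p k) * N ?y" using p y by (simp add: N_scale)
      also have "\<dots> \<le> step k * N ?y" using p[of k] y by (intro mult_right_mono) auto
      finally show ?thesis by simp
    qed
    have "(\<lambda>k. t * (2 * N (?y - z) + t * N (A z)) + step k * N ?y) \<longlonglongrightarrow> t * (2 * N (?y - z) + t * N (A z)) + 0 * N ?y"
      by (intro tendsto_intros step_lim)
    then show "(\<lambda>k. t * (2 * N (?y - z) + t * N (A z)) + step k * N ?y) \<longlonglongrightarrow> t * (2 * N (?y - z) + t * N (A z))"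
      by simp
  qed
  have "dist (N ((1 / t) *\<^sub>R (T t x - x) - ?y)) 0 < \<epsilon>" if t: "t \<in> {0<..<d}" for t
  proof -
    have t0: "t > 0" using t by simp
    have "(1 / t) *\<^sub>R (T t x - x) - ?y = (1 / t) *\<^sub>R (T t x - x - t *\<^sub>R ?y)"
      using t0 by (simp add: scaleR_diff_right)
    then have "N ((1 / t) *\<^sub>R (T t x - x) - ?y) = (1 / t) * N (T t x - x - t *\<^sub>R ?y)"
      using t0 x y by (simp only:) (simp add: N_scale)
    also have "\<dots> \<le> (1 / t) * (t * (2 * N (?y - z) + t * N (A z)))"
      using t0 by (intro mult_left_mono bound) auto
    also have "\<dots> = 2 * N (?y - z) + t * N (A z)" using t0 by simp
    also have "t * N (A z) \<le> d * (N (A z) + 1)" using t NA by (intro mult_mono) auto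
    also have "d * (N (A z) + 1) = \<epsilon> / 4"
    proof -
      have "N (A z) + 1 \<noteq> 0" using NA by simp
      then show ?thesis unfolding d_def by (rule nonzero_divide_eq_eq[THEN iffD1, OF _ refl, symmetric])
    qed
    finally show ?thesis using z x y t0 e by simp
  qed
  then show "\<forall>\<^sub>F t in at_right 0. dist (N ((1 / t) *\<^sub>R (T t x - x) - ?y)) 0 < \<epsilon>"
    using d by (auto simp: eventually_at_right_field intro!: exI[of _ d])
qed

end

section \<open>The generator of the limit semigroup\<close>

context dissipative_operator
begin

lemma T_contraction_semigroup: "contraction_semigroup X N T"
  unfolding contraction_semigroup_def C0_semigroup_def
  by (auto simp: T_add T_scale T_0 T_semigroup T_contr T_continuous_0 intro!: exI[of _ 1])

lemma eventually_pos: "(\<And>h. h > 0 \<Longrightarrow> P h) \<Longrightarrow> \<forall>\<^sub>F h in at_right (0::real). P h"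
  by (auto simp: eventually_at_filter)

lemma semigroup_deriv_diff:
  assumes "semigroup_deriv N T x y" "semigroup_deriv N T x' y'" "x \<in> X" "x' \<in> X" "y \<in> X" "y' \<in> X"
  shows "semigroup_deriv N T (x - x') (y - y')"
  unfolding semigroup_deriv_def
proof (rule tendsto_sandwich[OF _ _ tendsto_const])
  let ?f = "\<lambda>h x y. (1 / h) *\<^sub>R (T h x - x) - y"
  show "((\<lambda>h. N (?f h x y) + N (?f h x' y')) \<longlongrightarrow> 0) (at_right 0)"
    using tendsto_add[OF assms(1,2)[unfolded semigroup_deriv_def]] by simp
  show "\<forall>\<^sub>F h in at_right 0. 0 \<le> N (?f h (x - x') (y - y'))"
    using assms by (intro eventually_pos N_nonneg) auto
  show "\<forall>\<^sub>F h in at_right 0. N (?f h (x - x') (y - y')) \<le> N (?f h x y) + N (?f h x' y')"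
  proof (rule eventually_pos)
    fix h :: real assume h: "h > 0"
    have "?f h (x - x') (y - y') = ?f h x y - ?f h x' y'"
      using assms h by (simp add: T_diff algebra_simps)
    then show "N (?f h (x - x') (y - y')) \<le> N (?f h x y) + N (?f h x' y')"
      using assms h by (simp only:) (intro N_diff_le, auto)
  qed
qed

lemma semigroup_deriv_unique:
  assumes "semigroup_deriv N T x y" "semigroup_deriv N T x y'" "x \<in> X" "y \<in> X" "y' \<in> X"
  shows "y = y'"
proof -
  have "((\<lambda>h. N ((1 / h) *\<^sub>R (T h 0 - 0) - (y - y'))) \<longlongrightarrow> 0) (at_right 0)"
    using semigroup_deriv_diff[OF assms(1,2)] assms by (simp add: semigroup_deriv_def)
  moreover have "\<forall>\<^sub>F h in at_right 0. N ((1 / h) *\<^sub>R (T h 0 - 0) - (y - y')) = N (y - y')"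
  proof (rule eventually_pos)
    fix h :: real assume "h > 0"
    then have "T h 0 = 0" using T_scale[of 0 h 0] by simp
    then show "N ((1 / h) *\<^sub>R (T h 0 - 0) - (y - y')) = N (y - y')"
      using assms N_minus[of "y - y'"] by simp
  qed
  ultimately have "((\<lambda>h::real. N (y - y')) \<longlongrightarrow> 0) (at_right 0)"
    by (rule Lim_transform_eventually)
  then have "N (y - y') = 0" by (simp add: tendsto_const_iff)
  then show ?thesis using N_eq_0[of "y - y'"] assms by simp
qed

text \<open>With \<open>z\<close> solving \<open>z - A z = x - y\<close>, the difference
  \<open>x - z\<close> has itself as semigroup derivative. An orbit of a contraction semigroup
  cannot grow at unit rate, so the difference is zero.\<close>

lemma semigroup_deriv_imp_D:
  assumes d: "semigroup_deriv N T x y" and x: "x \<in> X" and y: "y \<in> X"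
  shows "x \<in> D"
proof -
  define z where "z = J 1 (x - y)"
  have z: "z \<in> D" "z - A z = x - y"
    using J_eq[of 1 "x - y"] x y by (auto simp: z_def)
  let ?d = "x - z"
  have dX: "?d \<in> X" using x z by simp
  have "y - A z = ?d" using z(2) by (simp add: algebra_simps)
  then have lim: "((\<lambda>h. N ((1 / h) *\<^sub>R (T h ?d - ?d) - ?d)) \<longlongrightarrow> 0) (at_right 0)"
    using semigroup_deriv_diff[OF d T_deriv[OF z(1)]] x y z by (simp add: semigroup_deriv_def)
  have "\<forall>\<^sub>F h in at_right 0. N ?d \<le> N ((1 / h) *\<^sub>R (T h ?d - ?d) - ?d)"
  proof (rule eventually_pos)
    fix h :: real assume h: "h > 0"
    let ?e = "(1 / h) *\<^sub>R (T h ?d - ?d) - ?d"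
    have e: "?e \<in> X" "T h ?d \<in> X" using dX h by auto
    \<comment> \<open>\<open>?e\<close> is the error of the difference quotient. Solved for
      \<open>?d\<close>, the contraction bound absorbs one copy of its norm and leaves
      \<open>N ?d \<le> N ?e\<close>, whose right-hand side tends to 0.\<close>
    have "(1 + h) *\<^sub>R ?d = T h ?d - h *\<^sub>R ?e"
      using h by (simp add: scaleR_diff_right scaleR_add_left scaleR_add_right)
    then have "(1 + h) * N ?d = N (T h ?d - h *\<^sub>R ?e)"
      using N_scale[OF dX, of "1 + h"] h by simp
    also have "\<dots> \<le> N (T h ?d) + N (h *\<^sub>R ?e)" using e by (intro N_diff_le) auto
    also have "\<dots> \<le> N ?d + h * N ?e"
      using N_scale[OF e(1), of h] T_contr[OF dX, of h] h by simp
    finally have "h * N ?d \<le> h * N ?e" by (simp add: algebra_simps)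
    then show "N ?d \<le> N ?e" using h by simp
  qed
  with lim have "N ?d \<le> 0" by (intro tendsto_lowerbound[OF lim]) auto
  then have "N ?d = 0" using dX by (intro antisym) auto
  then have "?d = 0" using N_eq_0[OF dX] by simp
  then show ?thesis using z by simp
qed

lemma T_generator: "is_generator X N T D A"
  unfolding is_generator_def
proof (intro conjI)
  show "D = {x \<in> X. \<exists>y\<in>X. semigroup_deriv N T x y}"
    using T_deriv semigroup_deriv_imp_D A_X DX by blast
qed (auto simp: T_deriv)

text \<open>\<open>T t\<close> commutes with \<open>T h\<close> and is a contraction, so the
  quotient at time \<open>t\<close> is at least as close to its limit as the quotient at time 0.
  With \<open>semigroup_deriv_imp_D\<close> this yields invariance of \<open>D\<close>.\<close>

lemma T_deriv_orbit:
  assumes x: "x \<in> D" and t: "t \<ge> 0"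
  shows "semigroup_deriv N T (T t x) (T t (A x))"
  unfolding semigroup_deriv_def
proof (rule tendsto_sandwich[OF _ _ tendsto_const])
  show "((\<lambda>h. N ((1 / h) *\<^sub>R (T h x - x) - A x)) \<longlongrightarrow> 0) (at_right 0)"
    using T_deriv[OF x] by (simp add: semigroup_deriv_def)
  show "\<forall>\<^sub>F h in at_right 0. 0 \<le> N ((1 / h) *\<^sub>R (T h (T t x) - T t x) - T t (A x))"
    using x t by (intro eventually_pos N_nonneg) auto
  show "\<forall>\<^sub>F h in at_right 0. N ((1 / h) *\<^sub>R (T h (T t x) - T t x) - T t (A x))
      \<le> N ((1 / h) *\<^sub>R (T h x - x) - A x)"
  proof (rule eventually_pos)
    fix h :: real assume h: "h > 0"
    have "T h (T t x) = T t (T h x)"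
      using T_semigroup[of x h t] T_semigroup[of x t h] x t h by (simp add: add.commute)
    then have "(1 / h) *\<^sub>R (T h (T t x) - T t x) - T t (A x) = T t ((1 / h) *\<^sub>R (T h x - x) - A x)"
      using x t h by (simp add: T_diff T_scale)
    then show "N ((1 / h) *\<^sub>R (T h (T t x) - T t x) - T t (A x)) \<le> N ((1 / h) *\<^sub>R (T h x - x) - A x)"
      using x t h by (simp add: T_contr)
  qed
qed

lemma T_D: "x \<in> D \<Longrightarrow> t \<ge> 0 \<Longrightarrow> T t x \<in> D"
  using T_deriv_orbit by (rule semigroup_deriv_imp_D) auto

lemma A_T: "x \<in> D \<Longrightarrow> t \<ge> 0 \<Longrightarrow> A (T t x) = T t (A x)"
  by (rule semigroup_deriv_unique[OF T_deriv[OF T_D] T_deriv_orbit]) (auto simp: T_D)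

section \<open>Classical solutions and well-posedness\<close>

lemma T_orbit_near:
  assumes x: "x \<in> X" and "s \<ge> 0" "t \<ge> 0"
  shows "N (T s x - T t x) \<le> N (T \<bar>s - t\<bar> x - x)"
proof -
  have le: "N (T s x - T t x) \<le> N (T \<bar>s - t\<bar> x - x)" if "0 \<le> t" "t \<le> s" for s t
  proof -
    have "T s x = T t (T \<bar>s - t\<bar> x)" using T_semigroup[of x t "s - t"] x that by simp
    then show ?thesis using x that by (simp add: T_contr flip: T_diff)
  qed
  show ?thesis
    using le[of s t] le[of t s] N_commute[of "T s x" "T t x"] assms
    by (cases "t \<le> s") (auto simp: abs_minus_commute)
qed

lemma T_continuous:
  assumes x: "x \<in> X" and S: "S \<subseteq> {0..}"
  shows "norm_continuous_on N S (\<lambda>t. T t x)"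
  unfolding norm_continuous_on_def
proof
  fix t assume t: "t \<in> S"
  have fl: "filterlim (\<lambda>s. \<bar>s - t\<bar>) (at_right 0) (at t within S)"
    unfolding filterlim_at
  proof
    show "\<forall>\<^sub>F s in at t within S. \<bar>s - t\<bar> \<in> {0<..} \<and> \<bar>s - t\<bar> \<noteq> 0"
      by (auto simp: eventually_at_filter)
    show "((\<lambda>s. \<bar>s - t\<bar>) \<longlongrightarrow> 0) (at t within S)"
      by (rule tendsto_eq_intros refl | simp)+
  qed
  show "((\<lambda>s. N (T s x - T t x)) \<longlongrightarrow> 0) (at t within S)"
  proof (rule tendsto_sandwich[OF _ _ tendsto_const])
    show "((\<lambda>s. N (T \<bar>s - t\<bar> x - x)) \<longlongrightarrow> 0) (at t within S)"
      using filterlim_compose[OF T_continuous_0[OF x] fl] .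
    have pos: "s \<ge> 0" if "s \<in> S" for s using that S by auto
    then have "0 \<le> N (T s x - T t x)" "N (T s x - T t x) \<le> N (T \<bar>s - t\<bar> x - x)" if "s \<in> S" for s
      using x t that by (auto intro!: T_orbit_near)
    then show "\<forall>\<^sub>F s in at t within S. 0 \<le> N (T s x - T t x)"
      "\<forall>\<^sub>F s in at t within S. N (T s x - T t x) \<le> N (T \<bar>s - t\<bar> x - x)"
      by (auto simp: eventually_at_filter intro!: always_eventually)
  qed
qed

lemma T_derivative:
  assumes x: "x \<in> D" and t: "t > 0"
  shows "norm_has_derivative N (\<lambda>t. T t x) (T t (A x)) t"
  unfolding norm_has_derivative_def filterlim_at_split
proof
  have q: "((\<lambda>h. N ((1 / h) *\<^sub>R (T h x - x) - A x)) \<longlongrightarrow> 0) (at_right 0)"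
    using T_deriv[OF x] by (simp add: semigroup_deriv_def)
  show "((\<lambda>h. N ((1 / h) *\<^sub>R (T (t + h) x - T t x) - T t (A x))) \<longlongrightarrow> 0) (at_right 0)"
  proof (rule Lim_transform_eventually)
    show "((\<lambda>h. N ((1 / h) *\<^sub>R (T h (T t x) - T t x) - T t (A x))) \<longlongrightarrow> 0) (at_right 0)"
      using T_deriv_orbit[of x t] x t by (simp add: semigroup_deriv_def)
    show "\<forall>\<^sub>F h in at_right 0. N ((1 / h) *\<^sub>R (T h (T t x) - T t x) - T t (A x))
        = N ((1 / h) *\<^sub>R (T (t + h) x - T t x) - T t (A x))"
      using T_semigroup[of x _ t] x t by (intro eventually_pos) (simp add: add.commute)
  qed
  have r: "((\<lambda>h. N (T h (A x) - A x)) \<longlongrightarrow> 0) (at_right 0)"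
    using x by (intro T_continuous_0) simp
  show "((\<lambda>h. N ((1 / h) *\<^sub>R (T (t + h) x - T t x) - T t (A x))) \<longlongrightarrow> 0) (at_left 0)"
    unfolding at_left_minus[of "0::real"] filterlim_filtermap minus_zero
  proof (rule tendsto_sandwich[OF _ _ tendsto_const])
    show "((\<lambda>h. N ((1 / h) *\<^sub>R (T h x - x) - A x) + N (T h (A x) - A x)) \<longlongrightarrow> 0) (at_right 0)"
      using tendsto_add[OF q r] by simp
    have ev: "\<forall>\<^sub>F h in at_right 0. h \<in> {0<..<t}"
      using t by (rule eventually_at_right_real)
    show "\<forall>\<^sub>F h in at_right 0. 0 \<le> N ((1 / - h) *\<^sub>R (T (t + - h) x - T t x) - T t (A x))"
      using ev by eventually_elim (use x t in auto)
    show "\<forall>\<^sub>F h in at_right 0. N ((1 / - h) *\<^sub>R (T (t + - h) x - T t x) - T t (A x))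
        \<le> N ((1 / h) *\<^sub>R (T h x - x) - A x) + N (T h (A x) - A x)"
      using ev
    proof eventually_elim
      case (elim h)
      \<comment> \<open>For the left derivative \<open>T ?s\<close> is factored out of the quotient.
        By contractivity, what remains is the right-hand quotient at 0 and the continuity error of
        \<open>T h\<close> at \<open>A x\<close>.\<close>
      let ?s = "t - h"
      have T: "T t y = T ?s (T h y)" if "y \<in> X" for y
        using T_semigroup[OF that, of ?s h] elim by simp
      have "(1 / - h) *\<^sub>R (T (t + - h) x - T t x) - T t (A x)
        = (1 / h) *\<^sub>R (T ?s (T h x) - T ?s x) - T ?s (T h (A x))"
        using x T[of x] T[of "A x"] by (simp add: scaleR_diff_right)
      also have "\<dots> = T ?s ((1 / h) *\<^sub>R (T h x - x) - A x) - T ?s (T h (A x) - A x)"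
        using x elim by (simp add: T_diff T_scale)
      finally have "N ((1 / - h) *\<^sub>R (T (t + - h) x - T t x) - T t (A x))
        \<le> N (T ?s ((1 / h) *\<^sub>R (T h x - x) - A x)) + N (T ?s (T h (A x) - A x))"
        using x elim by (simp only:) (intro N_diff_le, auto)
      also have "\<dots> \<le> N ((1 / h) *\<^sub>R (T h x - x) - A x) + N (T h (A x) - A x)"
        using x elim by (intro add_mono T_contr) auto
      finally show ?case .
    qed
  qed
qed

lemma T_classical_solution: "x \<in> D \<Longrightarrow> classical_solution X N D A x (\<lambda>t. T t x)"
  unfolding classical_solution_def
  by (auto simp: T_0 T_D A_T T_derivative intro!: T_continuous exI[of _ "\<lambda>t. T t (A x)"])

text \<open>Symmetry of \<open>ip\<close> turns the quotient of squares into
  \<open>ip (?q h) (?v + ?w)\<close>; Cauchy-Schwarz then reduces the claim to the two norm limits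
  in the hypotheses.\<close>

lemma energy_derivative:
  assumes X: "\<And>s. s \<ge> 0 \<Longrightarrow> w s \<in> X" "y \<in> X" and t: "t > 0"
    and c: "((\<lambda>s. N (w s - w t)) \<longlongrightarrow> 0) (at t)"
    and d: "norm_has_derivative N w y t"
  shows "((\<lambda>s. ip (w s) (w s)) has_real_derivative 2 * ip y (w t)) (at t)"
  unfolding DERIV_def
proof -
  have wt: "w t \<in> X" using X t by simp
  have c0: "((\<lambda>h. N (w (t + h) - w t)) \<longlongrightarrow> 0) (at 0)"
    using LIM_offset_zero[OF c] .
  let ?q = "\<lambda>h. (1 / h) *\<^sub>R (w (t + h) - w t)"
  have d0: "((\<lambda>h. N (?q h - y)) \<longlongrightarrow> 0) (at 0)" using d by (simp add: norm_has_derivative_def)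
  have "((\<lambda>h. (ip (w (t + h)) (w (t + h)) - ip (w t) (w t)) / h - 2 * ip y (w t)) \<longlongrightarrow> 0) (at 0)"
  proof (rule Lim_null_comparison)
    have ev: "\<forall>\<^sub>F h in at 0. \<bar>h\<bar> < t \<and> h \<noteq> 0"
      using t by (auto simp: eventually_at intro!: exI[of _ t])
    show "((\<lambda>h. N (?q h - y) * (N (w (t + h) - w t) + 2 * N (w t)) + N y * N (w (t + h) - w t)) \<longlongrightarrow> 0) (at 0)"
      by (rule tendsto_eq_intros d0 c0 refl | simp)+
    show "\<forall>\<^sub>F h in at 0. norm ((ip (w (t + h)) (w (t + h)) - ip (w t) (w t)) / h - 2 * ip y (w t))
        \<le> N (?q h - y) * (N (w (t + h) - w t) + 2 * N (w t)) + N y * N (w (t + h) - w t)"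
      using ev
    proof eventually_elim
      case (elim h)
      let ?v = "w (t + h)" and ?w = "w t"
      have v: "?v \<in> X" using X elim by auto
      have "(ip ?v ?v - ip ?w ?w) / h = ip (?q h) (?v + ?w)"
        using v wt elim ip_sym[OF v wt] by (simp add: ip_simps field_simps)
      then have "(ip ?v ?v - ip ?w ?w) / h - 2 * ip y ?w = ip (?q h - y) ((?v - ?w) + 2 *\<^sub>R ?w) + ip y (?v - ?w)"
        using v wt X(2) by (simp add: ip_simps algebra_simps)
      then have "norm ((ip ?v ?v - ip ?w ?w) / h - 2 * ip y ?w)
        \<le> \<bar>ip (?q h - y) ((?v - ?w) + 2 *\<^sub>R ?w)\<bar> + \<bar>ip y (?v - ?w)\<bar>"
        by simp
      also have "\<dots> \<le> N (?q h - y) * N ((?v - ?w) + 2 *\<^sub>R ?w) + N y * N (?v - ?w)"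
        using v wt X(2) by (intro add_mono cauchy_schwarz) auto
      also have "N ((?v - ?w) + 2 *\<^sub>R ?w) \<le> N (?v - ?w) + 2 * N ?w"
        using N_triangle[of "?v - ?w" "2 *\<^sub>R ?w"] N_scale[OF wt, of 2] v wt by simp
      finally show ?case using v wt X(2) by (simp add: mult_left_mono)
    qed
  qed
  then show "((\<lambda>h. (ip (w (t + h)) (w (t + h)) - ip (w t) (w t)) / h) \<longlongrightarrow> 2 * ip y (w t)) (at 0)"
    by (rule LIM_zero_cancel)
qed

text \<open>The squared norm of the difference of two solutions has a nonpositive derivative by
  dissipativity. This one estimate gives both uniqueness and continuous dependence, the latter with
  \<delta> equal to \<epsilon> on every time interval.\<close>

lemma classical_solution_stable:
  assumes u: "classical_solution X N D A x u" and v: "classical_solution X N D A y v" and t: "t \<ge> 0"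
  shows "N (u t - v t) \<le> N (x - y)"
proof (cases "t = 0")
  case True
  then show ?thesis using u v by (simp add: classical_solution_def)
next
  case False
  then have t: "t > 0" using t by simp
  define w where "w s = u s - v s" for s
  have uvX: "u s \<in> X" "v s \<in> X" if "s \<ge> 0" for s
    using u v that by (auto simp: classical_solution_def)
  then have wX: "w s \<in> X" if "s \<ge> 0" for s
    using that by (auto simp: w_def)
  have uvD: "u s \<in> D" "v s \<in> D" if "s > 0" for s
    using u v that by (auto simp: classical_solution_def)
  have wD: "w s \<in> D" if "s > 0" for s
    using uvD[OF that] by (simp add: w_def)
  have du: "norm_has_derivative N u (A (u s)) s" and dv: "norm_has_derivative N v (A (v s)) s" if "s > 0" for s
    using u v that by (auto simp: classical_solution_def)
  have cont: "((\<lambda>r. N (w r - w s)) \<longlongrightarrow> 0) (at s within {0..})" if s: "s \<ge> 0" for s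
  proof (rule tendsto_sandwich[OF _ _ tendsto_const])
    have "((\<lambda>r. N (u r - u s)) \<longlongrightarrow> 0) (at s within {0..})" "((\<lambda>r. N (v r - v s)) \<longlongrightarrow> 0) (at s within {0..})"
      using u v s by (auto simp: classical_solution_def norm_continuous_on_def)
    from tendsto_add[OF this] show "((\<lambda>r. N (u r - u s) + N (v r - v s)) \<longlongrightarrow> 0) (at s within {0..})"
      by simp
    show "\<forall>\<^sub>F r in at s within {0..}. 0 \<le> N (w r - w s)"
      using wX s by (auto simp: eventually_at_filter)
    have "N (w r - w s) \<le> N (u r - u s) + N (v r - v s)" if "r \<ge> 0" for r
    proof -
      have "w r - w s = (u r - u s) - (v r - v s)" by (simp add: w_def)
      then show ?thesis using uvX s that by (simp only:) (intro N_diff_le, auto)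
    qed
    then show "\<forall>\<^sub>F r in at s within {0..}. N (w r - w s) \<le> N (u r - u s) + N (v r - v s)"
      by (auto simp: eventually_at_filter)
  qed
  have dw: "norm_has_derivative N w (A (w s)) s" if s: "s > 0" for s
    unfolding norm_has_derivative_def
  proof (rule tendsto_sandwich[OF _ _ tendsto_const])
    let ?f = "\<lambda>u y h. (1 / h) *\<^sub>R (u (s + h) - u s) - y"
    show "((\<lambda>h. N (?f u (A (u s)) h) + N (?f v (A (v s)) h)) \<longlongrightarrow> 0) (at 0)"
      using tendsto_add[OF du[OF s, unfolded norm_has_derivative_def] dv[OF s, unfolded norm_has_derivative_def]]
      by simp
    have ev: "\<forall>\<^sub>F h in at 0. \<bar>h\<bar> < s"
      using s by (auto simp: eventually_at intro!: exI[of _ s])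
    show "\<forall>\<^sub>F h in at 0. 0 \<le> N (?f w (A (w s)) h)"
      using ev by eventually_elim (use wX wD s in auto)
    show "\<forall>\<^sub>F h in at 0. N (?f w (A (w s)) h) \<le> N (?f u (A (u s)) h) + N (?f v (A (v s)) h)"
      using ev
    proof eventually_elim
      case (elim h)
      have "?f w (A (w s)) h = ?f u (A (u s)) h - ?f v (A (v s)) h"
        using uvD[OF s] by (simp add: w_def A_diff algebra_simps)
      then show ?case using uvX[of s] uvX[of "s + h"] uvD[OF s] elim s
        by (simp only:) (intro N_diff_le, auto)
    qed
  qed
  have der: "((\<lambda>s. ip (w s) (w s)) has_real_derivative 2 * ip (A (w s)) (w s)) (at s)" if s: "s > 0" for s
  proof (rule energy_derivative[OF wX])
    have "at s within {0..} = at s" using s by (intro at_within_interior) simp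
    then show "((\<lambda>r. N (w r - w s)) \<longlongrightarrow> 0) (at s)" using cont[of s] s by simp
  qed (use wD[OF s] dw[OF s] s in auto)
  \<comment> \<open>A classical solution is differentiable only at positive times, so monotonicity
    comes from the open interval and is extended to 0 by continuity.\<close>
  have "ip (w t) (w t) \<le> ip (w 0) (w 0)"
  proof (rule DERIV_nonpos_imp_decreasing_open[of 0 t "\<lambda>s. ip (w s) (w s)"])
    show "\<exists>y. DERIV (\<lambda>s. ip (w s) (w s)) s :> y \<and> y \<le> 0" if "0 < s" "s < t" for s
      using der[OF that(1)] dissipative[OF wD[OF that(1)]] by (intro exI[of _ "2 * ip (A (w s)) (w s)"]) auto
    have "continuous_on {0..} (\<lambda>s. N (w s))"
      unfolding continuous_on
    proof
      fix s :: real assume s: "s \<in> {0..}"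
      have "((\<lambda>r. N (w r) - N (w s)) \<longlongrightarrow> 0) (at s within {0..})"
      proof (rule Lim_null_comparison[OF _ cont])
        have "norm (N (w r) - N (w s)) \<le> N (w r - w s)" if "r \<ge> 0" for r
          using N_le_diff[of "w r" "w s"] N_le_diff[of "w s" "w r"] N_commute[of "w r" "w s"] wX s that
          by (simp add: abs_le_iff)
        then show "\<forall>\<^sub>F r in at s within {0..}. norm (N (w r) - N (w s)) \<le> N (w r - w s)"
          by (auto simp: eventually_at_filter)
      qed (use s in simp)
      then show "((\<lambda>r. N (w r)) \<longlongrightarrow> N (w s)) (at s within {0..})" by (rule LIM_zero_cancel)
    qed
    then have "continuous_on {0..t} (\<lambda>s. (N (w s))\<^sup>2)"
      by (intro continuous_intros) (auto intro: continuous_on_subset)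
    then show "continuous_on {0..t} (\<lambda>s. ip (w s) (w s))"
      by (rule continuous_on_eq) (simp add: N_sq wX)
  qed (use t in simp)
  then show ?thesis using u v by (simp add: N_eq w_def classical_solution_def)
qed

theorem generates: "generates_contraction_semigroup X N D A"
  unfolding generates_contraction_semigroup_def
  using T_contraction_semigroup T_generator by blast

theorem well_posed: "well_posed X N D A"
  unfolding well_posed_def
proof (intro conjI ballI allI impI)
  show "D \<subseteq> X" by (rule D_X)
  show "\<exists>y\<in>D. N (x - y) < \<epsilon>" if "x \<in> X" "\<epsilon> > 0" for x \<epsilon>
    using D_dense[OF that] .
  show "\<exists>u. classical_solution X N D A x u" if "x \<in> D" for x
    using T_classical_solution[OF that] by blast
  show "u t = v t" if "classical_solution X N D A x u" "classical_solution X N D A x v" "t \<ge> 0" for x u v t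
  proof -
    have uv: "u t \<in> X" "v t \<in> X" using that by (auto simp: classical_solution_def)
    have "N (u t - v t) \<le> 0" using classical_solution_stable[OF that] by simp
    then have "N (u t - v t) = 0" using uv by (intro antisym) auto
    then show ?thesis using N_eq_0[of "u t - v t"] uv by simp
  qed
  show "\<exists>\<delta>>0. \<forall>x1\<in>D. N (x0 - x1) \<le> \<delta> \<longrightarrow> (\<forall>u v. classical_solution X N D A x0 u \<longrightarrow>
      classical_solution X N D A x1 v \<longrightarrow> (\<forall>t\<in>{0..\<tau>}. N (u t - v t) \<le> \<epsilon>))"
    if e: "\<epsilon> > 0" for \<epsilon> \<tau> x0
  proof (intro exI[of _ \<epsilon>] conjI e ballI impI allI)
    fix x1 u v t
    assume "N (x0 - x1) \<le> \<epsilon>" "classical_solution X N D A x0 u" "classical_solution X N D A x1 v" "t \<in> {0..\<tau>}"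
    then show "N (u t - v t) \<le> \<epsilon>" using classical_solution_stable[of x0 u x1 v t] by simp
  qed
qed

end

section \<open>Square integrable functions and coercive multiplication operators\<close>

lemma square_integrable_rep [simp]: "square_integrable (rep_l2 x)"
  using Quotient3_rep_reflp[OF Quotient3_l2, of x] by simp

lemma rep_abs_AE: "square_integrable f \<Longrightarrow> AE z in lebesgue. rep_l2 (abs_l2 f) z = f z"
  using Quotient3_rep_abs[OF Quotient3_l2, of f] by simp

lemma l2_eqI: "(AE z in lebesgue. rep_l2 x z = rep_l2 y z) \<Longrightarrow> x = y"
  using Quotient3_rel_rep[OF Quotient3_l2, of x y, symmetric] by simp

lemma abs_rep: "abs_l2 (rep_l2 x) = x"
  by (rule Quotient3_abs_rep[OF Quotient3_l2])

lemma rep_measurable [measurable]: "rep_l2 x \<in> borel_measurable lebesgue"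
  using square_integrable_rep[of x] by (simp add: square_integrable_def)

lemma rep_integrable [simp]: "integrable lebesgue (\<lambda>z. (norm (rep_l2 x z))\<^sup>2)"
  using square_integrable_rep[of x] by (simp add: square_integrable_def)

lemma rep_zero: "AE z in lebesgue. rep_l2 0 z = 0"
  unfolding zero_l2_def using rep_abs_AE[OF square_integrable_zero] by simp

lemma rep_add: "AE z in lebesgue. rep_l2 (x + y) z = rep_l2 x z + rep_l2 y z"
proof -
  have "x + y = abs_l2 (\<lambda>z. rep_l2 x z + rep_l2 y z)"
    by (simp add: plus_l2_def)
  then show ?thesis using rep_abs_AE[OF square_integrable_add[of "rep_l2 x" "rep_l2 y"]] by simp
qed

lemma rep_scale: "AE z in lebesgue. rep_l2 (c *\<^sub>R x) z = c *\<^sub>R rep_l2 x z"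
proof -
  have "c *\<^sub>R x = abs_l2 (\<lambda>z. c *\<^sub>R rep_l2 x z)"
    by (simp add: scaleR_l2_def)
  then show ?thesis using rep_abs_AE[OF square_integrable_scaleR[of "rep_l2 x" c]] by simp
qed

lemma rep_diff: "AE z in lebesgue. rep_l2 (x - y) z = rep_l2 x z - rep_l2 y z"
  using rep_add[of x "(-1) *\<^sub>R y"] rep_scale[of "-1" y] by eventually_elim simp

lemma L2_on_subspace: "subspace (L2_on a b)"
  unfolding subspace_def L2_on_def
proof (intro conjI allI ballI; (elim CollectE)?; (intro CollectI)?)
  show "AE z in lebesgue. z \<notin> {a..b} \<longrightarrow> rep_l2 0 z = 0"
    using rep_zero by eventually_elim simp
  fix x y
  assume x: "AE z in lebesgue. z \<notin> {a..b} \<longrightarrow> rep_l2 x z = 0"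
  then show "AE z in lebesgue. z \<notin> {a..b} \<longrightarrow> rep_l2 (c *\<^sub>R x) z = 0" for c
    using rep_scale[of c x] by eventually_elim simp
  assume y: "AE z in lebesgue. z \<notin> {a..b} \<longrightarrow> rep_l2 y z = 0"
  show "AE z in lebesgue. z \<notin> {a..b} \<longrightarrow> rep_l2 (x + y) z = 0"
    using x y rep_add[of x y] by eventually_elim simp
qed

lemma abs_l2_L2_on:
  assumes "square_integrable f" "AE z in lebesgue. z \<notin> {a..b} \<longrightarrow> f z = 0"
  shows "abs_l2 f \<in> L2_on a b"
  unfolding L2_on_def using rep_abs_AE[OF assms(1)] assms(2) by (auto elim: eventually_elim2)

lemma measurable_matrix_vector [measurable (raw)]:
  fixes Q :: "'a \<Rightarrow> real^2^2" and f :: "'a \<Rightarrow> real^2"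
  assumes "Q \<in> borel_measurable M" "f \<in> borel_measurable M"
  shows "(\<lambda>z. Q z *v f z) \<in> borel_measurable M"
proof (rule borel_measurable_continuous_Pair[OF assms])
  show "continuous_on UNIV (\<lambda>x. fst x *v snd x :: real^2)"
    unfolding matrix_vector_mult_def by (intro continuous_intros)
qed

section \<open>The plain L2 norm and its completeness\<close>

definition sq_norm :: "l2 \<Rightarrow> real" where
  "sq_norm x = (LINT z|lebesgue. (norm (rep_l2 x z))\<^sup>2)"

lemma sq_norm_nonneg [simp]: "0 \<le> sq_norm x"
  by (simp add: sq_norm_def)

lemma sq_norm_eq_0: "sq_norm x = 0 \<Longrightarrow> x = 0"
proof -
  assume "sq_norm x = 0"
  then have "AE z in lebesgue. (norm (rep_l2 x z))\<^sup>2 = 0"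
    unfolding sq_norm_def by (subst (asm) integral_nonneg_eq_0_iff_AE) auto
  then have "AE z in lebesgue. rep_l2 x z = rep_l2 0 z"
    using rep_zero by eventually_elim simp
  then show "x = 0" by (rule l2_eqI)
qed

lemma sq_norm_diff: "sq_norm (x - y) = (LINT z|lebesgue. (norm (rep_l2 x z - rep_l2 y z))\<^sup>2)"
  unfolding sq_norm_def by (intro integral_cong_AE) (use rep_diff[of x y] in \<open>auto elim: eventually_mono\<close>)

text \<open>In this form Fatou's lemma applies before the limit function is known to be square
  integrable.\<close>

lemma sq_norm_nn: "ennreal (sq_norm (x - y)) = (\<integral>\<^sup>+ z. ennreal ((norm (rep_l2 x z - rep_l2 y z))\<^sup>2) \<partial>lebesgue)"
proof -
  have "integrable lebesgue (\<lambda>z. (norm (rep_l2 x z - rep_l2 y z))\<^sup>2)"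
  proof (rule integrable_cong_AE[THEN iffD1, OF _ _ _ rep_integrable[of "x - y"]])
    show "AE z in lebesgue. (norm (rep_l2 (x - y) z))\<^sup>2 = (norm (rep_l2 x z - rep_l2 y z))\<^sup>2"
      using rep_diff[of x y] by eventually_elim simp
  qed auto
  then show ?thesis unfolding sq_norm_diff by (intro nn_integral_eq_integral[symmetric]) auto
qed

text \<open>A fast subsequence converges almost everywhere because its increments are summable in L1
  of the bounded interval. Fatou's lemma identifies the pointwise limit as the limit of the whole
  sequence in the mean.\<close>

lemma Riesz_Fischer:
  assumes u: "\<And>n. u n \<in> L2_on a b"
    and c: "\<And>\<epsilon>. \<epsilon> > 0 \<Longrightarrow> \<exists>K. \<forall>i\<ge>K. \<forall>j\<ge>K. sq_norm (u i - u j) < \<epsilon>"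
  shows "\<exists>x\<in>L2_on a b. (\<lambda>n. sq_norm (u n - x)) \<longlonglongrightarrow> 0"
proof -
  have "\<forall>k. \<exists>K. \<forall>i\<ge>K. \<forall>j\<ge>K. sq_norm (u i - u j) < (1/4) ^ k"
    using c by simp
  then obtain R where R: "\<And>k i j. i \<ge> R k \<Longrightarrow> j \<ge> R k \<Longrightarrow> sq_norm (u i - u j) < (1/4) ^ k"
    by metis
  \<comment> \<open>The sum makes the indices nondecreasing and places \<open>r k\<close> beyond
    \<open>R k\<close>; the summand \<open>k\<close> makes them unbounded.\<close>
  define r where "r k = (\<Sum>i\<le>k. R i) + k" for k
  have rR: "R k \<le> r k" for k unfolding r_def by (intro trans_le_add1 member_le_sum) auto
  have rmono: "r k \<le> r (Suc k)" for k by (simp add: r_def)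
  have small: "sq_norm (u (r (Suc k)) - u (r k)) < (1/4) ^ k" for k
    using R[of k "r (Suc k)" "r k"] rR[of k] rmono[of k] by simp
  define f where "f k = rep_l2 (u (r k))" for k
  have fm [measurable]: "f k \<in> borel_measurable lebesgue" for k by (simp add: f_def)
  let ?M = "lebesgue_on {a..b}"
  have fM [measurable]: "f k \<in> borel_measurable ?M" for k
    using fm by (intro measurable_restrict_space1)
  define d where "d k z = norm (f (Suc k) z - f k z)" for k z
  have dM [measurable]: "d k \<in> borel_measurable ?M" for k unfolding d_def by measurable
  have dle: "(\<integral>\<^sup>+ z. ennreal (d k z) \<partial>?M) \<le> ennreal ((1 + max 0 (b - a)) * (1/2) ^ k)" for k
  proof -
    \<comment> \<open>The weights \<open>2 ^ k\<close> and \<open>(1/2) ^ k\<close> balance the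
      decay \<open>(1/4) ^ k\<close> of the squared increments. Integrated over the interval, both
      terms are of order \<open>(1/2) ^ k\<close>.\<close>
    have p: "d k z \<le> 2 ^ k * (d k z)\<^sup>2 + (1/2) ^ k" for z
    proof -
      have "2 * (2 ^ k * d k z) \<le> (2 ^ k * d k z)\<^sup>2 + 1"
        using sum_squares_bound[of "2 ^ k * d k z" 1] by simp
      moreover have "0 \<le> 2 ^ k * d k z" by (simp add: d_def)
      ultimately have "2 ^ k * d k z \<le> (2 ^ k * d k z)\<^sup>2 + 1" by linarith
      then have "(1/2) ^ k * (2 ^ k * d k z) \<le> (1/2) ^ k * ((2 ^ k * d k z)\<^sup>2 + 1)"
        by (intro mult_left_mono) auto
      then show ?thesis by (simp add: power2_eq_square power_one_over field_simps)
    qed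
    have "(\<integral>\<^sup>+ z. ennreal (d k z) \<partial>?M) \<le> (\<integral>\<^sup>+ z. ennreal (2 ^ k) * ennreal ((d k z)\<^sup>2) + ennreal ((1/2) ^ k) \<partial>?M)"
      using p by (intro nn_integral_mono) (simp add: ennreal_mult[symmetric] ennreal_plus[symmetric] ennreal_leI del: ennreal_plus)
    also have "\<dots> = ennreal (2 ^ k) * (\<integral>\<^sup>+ z. ennreal ((d k z)\<^sup>2) \<partial>?M) + ennreal ((1/2) ^ k) * emeasure ?M {a..b}"
      by (subst nn_integral_add) (auto simp: nn_integral_cmult)
    also have "(\<integral>\<^sup>+ z. ennreal ((d k z)\<^sup>2) \<partial>?M) \<le> (\<integral>\<^sup>+ z. ennreal ((d k z)\<^sup>2) \<partial>lebesgue)"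
      by (subst nn_integral_restrict_space) (auto intro!: nn_integral_mono simp: indicator_def)
    also have "\<dots> = ennreal (sq_norm (u (r (Suc k)) - u (r k)))"
      by (simp add: sq_norm_nn d_def f_def)
    also have "\<dots> \<le> ennreal ((1/4) ^ k)" using small[of k] by (intro ennreal_leI) simp
    also have "emeasure ?M {a..b} = ennreal (max 0 (b - a))"
      by (subst emeasure_restrict_space) (auto simp: emeasure_lborel_Icc_eq max_def)
    also have "ennreal (2 ^ k) * ennreal ((1/4) ^ k) + ennreal ((1/2) ^ k) * ennreal (max 0 (b - a))
      = ennreal (2 ^ k * (1/4) ^ k + (1/2) ^ k * max 0 (b - a))"
      by (simp add: ennreal_mult[symmetric] ennreal_plus[symmetric] del: ennreal_plus)
    also have "2 ^ k * (1/4) ^ k + (1/2) ^ k * max 0 (b - a) = (1 + max 0 (b - a)) * (1/2) ^ k"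
      by (simp add: power_mult_distrib[symmetric] algebra_simps)
    finally show ?thesis by (simp add: add_mono mult_left_mono)
  qed
  have "(\<integral>\<^sup>+ z. (\<Sum>k. ennreal (d k z)) \<partial>?M) = (\<Sum>k. \<integral>\<^sup>+ z. ennreal (d k z) \<partial>?M)"
    by (intro nn_integral_suminf) measurable
  also have "\<dots> \<le> (\<Sum>k. ennreal ((1 + max 0 (b - a)) * (1/2) ^ k))"
    by (intro suminf_le dle) auto
  also have "\<dots> = ennreal (\<Sum>k. (1 + max 0 (b - a)) * (1/2) ^ k)"
    by (intro suminf_ennreal2) (auto intro!: summable_mult summable_geometric)
  also have "\<dots> < \<infinity>" by simp
  finally have "AE z in ?M. (\<Sum>k. ennreal (d k z)) \<noteq> \<infinity>"
    by (intro nn_integral_PInf_AE) auto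
  then have aeM: "AE z in lebesgue. z \<in> {a..b} \<longrightarrow> (\<Sum>k. ennreal (d k z)) \<noteq> \<infinity>"
    by (simp add: AE_restrict_space_iff)
  define g where "g z = (if z \<in> {a..b} then lim (\<lambda>k. f k z) else 0)" for z
  have gm [measurable]: "g \<in> borel_measurable lebesgue"
    unfolding g_def by (intro measurable_If_set borel_measurable_lim_metric fm) auto
  have z0: "AE z in lebesgue. \<forall>k. z \<notin> {a..b} \<longrightarrow> f k z = 0"
    unfolding AE_all_countable using u by (simp add: L2_on_def f_def)
  have lim: "AE z in lebesgue. (\<lambda>k. f k z) \<longlonglongrightarrow> g z"
    using aeM z0
  proof eventually_elim
    case (elim z)
    show ?case
    proof (cases "z \<in> {a..b}")
      case True
      then have "(\<Sum>k. ennreal (d k z)) \<noteq> \<infinity>" using elim by simp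
      then have "summable (\<lambda>k. d k z)" by (intro summable_suminf_not_top) (auto simp: d_def)
      then have "summable (\<lambda>k. f (Suc k) z - f k z)" unfolding d_def by (rule summable_norm_cancel)
      then have "convergent (\<lambda>n. \<Sum>k<n. f (Suc k) z - f k z)" by (simp add: summable_iff_convergent)
      then have "convergent (\<lambda>n. f n z - f 0 z)" by (simp add: sum_lessThan_telescope[of "\<lambda>k. f k z"])
      then have "convergent (\<lambda>n. (f n z - f 0 z) + f 0 z)" by (intro convergent_add convergent_const)
      then show ?thesis using True by (simp add: g_def convergent_LIMSEQ_iff)
    next
      case False then show ?thesis using elim by (simp add: g_def)
    qed
  qed
  \<comment> \<open>The index \<open>n\<close> stays fixed while the subsequence runs to its limit,
    so the Cauchy bound passes to the distance between \<open>g\<close> and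
    \<open>u n\<close>.\<close>
  have fatou: "(\<integral>\<^sup>+ z. ennreal ((norm (g z - rep_l2 (u n) z))\<^sup>2) \<partial>lebesgue) \<le> ennreal \<epsilon>"
    if e: "\<epsilon> > 0" and n: "\<And>k. k \<ge> K \<Longrightarrow> sq_norm (u k - u n) < \<epsilon>" for \<epsilon> n K
  proof -
    let ?h = "rep_l2 (u n)"
    have "(\<integral>\<^sup>+ z. ennreal ((norm (g z - ?h z))\<^sup>2) \<partial>lebesgue)
      = (\<integral>\<^sup>+ z. liminf (\<lambda>k. ennreal ((norm (f k z - ?h z))\<^sup>2)) \<partial>lebesgue)"
    proof (rule nn_integral_cong_AE)
      show "AE z in lebesgue. ennreal ((norm (g z - ?h z))\<^sup>2) = liminf (\<lambda>k. ennreal ((norm (f k z - ?h z))\<^sup>2))"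
        using lim
      proof eventually_elim
        case (elim z)
        have "(\<lambda>k. ennreal ((norm (f k z - ?h z))\<^sup>2)) \<longlonglongrightarrow> ennreal ((norm (g z - ?h z))\<^sup>2)"
          by (intro tendsto_ennrealI tendsto_intros elim)
        then show ?case by (intro lim_imp_Liminf[symmetric]) auto
      qed
    qed
    also have "\<dots> \<le> liminf (\<lambda>k. \<integral>\<^sup>+ z. ennreal ((norm (f k z - ?h z))\<^sup>2) \<partial>lebesgue)"
      by (intro nn_integral_liminf) auto
    also have "\<dots> = liminf (\<lambda>k. ennreal (sq_norm (u (r k) - u n)))"
      by (simp add: sq_norm_nn f_def)
    also have "\<dots> \<le> limsup (\<lambda>k. ennreal (sq_norm (u (r k) - u n)))"
      by (intro Liminf_le_Limsup) simp
    also have "\<dots> \<le> ennreal \<epsilon>"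
    proof (rule Limsup_bounded)
      have "sq_norm (u (r k) - u n) \<le> \<epsilon>" if "k \<ge> K" for k
        using that by (intro less_imp_le[OF n]) (simp add: r_def)
      then show "\<forall>\<^sub>F k in sequentially. ennreal (sq_norm (u (r k) - u n)) \<le> ennreal \<epsilon>"
        by (auto simp: eventually_sequentially intro!: exI[of _ K] ennreal_leI)
    qed
    finally show ?thesis .
  qed
  obtain K0 where K0: "\<And>i j. i \<ge> K0 \<Longrightarrow> j \<ge> K0 \<Longrightarrow> sq_norm (u i - u j) < 1"
    using c[of 1] by auto
  \<comment> \<open>Only differences from \<open>g\<close> are under control, so \<open>g\<close>
    becomes square integrable by adding \<open>u K0\<close> back.\<close>
  have "square_integrable (\<lambda>z. g z - rep_l2 (u K0) z)"
    unfolding square_integrable_def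
  proof
    show "integrable lebesgue (\<lambda>z. (norm (g z - rep_l2 (u K0) z))\<^sup>2)"
    proof (rule integrableI_bounded)
      have "(\<integral>\<^sup>+ z. ennreal (norm ((norm (g z - rep_l2 (u K0) z))\<^sup>2)) \<partial>lebesgue) \<le> ennreal 1"
        using fatou[of 1 K0 K0] K0 by simp
      also have "\<dots> < \<infinity>" by simp
      finally show "(\<integral>\<^sup>+ z. ennreal (norm ((norm (g z - rep_l2 (u K0) z))\<^sup>2)) \<partial>lebesgue) < \<infinity>" .
    qed simp
  qed simp
  from square_integrable_add[OF this square_integrable_rep[of "u K0"]]
  have gsq: "square_integrable g" by simp
  have rg: "AE z in lebesgue. rep_l2 (abs_l2 g) z = g z" by (rule rep_abs_AE[OF gsq])
  have "abs_l2 g \<in> L2_on a b"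
    by (rule abs_l2_L2_on[OF gsq]) (simp add: g_def)
  moreover have "(\<lambda>n. sq_norm (u n - abs_l2 g)) \<longlonglongrightarrow> 0"
  proof (rule LIMSEQ_I)
    fix \<epsilon> :: real assume e: "\<epsilon> > 0"
    then obtain K where K: "\<And>i j. i \<ge> K \<Longrightarrow> j \<ge> K \<Longrightarrow> sq_norm (u i - u j) < \<epsilon> / 2"
      using c[of "\<epsilon> / 2"] by auto
    have "sq_norm (u n - abs_l2 g) < \<epsilon>" if n: "n \<ge> K" for n
    proof -
      have "ennreal (sq_norm (u n - abs_l2 g)) = (\<integral>\<^sup>+ z. ennreal ((norm (rep_l2 (u n) z - rep_l2 (abs_l2 g) z))\<^sup>2) \<partial>lebesgue)"
        by (rule sq_norm_nn)
      also have "\<dots> = (\<integral>\<^sup>+ z. ennreal ((norm (g z - rep_l2 (u n) z))\<^sup>2) \<partial>lebesgue)"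
        using rg by (intro nn_integral_cong_AE) (auto elim!: eventually_mono simp: norm_minus_commute)
      also have "\<dots> \<le> ennreal (\<epsilon> / 2)" using fatou[of "\<epsilon> / 2" K n] K n e by simp
      finally show ?thesis using e by (simp add: ennreal_le_iff)
    qed
    then show "\<exists>no. \<forall>n\<ge>no. norm (sq_norm (u n - abs_l2 g) - 0) < \<epsilon>" by auto
  qed
  ultimately show ?thesis by blast
qed

definition l2_inner :: "l2 \<Rightarrow> l2 \<Rightarrow> real" where
  "l2_inner x y = (LINT z|lebesgue. rep_l2 x z \<bullet> rep_l2 y z)"

lemma l2_inner_integrable: "integrable lebesgue (\<lambda>z. rep_l2 x z \<bullet> rep_l2 y z)"
proof (rule Bochner_Integration.integrable_bound)
  show "integrable lebesgue (\<lambda>z. (norm (rep_l2 x z))\<^sup>2 + (norm (rep_l2 y z))\<^sup>2)" by simp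
  have "\<bar>u \<bullet> v\<bar> \<le> (norm u)\<^sup>2 + (norm v)\<^sup>2" for u v :: "real^2"
  proof -
    have "\<bar>u \<bullet> v\<bar> \<le> norm u * norm v" by (rule Cauchy_Schwarz_ineq2)
    moreover have "2 * (norm u * norm v) \<le> (norm u)\<^sup>2 + (norm v)\<^sup>2"
      using sum_squares_bound[of "norm u" "norm v"] by simp
    moreover have "0 \<le> norm u * norm v" by simp
    ultimately show ?thesis by linarith
  qed
  then show "AE z in lebesgue. norm (rep_l2 x z \<bullet> rep_l2 y z) \<le> norm ((norm (rep_l2 x z))\<^sup>2 + (norm (rep_l2 y z))\<^sup>2)"
    by simp
qed measurable

lemma l2_inner_commute: "l2_inner x y = l2_inner y x"
  by (simp add: l2_inner_def inner_commute)

lemma l2_inner_add: "l2_inner (x + y) z = l2_inner x z + l2_inner y z"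
proof -
  have "l2_inner (x + y) z = (LINT t|lebesgue. rep_l2 x t \<bullet> rep_l2 z t + rep_l2 y t \<bullet> rep_l2 z t)"
    unfolding l2_inner_def
    by (intro integral_cong_AE) (use rep_add[of x y] in \<open>auto elim!: eventually_mono simp: inner_add_left\<close>)
  then show ?thesis using l2_inner_integrable by (simp add: l2_inner_def)
qed

lemma l2_inner_scale: "l2_inner (c *\<^sub>R x) z = c * l2_inner x z"
proof -
  have "l2_inner (c *\<^sub>R x) z = (LINT t|lebesgue. c * (rep_l2 x t \<bullet> rep_l2 z t))"
    unfolding l2_inner_def
    by (intro integral_cong_AE) (use rep_scale[of c x] in \<open>auto elim!: eventually_mono\<close>)
  then show ?thesis using l2_inner_integrable by (simp add: l2_inner_def)
qed

lemma l2_inner_diff: "l2_inner (x - y) z = l2_inner x z - l2_inner y z"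
  using l2_inner_add[of x "(-1) *\<^sub>R y" z] l2_inner_scale[of "-1" y z] by simp

lemma l2_inner_scale_right: "l2_inner z (c *\<^sub>R x) = c * l2_inner z x"
  using l2_inner_scale by (simp add: l2_inner_commute[of z])

lemma l2_inner_diff_right: "l2_inner z (x - y) = l2_inner z x - l2_inner z y"
  using l2_inner_diff by (simp add: l2_inner_commute[of z])

lemma l2_inner_self: "l2_inner x x = sq_norm x"
  by (simp add: l2_inner_def sq_norm_def power2_norm_eq_inner)

lemma l2_inner_mono_AE:
  assumes "AE z in lebesgue. rep_l2 x z \<bullet> rep_l2 y z \<le> rep_l2 u z \<bullet> rep_l2 v z"
  shows "l2_inner x y \<le> l2_inner u v"
  unfolding l2_inner_def using assms by (intro integral_mono_AE l2_inner_integrable)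

lemma l2_inner_cong_AE:
  assumes "AE z in lebesgue. rep_l2 x z \<bullet> rep_l2 y z = rep_l2 u z \<bullet> rep_l2 v z"
  shows "l2_inner x y = l2_inner u v"
  unfolding l2_inner_def using assms by (intro integral_cong_AE) auto

text \<open>Elements of the carrier vanish outside the interval, so the bounds on \<open>Q\<close>
  are local to it. Thus both \<open>Q0\<close>, which is zero outside, and the constant identity
  matrix are instances.\<close>

locale coercive_multiplier =
  fixes a b m K :: real and Q :: "real \<Rightarrow> real^2^2"
  assumes m_pos: "0 < m" and K_pos: "0 < K"
    and Q_measurable [measurable]: "Q \<in> borel_measurable lebesgue"
    and Q_sym: "AE z in lebesgue. z \<in> {a..b} \<longrightarrow> transpose (Q z) = Q z"
    and Q_lower: "AE z in lebesgue. z \<in> {a..b} \<longrightarrow> (\<forall>v. m * (v \<bullet> v) \<le> v \<bullet> (Q z *v v))"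
    and Q_upper: "AE z in lebesgue. z \<in> {a..b} \<longrightarrow> (\<forall>v. norm (Q z *v v) \<le> K * norm v)"
begin

abbreviation "X \<equiv> L2_on a b"
abbreviation "M \<equiv> mult_op Q"

lemma X_AE: "x \<in> X \<Longrightarrow> AE z in lebesgue. z \<notin> {a..b} \<longrightarrow> rep_l2 x z = 0"
  by (simp add: L2_on_def)

lemma mult_square_integrable:
  assumes x: "x \<in> X"
  shows "square_integrable (\<lambda>z. Q z *v rep_l2 x z)"
  unfolding square_integrable_def
proof
  show "integrable lebesgue (\<lambda>z. (norm (Q z *v rep_l2 x z))\<^sup>2)"
  proof (rule Bochner_Integration.integrable_bound)
    show "integrable lebesgue (\<lambda>z. K\<^sup>2 * (norm (rep_l2 x z))\<^sup>2)" by simp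
    show "AE z in lebesgue. norm ((norm (Q z *v rep_l2 x z))\<^sup>2) \<le> norm (K\<^sup>2 * (norm (rep_l2 x z))\<^sup>2)"
      using X_AE[OF x] Q_upper
    proof eventually_elim
      case (elim z)
      have "norm (Q z *v rep_l2 x z) \<le> K * norm (rep_l2 x z)"
        using elim K_pos by (cases "z \<in> {a..b}") auto
      then have "(norm (Q z *v rep_l2 x z))\<^sup>2 \<le> (K * norm (rep_l2 x z))\<^sup>2"
        by (intro power_mono) auto
      then show ?case by (simp add: power_mult_distrib)
    qed
  qed measurable
qed measurable

lemma rep_M: "x \<in> X \<Longrightarrow> AE z in lebesgue. rep_l2 (M x) z = Q z *v rep_l2 x z"
  unfolding mult_op_def by (intro rep_abs_AE mult_square_integrable)

lemma M_X [simp]: "x \<in> X \<Longrightarrow> M x \<in> X"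
  unfolding mult_op_def
  by (intro abs_l2_L2_on mult_square_integrable) (use X_AE[of x] in \<open>auto elim!: eventually_mono\<close>)

lemma X_closed [simp]: "x \<in> X \<Longrightarrow> y \<in> X \<Longrightarrow> x + y \<in> X" "x \<in> X \<Longrightarrow> c *\<^sub>R x \<in> X"
  "x \<in> X \<Longrightarrow> y \<in> X \<Longrightarrow> x - y \<in> X"
  using L2_on_subspace[of a b] by (auto intro: subspace_add subspace_scale subspace_diff)

lemma M_add: "x \<in> X \<Longrightarrow> y \<in> X \<Longrightarrow> M (x + y) = M x + M y"
proof (rule l2_eqI)
  assume x: "x \<in> X" and y: "y \<in> X"
  show "AE z in lebesgue. rep_l2 (M (x + y)) z = rep_l2 (M x + M y) z"
    using rep_M[OF X_closed(1)[OF x y]] rep_M[OF x] rep_M[OF y] rep_add[of x y] rep_add[of "M x" "M y"]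
    by eventually_elim (simp add: matrix_vector_right_distrib)
qed

lemma M_scale: "x \<in> X \<Longrightarrow> M (c *\<^sub>R x) = c *\<^sub>R M x"
proof (rule l2_eqI)
  assume x: "x \<in> X"
  show "AE z in lebesgue. rep_l2 (M (c *\<^sub>R x)) z = rep_l2 (c *\<^sub>R M x) z"
    using rep_M[OF X_closed(2)[OF x, of c]] rep_M[OF x] rep_scale[of c x] rep_scale[of c "M x"]
    by eventually_elim (simp add: matrix_vector_mult_scaleR)
qed

lemma M_diff: "x \<in> X \<Longrightarrow> y \<in> X \<Longrightarrow> M (x - y) = M x - M y"
  using M_add[of x "(-1) *\<^sub>R y"] M_scale[of y "-1"] X_closed(2)[of y "-1"] by simp

lemma M_sym: "x \<in> X \<Longrightarrow> y \<in> X \<Longrightarrow> l2_inner (M x) y = l2_inner x (M y)"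
proof (rule l2_inner_cong_AE)
  assume x: "x \<in> X" and y: "y \<in> X"
  show "AE z in lebesgue. rep_l2 (M x) z \<bullet> rep_l2 y z = rep_l2 x z \<bullet> rep_l2 (M y) z"
    using rep_M[OF x] rep_M[OF y] X_AE[OF x] Q_sym
  proof eventually_elim
    case (elim z)
    show ?case
    proof (cases "z \<in> {a..b}")
      case True
      then have "(Q z *v rep_l2 x z) \<bullet> rep_l2 y z = rep_l2 x z \<bullet> (Q z *v rep_l2 y z)"
        using elim dot_lmul_matrix[of "rep_l2 x z" "transpose (Q z)" "rep_l2 y z"]
        by (metis vector_transpose_matrix dot_lmul_matrix transpose_transpose)
      then show ?thesis using elim by simp
    next
      case False
      then show ?thesis using elim by simp
    qed
  qed
qed

lemma M_lower: "x \<in> X \<Longrightarrow> m * sq_norm x \<le> l2_inner x (M x)"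
proof -
  assume x: "x \<in> X"
  have "l2_inner (m *\<^sub>R x) x \<le> l2_inner x (M x)"
  proof (rule l2_inner_mono_AE)
    show "AE z in lebesgue. rep_l2 (m *\<^sub>R x) z \<bullet> rep_l2 x z \<le> rep_l2 x z \<bullet> rep_l2 (M x) z"
      using rep_scale[of m x] rep_M[OF x] X_AE[OF x] Q_lower
    proof eventually_elim
      case (elim z)
      then show ?case by (cases "z \<in> {a..b}") auto
    qed
  qed
  then show ?thesis by (simp add: l2_inner_scale l2_inner_self)
qed

lemma M_bound: "x \<in> X \<Longrightarrow> sq_norm (M x) \<le> K\<^sup>2 * sq_norm x"
proof -
  assume x: "x \<in> X"
  have "l2_inner (M x) (M x) \<le> l2_inner (K\<^sup>2 *\<^sub>R x) x"
  proof (rule l2_inner_mono_AE)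
    show "AE z in lebesgue. rep_l2 (M x) z \<bullet> rep_l2 (M x) z \<le> rep_l2 (K\<^sup>2 *\<^sub>R x) z \<bullet> rep_l2 x z"
      using rep_scale[of "K\<^sup>2" x] rep_M[OF x] X_AE[OF x] Q_upper
    proof eventually_elim
      case (elim z)
      have "norm (Q z *v rep_l2 x z) \<le> K * norm (rep_l2 x z)"
        using elim K_pos by (cases "z \<in> {a..b}") auto
      then have "(norm (Q z *v rep_l2 x z))\<^sup>2 \<le> (K * norm (rep_l2 x z))\<^sup>2"
        by (intro power_mono) auto
      then show ?case using elim by (simp add: power_mult_distrib power2_norm_eq_inner)
    qed
  qed
  then show ?thesis by (simp add: l2_inner_scale l2_inner_self)
qed

lemma energy_inner_eq: "x \<in> X \<Longrightarrow> energy_inner a b Q x y = l2_inner y (M x) / 2"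
proof -
  assume x: "x \<in> X"
  have "(LINT z|lebesgue_on {a..b}. rep_l2 y z \<bullet> (Q z *v rep_l2 x z))
    = (LINT z|lebesgue. indicator {a..b} z * (rep_l2 y z \<bullet> (Q z *v rep_l2 x z)))"
    by (simp add: integral_restrict_space)
  also have "\<dots> = (LINT z|lebesgue. rep_l2 y z \<bullet> rep_l2 (M x) z)"
  proof (intro integral_cong_AE)
    show "AE z in lebesgue. indicator {a..b} z * (rep_l2 y z \<bullet> (Q z *v rep_l2 x z)) = rep_l2 y z \<bullet> rep_l2 (M x) z"
      using rep_M[OF x] X_AE[OF x] by eventually_elim (auto simp: indicator_def)
    show "(\<lambda>z. indicator {a..b} z * (rep_l2 y z \<bullet> (Q z *v rep_l2 x z))) \<in> borel_measurable lebesgue"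
      by (intro borel_measurable_times borel_measurable_indicator borel_measurable_inner measurable_matrix_vector
          rep_measurable Q_measurable) simp
    show "(\<lambda>z. rep_l2 y z \<bullet> rep_l2 (M x) z) \<in> borel_measurable lebesgue"
      by (intro borel_measurable_inner rep_measurable)
  qed
  finally show ?thesis by (simp add: energy_inner_def l2_inner_def)
qed

text \<open>The two-sided bounds make the energy form equivalent to \<open>sq_norm\<close>;
  definiteness and completeness are inherited from there.\<close>

sublocale energy_space X "energy_inner a b Q" "energy_norm a b Q"
proof
  show "subspace X" by (rule L2_on_subspace)
  show "energy_inner a b Q (x + y) z = energy_inner a b Q x z + energy_inner a b Q y z"
    if "x \<in> X" "y \<in> X" "z \<in> X" for x y z
    using that l2_inner_add[of "M x" "M y" z] by (simp add: energy_inner_eq M_add l2_inner_commute[of z])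
  show "energy_inner a b Q (c *\<^sub>R x) z = c * energy_inner a b Q x z" if "x \<in> X" "z \<in> X" for c x z
    using that l2_inner_scale[of c "M x" z] by (simp add: energy_inner_eq M_scale l2_inner_commute[of z])
  show "energy_inner a b Q x y = energy_inner a b Q y x" if "x \<in> X" "y \<in> X" for x y
    using that M_sym[of x y] by (simp add: energy_inner_eq l2_inner_commute[of y])
  have low: "m * sq_norm x / 2 \<le> energy_inner a b Q x x" if "x \<in> X" for x
    using M_lower[OF that] that by (simp add: energy_inner_eq)
  show nn: "0 \<le> energy_inner a b Q x x" if "x \<in> X" for x
    using low[OF that] m_pos sq_norm_nonneg[of x] by (meson divide_nonneg_nonneg less_imp_le mult_nonneg_nonneg order_trans zero_le_numeral)
  show "x = 0" if "x \<in> X" "energy_inner a b Q x x = 0" for x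
  proof -
    have "m * sq_norm x \<le> 0" using low[OF that(1)] that(2) by simp
    then have "sq_norm x = 0" using m_pos sq_norm_nonneg[of x] by (simp add: mult_le_0_iff)
    then show ?thesis by (rule sq_norm_eq_0)
  qed
  show "energy_norm a b Q x = sqrt (energy_inner a b Q x x)" for x by (simp add: energy_norm_def)
  fix u assume u: "\<And>n::nat. u n \<in> X"
    and c: "\<And>\<epsilon>. \<epsilon> > 0 \<Longrightarrow> \<exists>K. \<forall>i\<ge>K. \<forall>j\<ge>K. energy_norm a b Q (u i - u j) < \<epsilon>"
  have "\<exists>x\<in>X. (\<lambda>n. sq_norm (u n - x)) \<longlonglongrightarrow> 0"
  proof (rule Riesz_Fischer[OF u])
    fix \<epsilon> :: real assume e: "\<epsilon> > 0"
    have "sqrt (m * \<epsilon> / 2) > 0" using e m_pos by simp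
    from c[OF this] obtain L where L: "\<And>i j. i \<ge> L \<Longrightarrow> j \<ge> L \<Longrightarrow> energy_norm a b Q (u i - u j) < sqrt (m * \<epsilon> / 2)"
      by blast
    have "sq_norm (u i - u j) < \<epsilon>" if "i \<ge> L" "j \<ge> L" for i j
    proof -
      have "energy_inner a b Q (u i - u j) (u i - u j) < m * \<epsilon> / 2"
        using L[OF that] by (simp add: energy_norm_def)
      then have "m * sq_norm (u i - u j) < m * \<epsilon>" using low[of "u i - u j"] u by simp
      then show ?thesis using m_pos by simp
    qed
    then show "\<exists>K. \<forall>i\<ge>K. \<forall>j\<ge>K. sq_norm (u i - u j) < \<epsilon>" by blast
  qed
  then obtain x where x: "x \<in> X" "(\<lambda>n. sq_norm (u n - x)) \<longlonglongrightarrow> 0" by blast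
  \<comment> \<open>Expanding the nonnegative number \<open>sq_norm (M y - y)\<close> bounds the
    mixed term, so \<open>M_bound\<close> suffices.\<close>
  have up: "energy_inner a b Q y y \<le> (1 + K\<^sup>2) * sq_norm y" if y: "y \<in> X" for y
  proof -
    have "0 \<le> sq_norm (M y - y)" by simp
    also have "sq_norm (M y - y) = sq_norm (M y) - 2 * l2_inner y (M y) + sq_norm y"
      by (simp add: l2_inner_diff l2_inner_diff_right l2_inner_commute[of "M y" y] flip: l2_inner_self)
    finally have "2 * l2_inner y (M y) \<le> (1 + K\<^sup>2) * sq_norm y"
      using M_bound[OF y] by (simp add: algebra_simps)
    moreover have "0 \<le> (1 + K\<^sup>2) * sq_norm y" by simp
    ultimately show ?thesis unfolding energy_inner_eq[OF y] by linarith
  qed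
  have lim: "(\<lambda>n. sqrt ((1 + K\<^sup>2) * sq_norm (u n - x))) \<longlonglongrightarrow> 0"
    using tendsto_real_sqrt[OF tendsto_mult_right_zero[OF x(2), of "1 + K\<^sup>2"]] by simp
  have "(\<lambda>n. energy_norm a b Q (u n - x)) \<longlonglongrightarrow> 0"
  proof (rule tendsto_sandwich[OF _ _ tendsto_const lim])
    show "\<forall>\<^sub>F n in sequentially. 0 \<le> energy_norm a b Q (u n - x)"
      using nn[of "u _ - x"] u x by (simp add: energy_norm_def)
    show "\<forall>\<^sub>F n in sequentially. energy_norm a b Q (u n - x) \<le> sqrt ((1 + K\<^sup>2) * sq_norm (u n - x))"
      using up[of "u _ - x"] u x by (simp add: energy_norm_def)
  qed
  then show "\<exists>x\<in>X. (\<lambda>n. energy_norm a b Q (u n - x)) \<longlonglongrightarrow> 0" using x(1) by blast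
qed

end

text \<open>This makes L2 itself, with half its usual inner product, an energy space: the setting of
  the constant coefficient problem and of both fixed point arguments.\<close>

lemma identity_multiplier: "coercive_multiplier a b 1 1 (\<lambda>_. mat 1)"
  by standard (auto simp: transpose_mat)

lemma mult_op_identity: "mult_op (\<lambda>_. mat 1) x = x"
  by (simp add: mult_op_def abs_rep)

text \<open>The number \<open>s0 / s1\<^sup>2\<close> minimises 1 - 2 \<tau> s0 + \<tau>^2 s1^2 in
  \<tau>, and the factor on the right is the minimum. Here \<open>p\<close> stands for a squared
  norm and \<open>c\<close> for the value of the form.\<close>

lemma near_identity_contraction:
  fixes s0 s1 p c :: real
  shows "0 < s0 \<Longrightarrow> 0 < s1 \<Longrightarrow> 0 \<le> p \<Longrightarrow> s0 * p \<le> c \<Longrightarrow> 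
    p - 2 * (s0 / s1\<^sup>2) * c + (s0 / s1\<^sup>2)\<^sup>2 * (s1\<^sup>2 * p) \<le> (1 - s0\<^sup>2 / s1\<^sup>2) * p"
proof -
  assume a: "0 < s0" "0 < s1" "0 \<le> p" "s0 * p \<le> c"
  have "(s0 / s1\<^sup>2) * (s0 * p) \<le> (s0 / s1\<^sup>2) * c" using a by (intro mult_left_mono) auto
  then show ?thesis using a by (simp add: field_simps power2_eq_square)
qed

text \<open>
  The choice $\tau=s_0/s_1^2$ gives $\|x-\tau Cx\|^2\le(1-s_0^2/s_1^2)\|x\|^2$.
\<close>

lemma (in energy_space) scaled_contraction:
  assumes C: "\<And>x. x \<in> X \<Longrightarrow> C x \<in> X" and s: "0 < s0" "0 < s1"
    and low: "\<And>x. x \<in> X \<Longrightarrow> s0 * ip x x \<le> ip (C x) x"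
    and up: "\<And>x. x \<in> X \<Longrightarrow> ip (C x) (C x) \<le> s1\<^sup>2 * ip x x"
  shows "\<exists>\<tau>>0. \<exists>q. 0 \<le> q \<and> q < 1 \<and> (\<forall>x\<in>X. N (x - \<tau> *\<^sub>R C x) \<le> q * N x)"
proof -
  define \<tau> where "\<tau> = s0 / s1\<^sup>2"
  have t: "\<tau> > 0" using s by (simp add: \<tau>_def)
  \<comment> \<open>The maximum keeps \<open>q\<close> nonnegative when \<open>s0\<close> exceeds
    \<open>s1\<close>, since \<open>sqrt\<close> of a negative number is negative.\<close>
  define q where "q = sqrt (max 0 (1 - s0\<^sup>2 / s1\<^sup>2))"
  have q: "0 \<le> q" "q < 1" using s by (auto simp: q_def max_def)
  have "N (x - \<tau> *\<^sub>R C x) \<le> q * N x" if x: "x \<in> X" for x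
  proof -
    have "ip (x - \<tau> *\<^sub>R C x) (x - \<tau> *\<^sub>R C x) = ip x x - 2 * \<tau> * ip (C x) x + \<tau>\<^sup>2 * ip (C x) (C x)"
      using x C[OF x] ip_sym[OF x C[OF x]] by (simp add: ip_simps power2_eq_square algebra_simps)
    also have "\<dots> \<le> ip x x - 2 * \<tau> * ip (C x) x + \<tau>\<^sup>2 * (s1\<^sup>2 * ip x x)"
      using up[OF x] by (intro add_left_mono mult_left_mono) auto
    also have "\<dots> \<le> (1 - s0\<^sup>2 / s1\<^sup>2) * ip x x"
      unfolding \<tau>_def using s low[OF x] ip_nonneg[OF x] by (intro near_identity_contraction) auto
    also have "\<dots> \<le> max 0 (1 - s0\<^sup>2 / s1\<^sup>2) * ip x x"
      using ip_nonneg[OF x] by (intro mult_right_mono) auto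
    finally have "sqrt (ip (x - \<tau> *\<^sub>R C x) (x - \<tau> *\<^sub>R C x)) \<le> sqrt (max 0 (1 - s0\<^sup>2 / s1\<^sup>2) * ip x x)"
      by (rule real_sqrt_le_mono)
    then show ?thesis by (simp add: N_eq q_def real_sqrt_mult)
  qed
  then show ?thesis using t q by blast
qed

context coercive_multiplier
begin

text \<open>No pointwise inverse matrices are formed: for a suitable \<tau> the map sending x to x -
  \<tau> M x + \<tau> e is a strict contraction in L2, and its fixed point solves
  \<open>M x = e\<close>.\<close>

lemma M_surjective:
  assumes e: "e \<in> X"
  shows "\<exists>x\<in>X. M x = e"
proof -
  interpret I: coercive_multiplier a b 1 1 "\<lambda>_. mat 1" by (rule identity_multiplier)
  have I: "energy_inner a b (\<lambda>_. mat 1) x y = l2_inner y x / 2" if "x \<in> X" for x y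
    using I.energy_inner_eq[OF that] by (simp add: mult_op_identity)
  have "\<exists>\<tau>>0. \<exists>q. 0 \<le> q \<and> q < 1 \<and> (\<forall>x\<in>X. energy_norm a b (\<lambda>_. mat 1) (x - \<tau> *\<^sub>R M x) \<le> q * energy_norm a b (\<lambda>_. mat 1) x)"
    by (rule I.scaled_contraction[OF M_X m_pos K_pos])
      (use M_lower M_bound in \<open>auto simp: I l2_inner_self\<close>)
  then obtain \<tau> q where t: "\<tau> > 0" and q: "0 \<le> q" "q < 1"
    and c: "\<And>x. x \<in> X \<Longrightarrow> energy_norm a b (\<lambda>_. mat 1) (x - \<tau> *\<^sub>R M x) \<le> q * energy_norm a b (\<lambda>_. mat 1) x" by blast
  have "\<exists>x\<in>X. x - \<tau> *\<^sub>R M x + \<tau> *\<^sub>R e = x"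
  proof (rule I.contraction_fixpoint[OF _ q])
    show "x - \<tau> *\<^sub>R M x + \<tau> *\<^sub>R e \<in> X" if "x \<in> X" for x using that e by simp
    fix x y assume x: "x \<in> X" and y: "y \<in> X"
    have "x - \<tau> *\<^sub>R M x + \<tau> *\<^sub>R e - (y - \<tau> *\<^sub>R M y + \<tau> *\<^sub>R e) = (x - y) - \<tau> *\<^sub>R M (x - y)"
      using x y by (simp add: M_diff scaleR_diff_right)
    from arg_cong[OF this, of "energy_norm a b (\<lambda>_. mat 1)"]
    show "energy_norm a b (\<lambda>_. mat 1) (x - \<tau> *\<^sub>R M x + \<tau> *\<^sub>R e - (y - \<tau> *\<^sub>R M y + \<tau> *\<^sub>R e))
      \<le> q * energy_norm a b (\<lambda>_. mat 1) (x - y)"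
      using c[OF X_closed(3)[OF x y]] by (rule ord_eq_le_trans)
  qed
  then obtain x where x: "x \<in> X" "x - \<tau> *\<^sub>R M x + \<tau> *\<^sub>R e = x" by blast
  then have "\<tau> *\<^sub>R (e - M x) = 0" by (simp add: algebra_simps)
  then have "M x = e" using t by simp
  then show ?thesis using x by blast
qed

text \<open>Strong monotonicity of the inverse of \<open>M\<close>, written through the preimage
  \<open>x\<close> of \<open>M x\<close>.\<close>

lemma M_lower_image: "x \<in> X \<Longrightarrow> m / K\<^sup>2 * sq_norm (M x) \<le> l2_inner x (M x)"
proof -
  assume x: "x \<in> X"
  have "m / K\<^sup>2 * sq_norm (M x) \<le> m / K\<^sup>2 * (K\<^sup>2 * sq_norm x)"
    using M_bound[OF x] m_pos by (intro mult_left_mono) auto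
  also have "\<dots> = m * sq_norm x" using K_pos by simp
  finally show ?thesis using M_lower[OF x] by simp
qed

text \<open>The norm bound 1/m for the inverse of \<open>M\<close>. Expanding the squared norm of
  \<open>M x - m *\<^sub>R x\<close> and inserting coercivity gives it directly.\<close>

lemma M_expansive: "x \<in> X \<Longrightarrow> sq_norm x \<le> (1 / m)\<^sup>2 * sq_norm (M x)"
proof -
  assume x: "x \<in> X"
  have "0 \<le> sq_norm (M x - m *\<^sub>R x)" by simp
  also have "\<dots> = sq_norm (M x) - 2 * m * l2_inner x (M x) + m\<^sup>2 * sq_norm x"
    by (simp add: l2_inner_diff l2_inner_diff_right l2_inner_scale l2_inner_scale_right l2_inner_commute[of "M x" x] power2_eq_square
        algebra_simps flip: l2_inner_self)
  also have "\<dots> \<le> sq_norm (M x) - 2 * m * (m * sq_norm x) + m\<^sup>2 * sq_norm x"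
    using M_lower[OF x] m_pos by (intro add_right_mono diff_left_mono mult_left_mono) auto
  finally have "m\<^sup>2 * sq_norm x \<le> sq_norm (M x)" by (simp add: power2_eq_square)
  then show ?thesis using m_pos by (simp add: field_simps power2_eq_square)
qed

end

section \<open>Primitives of square integrable functions\<close>

lemma L2_fun_mult:
  assumes f: "L2_fun \<alpha> \<beta> f" and g: "L2_fun \<alpha> \<beta> g"
  shows "integrable (lebesgue_on {\<alpha><..<\<beta>}) (\<lambda>z. f z * g z)"
proof (rule Bochner_Integration.integrable_bound)
  show "integrable (lebesgue_on {\<alpha><..<\<beta>}) (\<lambda>z. (f z)\<^sup>2 + (g z)\<^sup>2)"
    using f g by (auto simp: L2_fun_def)
  show "(\<lambda>z. f z * g z) \<in> borel_measurable (lebesgue_on {\<alpha><..<\<beta>})"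
    using f g by (auto simp: L2_fun_def)
  have "\<bar>f z * g z\<bar> \<le> (f z)\<^sup>2 + (g z)\<^sup>2" for z
  proof -
    have "2 * (\<bar>f z\<bar> * \<bar>g z\<bar>) \<le> (f z)\<^sup>2 + (g z)\<^sup>2"
      using sum_squares_bound[of "\<bar>f z\<bar>" "\<bar>g z\<bar>"] by simp
    moreover have "0 \<le> \<bar>f z\<bar> * \<bar>g z\<bar>" by simp
    ultimately show ?thesis unfolding abs_mult by linarith
  qed
  then show "AE z in lebesgue_on {\<alpha><..<\<beta>}. norm (f z * g z) \<le> norm ((f z)\<^sup>2 + (g z)\<^sup>2)"
    by simp
qed

lemma integrable_const_on_Ioo: "integrable (lebesgue_on {\<alpha><..<\<beta>::real}) (\<lambda>_. c::real)"
  by (intro finite_measure.integrable_const finite_measure_lebesgue_on) simp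

lemma L2_fun_const: "L2_fun \<alpha> \<beta> (\<lambda>_. c)"
  unfolding L2_fun_def using integrable_const_on_Ioo by simp

lemma L2_fun_integrable: "L2_fun \<alpha> \<beta> f \<Longrightarrow> integrable (lebesgue_on {\<alpha><..<\<beta>}) f"
  using L2_fun_mult[OF L2_fun_const[of \<alpha> \<beta> 1]] by simp

lemma L2_fun_scale: "L2_fun \<alpha> \<beta> f \<Longrightarrow> L2_fun \<alpha> \<beta> (\<lambda>z. c * f z)"
  by (auto simp: L2_fun_def power_mult_distrib)

lemma L2_fun_add: "L2_fun \<alpha> \<beta> f \<Longrightarrow> L2_fun \<alpha> \<beta> g \<Longrightarrow> L2_fun \<alpha> \<beta> (\<lambda>z. f z + g z)"
proof -
  assume f: "L2_fun \<alpha> \<beta> f" and g: "L2_fun \<alpha> \<beta> g"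
  have "integrable (lebesgue_on {\<alpha><..<\<beta>}) (\<lambda>z. (f z)\<^sup>2 + 2 * (f z * g z) + (g z)\<^sup>2)"
    using f g L2_fun_mult[OF f g] by (auto simp: L2_fun_def)
  then show ?thesis
    using f g by (auto simp: L2_fun_def power2_sum algebra_simps)
qed

lemma L2_fun_minus: "L2_fun \<alpha> \<beta> f \<Longrightarrow> L2_fun \<alpha> \<beta> (\<lambda>z. - f z)"
  using L2_fun_scale[of \<alpha> \<beta> f "-1"] by simp

lemma L2_fun_diff: "L2_fun \<alpha> \<beta> f \<Longrightarrow> L2_fun \<alpha> \<beta> g \<Longrightarrow> L2_fun \<alpha> \<beta> (\<lambda>z. f z - g z)"
  using L2_fun_add[OF _ L2_fun_minus] by simp

lemma L2_fun_bounded_mult: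
  assumes f: "L2_fun \<alpha> \<beta> f" and c: "continuous_on {\<alpha>..\<beta>} c"
  shows "L2_fun \<alpha> \<beta> (\<lambda>z. c z * f z)"
proof -
  obtain B where B: "\<forall>z\<in>{\<alpha>..\<beta>}. \<bar>c z\<bar> \<le> B"
    using compact_imp_bounded[OF compact_continuous_image[OF c compact_Icc]]
    by (auto simp: bounded_iff simp del: atLeastAtMost_iff)
  have m: "c \<in> borel_measurable (lebesgue_on {\<alpha><..<\<beta>})"
    by (intro continuous_imp_measurable_on_sets_lebesgue continuous_on_subset[OF c]) auto
  have "integrable (lebesgue_on {\<alpha><..<\<beta>}) (\<lambda>z. (c z * f z)\<^sup>2)"
  proof (rule Bochner_Integration.integrable_bound)
    show "integrable (lebesgue_on {\<alpha><..<\<beta>}) (\<lambda>z. B\<^sup>2 * (f z)\<^sup>2)"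
      using f by (auto simp: L2_fun_def)
    show "(\<lambda>z. (c z * f z)\<^sup>2) \<in> borel_measurable (lebesgue_on {\<alpha><..<\<beta>})"
      using f m by (auto simp: L2_fun_def)
    have "(c z * f z)\<^sup>2 \<le> B\<^sup>2 * (f z)\<^sup>2" if "z \<in> {\<alpha><..<\<beta>}" for z
    proof -
      have "\<bar>c z\<bar>\<^sup>2 \<le> B\<^sup>2" using B that by (intro power_mono) auto
      then show ?thesis unfolding power_mult_distrib by (intro mult_right_mono) auto
    qed
    then show "AE z in lebesgue_on {\<alpha><..<\<beta>}. norm ((c z * f z)\<^sup>2) \<le> norm (B\<^sup>2 * (f z)\<^sup>2)"
      by (intro AE_I2) auto
  qed
  then show ?thesis using f m by (auto simp: L2_fun_def)
qed

lemma L2_fun_continuous: "continuous_on {\<alpha>..\<beta>} c \<Longrightarrow> L2_fun \<alpha> \<beta> c"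
  using L2_fun_bounded_mult[OF L2_fun_const[of \<alpha> \<beta> 1]] by simp

lemma integrable_lebesgue_on_subset:
  fixes f :: "real \<Rightarrow> real"
  assumes "integrable (lebesgue_on S) f" "T \<subseteq> S" "S \<in> sets lebesgue" "T \<in> sets lebesgue"
  shows "integrable (lebesgue_on T) f"
proof -
  have "f absolutely_integrable_on S"
    using assms by (simp add: integrable_restrict_space set_integrable_def)
  then have "f absolutely_integrable_on T"
    by (rule set_integrable_subset) (use assms in auto)
  then show ?thesis
    using assms by (simp add: integrable_restrict_space set_integrable_def)
qed

lemma L2_fun_subset:
  assumes "L2_fun \<alpha> \<beta> f" "\<alpha> \<le> \<alpha>'" "\<beta>' \<le> \<beta>"
  shows "L2_fun \<alpha>' \<beta>' f"
proof -
  have s: "{\<alpha>'<..<\<beta>'} \<subseteq> {\<alpha><..<\<beta>}" using assms by auto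
  have "f \<in> borel_measurable (lebesgue_on {\<alpha>'<..<\<beta>'})"
    using assms s by (auto simp: L2_fun_def intro: measurable_restrict_mono)
  then show ?thesis
    using assms s by (auto simp: L2_fun_def intro: integrable_lebesgue_on_subset)
qed

lemma L2_fun_cong_AE:
  assumes f: "L2_fun \<alpha> \<beta> f" and e: "AE z in lebesgue. z \<in> {\<alpha><..<\<beta>} \<longrightarrow> f z = g z"
  shows "L2_fun \<alpha> \<beta> g"
proof -
  have ae: "AE z in lebesgue_on {\<alpha><..<\<beta>}. f z = g z"
    using e by (simp add: AE_restrict_space_iff)
  have "(\<lambda>z. if z \<in> {\<alpha><..<\<beta>} then f z else 0) \<in> borel_measurable lebesgue"
    using f by (simp add: L2_fun_def borel_measurable_if del: greaterThanLessThan_iff)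
  moreover have "AE z in lebesgue. (if z \<in> {\<alpha><..<\<beta>} then f z else 0) = (if z \<in> {\<alpha><..<\<beta>} then g z else 0)"
    using e by eventually_elim auto
  ultimately have "(\<lambda>z. if z \<in> {\<alpha><..<\<beta>} then g z else 0) \<in> borel_measurable lebesgue"
    by (rule borel_measurable_AE)
  then have m: "g \<in> borel_measurable (lebesgue_on {\<alpha><..<\<beta>})"
    by (simp add: borel_measurable_if del: greaterThanLessThan_iff)
  have "integrable (lebesgue_on {\<alpha><..<\<beta>}) (\<lambda>z. (g z)\<^sup>2)"
  proof (rule integrable_cong_AE[THEN iffD1])
    show "AE z in lebesgue_on {\<alpha><..<\<beta>}. (f z)\<^sup>2 = (g z)\<^sup>2" using ae by eventually_elim simp
  qed (use m f in \<open>auto simp: L2_fun_def\<close>)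
  then show ?thesis using m by (simp add: L2_fun_def)
qed

lemma integrable_Ioo_imp_Icc:
  fixes f :: "real \<Rightarrow> real"
  assumes "integrable (lebesgue_on {\<alpha><..<\<beta>}) f"
  shows "f absolutely_integrable_on {\<alpha>..\<beta>}"
proof -
  have "f absolutely_integrable_on {\<alpha><..<\<beta>}"
    using assms by (simp add: integrable_restrict_space set_integrable_def)
  then show ?thesis by (simp add: absolutely_integrable_on_Icc_iff_Ioo)
qed

lemma L2_fun_absolutely_integrable: "L2_fun \<alpha> \<beta> f \<Longrightarrow> f absolutely_integrable_on {\<alpha>..\<beta>}"
  by (rule integrable_Ioo_imp_Icc[OF L2_fun_integrable])

lemma L2_fun_integrable_on: "L2_fun \<alpha> \<beta> f \<Longrightarrow> f integrable_on {\<alpha>..\<beta>}"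
  using L2_fun_absolutely_integrable by (rule set_lebesgue_integral_eq_integral)

lemma LINT_Ioo_eq_integral:
  fixes f :: "real \<Rightarrow> real"
  assumes "integrable (lebesgue_on {\<alpha><..<\<beta>}) f"
  shows "(LINT z|lebesgue_on {\<alpha><..<\<beta>}. f z) = integral {\<alpha>..\<beta>} f"
  using lebesgue_integral_eq_integral[OF assms] by (simp add: integral_open_interval_real)

section \<open>Fubini on triangles and integration by parts\<close>

lemma sigma_finite_lebesgue: "sigma_finite_measure lebesgue"
proof
  obtain A :: "'a set set" where A: "countable A" "A \<subseteq> sets lborel" "\<Union>A = space lborel" "\<forall>a\<in>A. emeasure lborel a \<noteq> \<infinity>"
    using lborel.sigma_finite_countable by blast
  then show "\<exists>A::'a set set. countable A \<and> A \<subseteq> sets lebesgue \<and> \<Union>A = space lebesgue \<and> (\<forall>a\<in>A. emeasure lebesgue a \<noteq> \<infinity>)"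
    by (intro exI[of _ A]) auto
qed

text \<open>Fubini on the triangles $y\le x$ and $x<y$ is what replaces the product rule for absolutely continuous functions.\<close>

lemma lebesgue_triangles:
  fixes f g :: "real \<Rightarrow> real"
  assumes f: "integrable lebesgue f" and g: "integrable lebesgue g"
  defines "F \<equiv> \<lambda>y. LINT x|lebesgue. indicator {..<y} x * f x"
    and "G \<equiv> \<lambda>x. LINT y|lebesgue. indicator {..x} y * g y"
  shows "integrable lebesgue (\<lambda>x. f x * G x)" "integrable lebesgue (\<lambda>y. g y * F y)"
    and "(LINT x|lebesgue. f x * G x) + (LINT y|lebesgue. g y * F y)
      = (LINT x|lebesgue. f x) * (LINT y|lebesgue. g y)"
proof -
  interpret pair_sigma_finite "lebesgue :: real measure" "lebesgue :: real measure"
    unfolding pair_sigma_finite_def using sigma_finite_lebesgue by auto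
  let ?M = "lebesgue \<Otimes>\<^sub>M lebesgue :: (real \<times> real) measure"
  have fm [measurable]: "f \<in> borel_measurable lebesgue" and gm [measurable]: "g \<in> borel_measurable lebesgue"
    using f g by auto
  have id [measurable]: "(\<lambda>x::real. x) \<in> borel_measurable lebesgue"
    by (intro measurable_completion) simp
  have fst: "(fst :: real \<times> real \<Rightarrow> real) \<in> borel_measurable ?M" "(snd :: real \<times> real \<Rightarrow> real) \<in> borel_measurable ?M"
    using measurable_compose[OF measurable_fst id] measurable_compose[OF measurable_snd id] by simp_all
  have h: "integrable ?M (\<lambda>p. f (fst p) * g (snd p))"
  proof (rule Fubini_integrable)
    show "(\<lambda>p. f (fst p) * g (snd p)) \<in> borel_measurable ?M" by measurable
    show "integrable lebesgue (\<lambda>x. LINT y|lebesgue. norm (f (fst (x, y)) * g (snd (x, y))))"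
      using f g by (simp add: abs_mult)
    show "AE x in lebesgue. integrable lebesgue (\<lambda>y. f (fst (x, y)) * g (snd (x, y)))"
      using g by simp
  qed
  \<comment> \<open>One triangle contains the diagonal and the other does not, so together they
    partition the plane and the two indicators add up to 1.\<close>
  have S: "{p. snd p \<le> fst p} \<in> sets ?M" "{p. fst p < snd p} \<in> sets ?M"
    using borel_measurable_le[OF fst(2,1)] borel_measurable_less[OF fst(1,2)] by (simp_all add: space_pair_measure)
  define h1 h2 where "h1 = (\<lambda>x y. indicator {p. snd p \<le> fst p} (x, y) * (f x * g y))"
    and "h2 = (\<lambda>x y. indicator {p. fst p < snd p} (x, y) * (f x * g y))"
  have i1: "integrable ?M (case_prod h1)" and i2: "integrable ?M (case_prod h2)"
    using integrable_mult_indicator[OF S(1) h] integrable_mult_indicator[OF S(2) h]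
    by (simp_all add: h1_def h2_def case_prod_unfold)
  have G: "(LINT y|lebesgue. h1 x y) = f x * G x" for x
    unfolding G_def h1_def
    by (subst integral_mult_right_zero[symmetric], intro Bochner_Integration.integral_cong) (auto simp: indicator_def)
  have F: "(LINT x|lebesgue. h2 x y) = g y * F y" for y
    unfolding F_def h2_def
    by (subst integral_mult_right_zero[symmetric], intro Bochner_Integration.integral_cong) (auto simp: indicator_def)
  show "integrable lebesgue (\<lambda>x. f x * G x)"
    using integrable_fst[OF i1] by (simp add: G)
  show "integrable lebesgue (\<lambda>y. g y * F y)"
    using integrable_snd[OF i2] by (simp add: F)
  have "(LINT x|lebesgue. f x * G x) + (LINT y|lebesgue. g y * F y)
     = (LINT x|lebesgue. LINT y|lebesgue. h1 x y) + (LINT y|lebesgue. LINT x|lebesgue. h2 x y)"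
    by (simp add: G F)
  also have "\<dots> = integral\<^sup>L ?M (case_prod h1) + integral\<^sup>L ?M (case_prod h2)"
    using integral_fst[OF i1] integral_snd[OF i2] by simp
  also have "\<dots> = integral\<^sup>L ?M (\<lambda>p. case_prod h1 p + case_prod h2 p)"
    using i1 i2 by simp
  also have "(\<lambda>p. case_prod h1 p + case_prod h2 p) = (\<lambda>(x, y). f x * g y)"
    by (auto simp: h1_def h2_def indicator_def fun_eq_iff)
  also have "integral\<^sup>L ?M (\<lambda>(x, y). f x * g y) = (LINT x|lebesgue. LINT y|lebesgue. f x * g y)"
    using h by (subst integral_fst[symmetric]) (simp_all add: case_prod_unfold)
  also have "\<dots> = (LINT x|lebesgue. f x) * (LINT y|lebesgue. g y)" by simp
  finally show "(LINT x|lebesgue. f x * G x) + (LINT y|lebesgue. g y * F y)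
      = (LINT x|lebesgue. f x) * (LINT y|lebesgue. g y)" .
qed

lemma integral_triangles:
  fixes f g :: "real \<Rightarrow> real"
  assumes f: "f absolutely_integrable_on {\<alpha>..\<beta>}" and g: "g absolutely_integrable_on {\<alpha>..\<beta>}"
  shows "(\<lambda>x. f x * integral {\<alpha>..x} g) absolutely_integrable_on {\<alpha>..\<beta>}"
    and "(\<lambda>x. g x * integral {\<alpha>..x} f) absolutely_integrable_on {\<alpha>..\<beta>}"
    and "integral {\<alpha>..\<beta>} (\<lambda>x. f x * integral {\<alpha>..x} g) + integral {\<alpha>..\<beta>} (\<lambda>x. g x * integral {\<alpha>..x} f)
      = integral {\<alpha>..\<beta>} f * integral {\<alpha>..\<beta>} g"
proof -
  let ?I = "indicator {\<alpha>..\<beta>} :: real \<Rightarrow> real"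
  let ?f = "\<lambda>x. ?I x * f x" and ?g = "\<lambda>x. ?I x * g x"
  have fi: "integrable lebesgue ?f" and gi: "integrable lebesgue ?g"
    using f g by (simp_all add: set_integrable_def)
  have int: "(LINT x|lebesgue. ?I x * h x) = integral {\<alpha>..\<beta>} h" if "h absolutely_integrable_on {\<alpha>..\<beta>}" for h :: "real \<Rightarrow> real"
    using set_lebesgue_integral_eq_integral(2)[OF that] by (simp add: set_lebesgue_integral_def)
  have G: "(LINT y|lebesgue. indicator {..x} y * (?I y * h y)) = integral {\<alpha>..x} h"
    if h: "h absolutely_integrable_on {\<alpha>..\<beta>}" and x: "x \<in> {\<alpha>..\<beta>}" for h x
  proof -
    have "h absolutely_integrable_on {\<alpha>..x}"
      using x by (intro set_integrable_subset[OF h]) auto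
    then have "integral {\<alpha>..x} h = (LINT y|lebesgue. indicator {\<alpha>..x} y * h y)"
      by (simp flip: set_lebesgue_integral_eq_integral(2) add: set_lebesgue_integral_def)
    also have "\<dots> = (LINT y|lebesgue. indicator {..x} y * (?I y * h y))"
      using x by (intro Bochner_Integration.integral_cong) (auto simp: indicator_def)
    finally show ?thesis by simp
  qed
  \<comment> \<open>The open half-line misses only the point \<open>x\<close>, a null set, so this
    inner integral is the same primitive as the one over the closed half-line.\<close>
  have F: "(LINT y|lebesgue. indicator {..<x} y * (?I y * h y)) = integral {\<alpha>..x} h"
    if h: "h absolutely_integrable_on {\<alpha>..\<beta>}" and x: "x \<in> {\<alpha>..\<beta>}" for h x
  proof -
    have "AE y in lebesgue. y \<noteq> x"
      by (intro AE_completion AE_lborel_singleton)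
    then have "(LINT y|lebesgue. indicator {..<x} y * (?I y * h y)) = (LINT y|lebesgue. indicator {..x} y * (?I y * h y))"
    proof (intro integral_cong_AE)
      have m: "(\<lambda>y. ?I y * h y) \<in> borel_measurable lebesgue"
        using h by (auto simp: set_integrable_def)
      show "(\<lambda>y. indicator {..<x} y * (?I y * h y)) \<in> borel_measurable lebesgue"
        by (rule borel_measurable_times[OF borel_measurable_indicator m]) simp
      show "(\<lambda>y. indicator {..x} y * (?I y * h y)) \<in> borel_measurable lebesgue"
        by (rule borel_measurable_times[OF borel_measurable_indicator m]) simp
    qed (auto simp: indicator_def elim: eventually_mono)
    then show ?thesis using G[OF h x] by simp
  qed
  have eq1: "?f x * (LINT y|lebesgue. indicator {..x} y * ?g y) = ?I x * (f x * integral {\<alpha>..x} g)" for x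
    using G[OF g, of x] by (simp add: indicator_def)
  have eq2: "?g x * (LINT y|lebesgue. indicator {..<x} y * ?f y) = ?I x * (g x * integral {\<alpha>..x} f)" for x
    using F[OF f, of x] by (simp add: indicator_def)
  note T = lebesgue_triangles[OF fi gi, unfolded eq1 eq2]
  show 1: "(\<lambda>x. f x * integral {\<alpha>..x} g) absolutely_integrable_on {\<alpha>..\<beta>}"
    using T(1) by (simp add: set_integrable_def)
  show 2: "(\<lambda>x. g x * integral {\<alpha>..x} f) absolutely_integrable_on {\<alpha>..\<beta>}"
    using T(2) by (simp add: set_integrable_def)
  show "integral {\<alpha>..\<beta>} (\<lambda>x. f x * integral {\<alpha>..x} g) + integral {\<alpha>..\<beta>} (\<lambda>x. g x * integral {\<alpha>..x} f)
      = integral {\<alpha>..\<beta>} f * integral {\<alpha>..\<beta>} g"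
    using T(3) by (simp only: int[OF 1] int[OF 2] int[OF f] int[OF g])
qed

text \<open>An H1 function through its continuous representative \<open>u\<close> and its derivative
  \<open>g\<close>. Equality is demanded everywhere on the closed interval, so traces are the plain
  values of \<open>u\<close>.\<close>

definition ac :: "real \<Rightarrow> real \<Rightarrow> (real \<Rightarrow> real) \<Rightarrow> (real \<Rightarrow> real) \<Rightarrow> bool" where
  "ac \<alpha> \<beta> u g \<longleftrightarrow> L2_fun \<alpha> \<beta> g \<and> (\<forall>z\<in>{\<alpha>..\<beta>}. u z = u \<alpha> + integral {\<alpha>..z} g)"

lemma ac_L2: "ac \<alpha> \<beta> u g \<Longrightarrow> L2_fun \<alpha> \<beta> g"
  by (simp add: ac_def)

lemma ac_eq: "ac \<alpha> \<beta> u g \<Longrightarrow> z \<in> {\<alpha>..\<beta>} \<Longrightarrow> u z = u \<alpha> + integral {\<alpha>..z} g"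
  unfolding ac_def by blast

lemma ac_continuous: "ac \<alpha> \<beta> u g \<Longrightarrow> continuous_on {\<alpha>..\<beta>} u"
proof -
  assume u: "ac \<alpha> \<beta> u g"
  have "continuous_on {\<alpha>..\<beta>} (\<lambda>z. u \<alpha> + integral {\<alpha>..z} g)"
    by (intro continuous_intros indefinite_integral_continuous_1 L2_fun_integrable_on ac_L2[OF u])
  then show ?thesis by (rule continuous_on_eq) (rule ac_eq[OF u, symmetric])
qed

lemma ac_L2_fun: "ac \<alpha> \<beta> u g \<Longrightarrow> L2_fun \<alpha> \<beta> u"
  by (intro L2_fun_continuous ac_continuous)

lemma ac_indefinite: "L2_fun \<alpha> \<beta> g \<Longrightarrow> ac \<alpha> \<beta> (\<lambda>z. c + integral {\<alpha>..z} g) g"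
  unfolding ac_def by simp

lemma ac_increment:
  assumes u: "ac \<alpha> \<beta> u g" and st: "\<alpha> \<le> s" "s \<le> t" "t \<le> \<beta>"
  shows "u t - u s = integral {s..t} g"
proof -
  have "g integrable_on {\<alpha>..t}"
    using integrable_on_subinterval[OF L2_fun_integrable_on[OF ac_L2[OF u]], of \<alpha> t] st by simp
  then have "integral {\<alpha>..s} g + integral {s..t} g = integral {\<alpha>..t} g"
    using st by (intro Henstock_Kurzweil_Integration.integral_combine) auto
  then show ?thesis using ac_eq[OF u, of s] ac_eq[OF u, of t] st by simp
qed

lemma ac_subset:
  assumes u: "ac \<alpha> \<beta> u g" and s: "\<alpha> \<le> \<alpha>'" "\<beta>' \<le> \<beta>"
  shows "ac \<alpha>' \<beta>' u g"
  unfolding ac_def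
proof (intro conjI ballI)
  show "L2_fun \<alpha>' \<beta>' g" by (rule L2_fun_subset[OF ac_L2[OF u] s])
  show "u z = u \<alpha>' + integral {\<alpha>'..z} g" if "z \<in> {\<alpha>'..\<beta>'}" for z
    using ac_increment[OF u, of \<alpha>' z] s that by simp
qed

text \<open>Integration by parts. With both functions written as constants plus primitives, only the
  products of derivatives with primitives are nontrivial, and \<open>integral_triangles\<close>
  evaluates their sum.\<close>

lemma ac_mult:
  assumes u: "ac \<alpha> \<beta> u g" and v: "ac \<alpha> \<beta> v h" and ab: "\<alpha> \<le> \<beta>"
  shows "integral {\<alpha>..\<beta>} (\<lambda>z. g z * v z + u z * h z) = u \<beta> * v \<beta> - u \<alpha> * v \<alpha>"
proof -
  let ?U = "\<lambda>z. integral {\<alpha>..z} g" and ?V = "\<lambda>z. integral {\<alpha>..z} h"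
  have gi: "g absolutely_integrable_on {\<alpha>..\<beta>}" and hi: "h absolutely_integrable_on {\<alpha>..\<beta>}"
    using u v by (auto intro: L2_fun_absolutely_integrable ac_L2)
  note g = set_lebesgue_integral_eq_integral(1)[OF gi] and h = set_lebesgue_integral_eq_integral(1)[OF hi]
  note T = integral_triangles[OF gi hi]
  note T1 = set_lebesgue_integral_eq_integral(1)[OF T(1)] and T2 = set_lebesgue_integral_eq_integral(1)[OF T(2)]
  have "integral {\<alpha>..\<beta>} (\<lambda>z. g z * v z + u z * h z)
    = integral {\<alpha>..\<beta>} (\<lambda>z. (v \<alpha> * g z + u \<alpha> * h z) + (g z * ?V z + h z * ?U z))"
  proof (rule Henstock_Kurzweil_Integration.integral_cong)
    fix z assume z: "z \<in> {\<alpha>..\<beta>}"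
    show "g z * v z + u z * h z = (v \<alpha> * g z + u \<alpha> * h z) + (g z * ?V z + h z * ?U z)"
      by (subst ac_eq[OF u z], subst ac_eq[OF v z]) (simp add: algebra_simps)
  qed
  also have "\<dots> = integral {\<alpha>..\<beta>} (\<lambda>z. v \<alpha> * g z + u \<alpha> * h z) + integral {\<alpha>..\<beta>} (\<lambda>z. g z * ?V z + h z * ?U z)"
    using g h T1 T2 by (intro Henstock_Kurzweil_Integration.integral_add integrable_add integrable_on_mult_right)
  also have "integral {\<alpha>..\<beta>} (\<lambda>z. v \<alpha> * g z + u \<alpha> * h z) = v \<alpha> * ?U \<beta> + u \<alpha> * ?V \<beta>"
    using g h by (simp add: Henstock_Kurzweil_Integration.integral_add integrable_on_mult_right)
  also have "integral {\<alpha>..\<beta>} (\<lambda>z. g z * ?V z + h z * ?U z) = ?U \<beta> * ?V \<beta>"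
    using T1 T2 T(3) by (simp add: Henstock_Kurzweil_Integration.integral_add)
  also have "v \<alpha> * ?U \<beta> + u \<alpha> * ?V \<beta> + ?U \<beta> * ?V \<beta> = (u \<alpha> + ?U \<beta>) * (v \<alpha> + ?V \<beta>) - u \<alpha> * v \<alpha>"
    by (simp add: algebra_simps)
  also have "u \<alpha> + ?U \<beta> = u \<beta>" using ac_eq[OF u, of \<beta>] ab by simp
  also have "v \<alpha> + ?V \<beta> = v \<beta>" using ac_eq[OF v, of \<beta>] ab by simp
  finally show ?thesis .
qed

lemma ac_C1:
  assumes d: "\<And>z. z \<in> {\<alpha>..\<beta>} \<Longrightarrow> (\<phi> has_real_derivative \<phi>' z) (at z within {\<alpha>..\<beta>})" and c: "continuous_on {\<alpha>..\<beta>} \<phi>'"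
  shows "ac \<alpha> \<beta> \<phi> \<phi>'"
  unfolding ac_def
proof
  show "L2_fun \<alpha> \<beta> \<phi>'" using c by (rule L2_fun_continuous)
  show "\<forall>z\<in>{\<alpha>..\<beta>}. \<phi> z = \<phi> \<alpha> + integral {\<alpha>..z} \<phi>'"
  proof
    fix z assume z: "z \<in> {\<alpha>..\<beta>}"
    have "(\<phi>' has_integral (\<phi> z - \<phi> \<alpha>)) {\<alpha>..z}"
    proof (rule fundamental_theorem_of_calculus)
      show "(\<phi> has_vector_derivative \<phi>' x) (at x within {\<alpha>..z})" if "x \<in> {\<alpha>..z}" for x
        using d[of x] that z unfolding has_real_derivative_iff_has_vector_derivative
        by (auto intro: has_vector_derivative_within_subset)
    qed (use z in auto)
    then show "\<phi> z = \<phi> \<alpha> + integral {\<alpha>..z} \<phi>'" by (simp add: integral_unique)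
  qed
qed

lemma ac_add: "ac \<alpha> \<beta> u g \<Longrightarrow> ac \<alpha> \<beta> v h \<Longrightarrow> ac \<alpha> \<beta> (\<lambda>z. u z + v z) (\<lambda>z. g z + h z)"
proof -
  assume u: "ac \<alpha> \<beta> u g" and v: "ac \<alpha> \<beta> v h"
  have "integral {\<alpha>..z} (\<lambda>z. g z + h z) = integral {\<alpha>..z} g + integral {\<alpha>..z} h" if "z \<in> {\<alpha>..\<beta>}" for z
    using that by (intro Henstock_Kurzweil_Integration.integral_add
      integrable_on_subinterval[OF L2_fun_integrable_on[OF ac_L2[OF u]]]
      integrable_on_subinterval[OF L2_fun_integrable_on[OF ac_L2[OF v]]]) auto
  then have "u z + v z = u \<alpha> + v \<alpha> + integral {\<alpha>..z} (\<lambda>z. g z + h z)" if "z \<in> {\<alpha>..\<beta>}" for z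
    using ac_eq[OF u that] ac_eq[OF v that] that by simp
  then show ?thesis
    unfolding ac_def using L2_fun_add[OF ac_L2[OF u] ac_L2[OF v]] by blast
qed

lemma ac_scale: "ac \<alpha> \<beta> u g \<Longrightarrow> ac \<alpha> \<beta> (\<lambda>z. c * u z) (\<lambda>z. c * g z)"
  unfolding ac_def
proof (intro conjI ballI)
  assume u: "L2_fun \<alpha> \<beta> g \<and> (\<forall>z\<in>{\<alpha>..\<beta>}. u z = u \<alpha> + integral {\<alpha>..z} g)"
  then show "L2_fun \<alpha> \<beta> (\<lambda>z. c * g z)" using L2_fun_scale by blast
  fix z assume z: "z \<in> {\<alpha>..\<beta>}"
  have "u z = u \<alpha> + integral {\<alpha>..z} g" using u z by blast
  then show "c * u z = c * u \<alpha> + integral {\<alpha>..z} (\<lambda>z. c * g z)"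
    by (simp add: distrib_left)
qed

lemma ac_diff: "ac \<alpha> \<beta> u g \<Longrightarrow> ac \<alpha> \<beta> v h \<Longrightarrow> ac \<alpha> \<beta> (\<lambda>z. u z - v z) (\<lambda>z. g z - h z)"
  using ac_add[of \<alpha> \<beta> u g "\<lambda>z. (-1) * v z" "\<lambda>z. (-1) * h z"] ac_scale[of \<alpha> \<beta> v h "-1"] by simp

lemma ac_product:
  assumes u: "ac \<alpha> \<beta> u g" and v: "ac \<alpha> \<beta> v h"
  shows "ac \<alpha> \<beta> (\<lambda>z. u z * v z) (\<lambda>z. g z * v z + u z * h z)"
  unfolding ac_def
proof (intro conjI ballI)
  show "L2_fun \<alpha> \<beta> (\<lambda>z. g z * v z + u z * h z)"
    using L2_fun_bounded_mult[OF ac_L2[OF u] ac_continuous[OF v]] L2_fun_bounded_mult[OF ac_L2[OF v] ac_continuous[OF u]]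
    by (intro L2_fun_add) (simp_all add: mult.commute)
  fix z assume z: "z \<in> {\<alpha>..\<beta>}"
  show "u z * v z = u \<alpha> * v \<alpha> + integral {\<alpha>..z} (\<lambda>z. g z * v z + u z * h z)"
    using ac_mult[OF ac_subset[OF u] ac_subset[OF v], of \<alpha> z] z by simp
qed

text \<open>The common value of \<open>u\<close> at \<gamma> excludes a jump. This is how continuity
  at the interface yields a single H1 function on the whole interval.\<close>

lemma ac_glue:
  assumes u: "ac \<alpha> \<gamma> u g" and v: "ac \<gamma> \<beta> u g" and abc: "\<alpha> \<le> \<gamma>" "\<gamma> \<le> \<beta>"
  shows "ac \<alpha> \<beta> u g"
proof -
  have ai: "(\<lambda>z. (g z)\<^sup>2) absolutely_integrable_on {\<alpha>..\<gamma>}" "(\<lambda>z. (g z)\<^sup>2) absolutely_integrable_on {\<gamma>..\<beta>}"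
    using ac_L2[OF u] ac_L2[OF v] by (auto simp: L2_fun_def intro: integrable_Ioo_imp_Icc)
  have gi: "g absolutely_integrable_on {\<alpha>..\<gamma>}" "g absolutely_integrable_on {\<gamma>..\<beta>}"
    using ac_L2[OF u] ac_L2[OF v] by (auto intro: L2_fun_absolutely_integrable)
  have un: "{\<alpha>..\<beta>} = {\<alpha>..\<gamma>} \<union> {\<gamma>..\<beta>}" using abc by auto
  have ai': "(\<lambda>z. (g z)\<^sup>2) absolutely_integrable_on {\<alpha>..\<beta>}" and gi': "g absolutely_integrable_on {\<alpha>..\<beta>}"
    unfolding un by (intro set_integrable_Un ai gi; simp)+
  have "integrable (lebesgue_on {\<alpha><..<\<beta>}) f" if "f absolutely_integrable_on {\<alpha>..\<beta>}" for f :: "real \<Rightarrow> real"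
    using that by (intro absolutely_integrable_imp_integrable) (auto simp: absolutely_integrable_on_Icc_iff_Ioo)
  then have L: "L2_fun \<alpha> \<beta> g"
    using ai' gi' by (auto simp: L2_fun_def)
  show ?thesis unfolding ac_def
  proof (intro conjI L ballI)
    fix z assume z: "z \<in> {\<alpha>..\<beta>}"
    show "u z = u \<alpha> + integral {\<alpha>..z} g"
    proof (cases "z \<le> \<gamma>")
      case True then show ?thesis using ac_eq[OF u, of z] z by simp
    next
      case False
      have "g integrable_on {\<alpha>..z}"
        using integrable_on_subinterval[OF L2_fun_integrable_on[OF L], of \<alpha> z] z by simp
      then have "integral {\<alpha>..\<gamma>} g + integral {\<gamma>..z} g = integral {\<alpha>..z} g"
        using z False abc by (intro Henstock_Kurzweil_Integration.integral_combine) auto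
      then show ?thesis using ac_eq[OF u, of \<gamma>] ac_eq[OF v, of z] z False abc by simp
    qed
  qed
qed

lemma ac_cong:
  assumes "ac \<alpha> \<beta> u g" "\<And>z. z \<in> {\<alpha>..\<beta>} \<Longrightarrow> u z = v z" "AE z in lebesgue. z \<in> {\<alpha><..<\<beta>} \<longrightarrow> g z = h z"
  shows "ac \<alpha> \<beta> v h"
  unfolding ac_def
proof (intro conjI ballI)
  show "L2_fun \<alpha> \<beta> h" using L2_fun_cong_AE[OF ac_L2 assms(3)] assms(1) .
  fix z assume z: "z \<in> {\<alpha>..\<beta>}"
  obtain S where S: "S \<in> null_sets lebesgue" "{z \<in> space lebesgue. \<not> (z \<in> {\<alpha><..<\<beta>} \<longrightarrow> g z = h z)} \<subseteq> S"
    using assms(3) unfolding eventually_ae_filter by blast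
  then have "negligible (S \<union> {\<alpha>, \<beta>})" by (auto simp: negligible_iff_null_sets)
  then have "integral {\<alpha>..z} g = integral {\<alpha>..z} h"
  proof (rule integral_spike)
    fix x assume x: "x \<in> {\<alpha>..z} - (S \<union> {\<alpha>, \<beta>})"
    then have "x \<in> {\<alpha><..<\<beta>}" using z by auto
    then show "h x = g x" using S(2) x by auto
  qed
  then show "v z = v \<alpha> + integral {\<alpha>..z} h" using ac_eq[OF assms(1) z] assms(2)[of z] assms(2)[of \<alpha>] z by simp
qed

section \<open>The lemma of du Bois-Reymond\<close>

lemma AE_lborel_zero_if_tail_integrals_zero:
  fixes H :: "real \<Rightarrow> real"
  assumes H: "integrable lborel H" and z: "\<And>x. (LINT z|lborel. indicator {x<..} z * H z) = 0"
  shows "AE z in lborel. H z = 0"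
proof -
  \<comment> \<open>The positive and the negative part of \<open>H\<close> serve as densities of two
    finite measures. These agree on all half-lines and hence coincide, and uniqueness of densities
    gives p = n almost everywhere.\<close>
  define p n where "p = (\<lambda>z. max (H z) 0)" and "n = (\<lambda>z. max (- H z) 0)"
  have i: "integrable lborel p" "integrable lborel n" using H by (auto simp: p_def n_def)
  have m [measurable]: "p \<in> borel_measurable borel" "n \<in> borel_measurable borel"
    using i by auto
  have e: "emeasure (density lborel (\<lambda>z. ennreal (q z))) {x<..} = ennreal (LINT z|lborel. indicator {x<..} z * q z)"
    if "integrable lborel q" "\<And>z. 0 \<le> q z" for q :: "real \<Rightarrow> real" and x
  proof -
    have [measurable]: "q \<in> borel_measurable borel" using that by auto
    have "{x<..} \<in> sets lborel" using borel_open[OF open_greaterThan] by simp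
    from integrable_mult_indicator[OF this that(1)]
    have "integrable lborel (\<lambda>z. indicator {x<..} z * q z)" by simp
    then have "ennreal (LINT z|lborel. indicator {x<..} z * q z) = (\<integral>\<^sup>+ z. ennreal (indicator {x<..} z * q z) \<partial>lborel)"
      using that by (intro nn_integral_eq_integral[symmetric]) auto
    also have "\<dots> = (\<integral>\<^sup>+ z. ennreal (q z) * indicator {x<..} z \<partial>lborel)"
      by (intro nn_integral_cong) (auto simp: indicator_def)
    also have "\<dots> = emeasure (density lborel (\<lambda>z. ennreal (q z))) {x<..}"
      by (rule emeasure_density[symmetric]) auto
    finally show ?thesis by simp
  qed
  have eq: "(LINT z|lborel. indicator {x<..} z * p z) = (LINT z|lborel. indicator {x<..} z * n z)" for x
  proof -
    have "(LINT z|lborel. indicator {x<..} z * p z) - (LINT z|lborel. indicator {x<..} z * n z)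
      = (LINT z|lborel. indicator {x<..} z * p z - indicator {x<..} z * n z)"
      using integrable_mult_indicator[of "{x<..}" lborel p] integrable_mult_indicator[of "{x<..}" lborel n] i
      by (intro Bochner_Integration.integral_diff[symmetric]) auto
    also have "\<dots> = (LINT z|lborel. indicator {x<..} z * H z)"
      by (intro Bochner_Integration.integral_cong) (auto simp: p_def n_def indicator_def max_def)
    finally show ?thesis using z by simp
  qed
  have "density lborel (\<lambda>z. ennreal (p z)) = density lborel (\<lambda>z. ennreal (n z))"
  proof (rule measure_eqI_lessThan)
    have pn: "0 \<le> p z" "0 \<le> n z" for z by (auto simp: p_def n_def)
    show "emeasure (density lborel (\<lambda>z. ennreal (p z))) {x<..} = emeasure (density lborel (\<lambda>z. ennreal (n z))) {x<..}"
      and "emeasure (density lborel (\<lambda>z. ennreal (p z))) {x<..} < \<infinity>" for x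
      by (simp_all only: e[OF i(1) pn(1)] e[OF i(2) pn(2)] eq) simp
  qed auto
  then have "AE z in lborel. ennreal (p z) = ennreal (n z)"
    by (intro sigma_finite_measure.density_unique[OF sigma_finite_lborel]) auto
  then show ?thesis
    by eventually_elim (auto simp: p_def n_def max_def split: if_splits)
qed

text \<open>The Borel case is transferred to the completion through a Borel function that agrees
  with \<open>H\<close> almost everywhere.\<close>

lemma AE_zero_if_tail_integrals_zero:
  fixes H :: "real \<Rightarrow> real"
  assumes H: "integrable lebesgue H" and z: "\<And>x. (LINT z|lebesgue. indicator {x<..} z * H z) = 0"
  shows "AE z in lebesgue. H z = 0"
proof -
  obtain H' where H': "H' \<in> borel_measurable lborel" "AE z in lborel. H z = H' z"
    using completion_ex_borel_measurable_real[OF borel_measurable_integrable[OF H]] by blast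
  have ae: "AE z in lebesgue. H z = H' z" by (rule AE_completion[OF H'(2)])
  have m: "H' \<in> borel_measurable lebesgue" using H'(1) by (rule measurable_completion)
  have "integrable lebesgue H'"
    using H ae m by (intro integrable_cong_AE[THEN iffD1, OF _ _ ae H]) auto
  then have i: "integrable lborel H'" using H' by (simp add: integrable_completion)
  have "(LINT z|lborel. indicator {x<..} z * H' z) = 0" for x
  proof -
    have "(LINT z|lborel. indicator {x<..} z * H' z) = (LINT z|lebesgue. indicator {x<..} z * H' z)"
      using H' by (intro integral_completion[symmetric]) (auto intro!: borel_measurable_times)
    also have "\<dots> = (LINT z|lebesgue. indicator {x<..} z * H z)"
    proof (intro integral_cong_AE)
      show "(\<lambda>z. indicator {x<..} z * H' z) \<in> borel_measurable lebesgue"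
        by (rule borel_measurable_times[OF borel_measurable_indicator m]) simp
      show "(\<lambda>z. indicator {x<..} z * H z) \<in> borel_measurable lebesgue"
        by (rule borel_measurable_times[OF borel_measurable_indicator borel_measurable_integrable[OF H]]) simp
      show "AE z in lebesgue. indicator {x<..} z * H' z = indicator {x<..} z * H z"
        using ae by eventually_elim simp
    qed
    finally show ?thesis using z by simp
  qed
  then have "AE z in lebesgue. H' z = 0"
    by (intro AE_completion AE_lborel_zero_if_tail_integrals_zero[OF i])
  with ae show ?thesis by eventually_elim simp
qed

lemma AE_zero_on_Ioo:
  fixes F :: "real \<Rightarrow> real"
  assumes F: "integrable (lebesgue_on {\<alpha><..<\<beta>}) F"
    and z: "\<And>s. \<alpha> \<le> s \<Longrightarrow> s < \<beta> \<Longrightarrow> (LINT z|lebesgue_on {\<alpha><..<\<beta>}. indicator {s<..<\<beta>} z * F z) = 0"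
  shows "AE z in lebesgue. z \<in> {\<alpha><..<\<beta>} \<longrightarrow> F z = 0"
proof -
  have "AE z in lebesgue. indicator {\<alpha><..<\<beta>} z * F z = 0"
  proof (rule AE_zero_if_tail_integrals_zero)
    show "integrable lebesgue (\<lambda>z. indicator {\<alpha><..<\<beta>} z * F z)"
      using F by (simp add: integrable_restrict_space)
    show "(LINT z|lebesgue. indicator {x<..} z * (indicator {\<alpha><..<\<beta>} z * F z)) = 0" for x
    proof (cases "max x \<alpha> < \<beta>")
      case True
      have "(LINT z|lebesgue. indicator {x<..} z * (indicator {\<alpha><..<\<beta>} z * F z))
        = (LINT z|lebesgue. indicator {\<alpha><..<\<beta>} z * (indicator {max x \<alpha><..<\<beta>} z * F z))"
        by (intro Bochner_Integration.integral_cong) (auto simp: indicator_def)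
      also have "\<dots> = (LINT z|lebesgue_on {\<alpha><..<\<beta>}. indicator {max x \<alpha><..<\<beta>} z * F z)"
        by (simp add: integral_restrict_space)
      finally show ?thesis using z[of "max x \<alpha>"] True by simp
    next
      case False
      then have "(LINT z|lebesgue. indicator {x<..} z * (indicator {\<alpha><..<\<beta>} z * F z)) = (LINT z|(lebesgue::real measure). (0::real))"
        by (intro Bochner_Integration.integral_cong) (auto simp: indicator_def)
      then show ?thesis by simp
    qed
  qed
  then show ?thesis by eventually_elim (auto simp: indicator_def)
qed

definition compact_supp :: "real \<Rightarrow> real \<Rightarrow> (real \<Rightarrow> real) \<Rightarrow> bool" where
  "compact_supp \<alpha> \<beta> \<psi> \<longleftrightarrow> (\<exists>c d. \<alpha> < c \<and> c \<le> d \<and> d < \<beta> \<and> (\<forall>z. z \<notin> {c..d} \<longrightarrow> \<psi> z = 0))"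

lemma compact_supp_diff:
  assumes "compact_supp \<alpha> \<beta> \<psi>" "compact_supp \<alpha> \<beta> \<xi>"
  shows "compact_supp \<alpha> \<beta> (\<lambda>z. \<psi> z - k * \<xi> z)"
proof -
  obtain c d c' d' where *: "\<alpha> < c" "c \<le> d" "d < \<beta>" "\<forall>z. z \<notin> {c..d} \<longrightarrow> \<psi> z = 0"
    "\<alpha> < c'" "c' \<le> d'" "d' < \<beta>" "\<forall>z. z \<notin> {c'..d'} \<longrightarrow> \<xi> z = 0"
    using assms unfolding compact_supp_def by blast
  show ?thesis unfolding compact_supp_def
    by (rule exI[of _ "min c c'"], rule exI[of _ "max d d'"]) (use * in \<open>auto simp: min_def max_def\<close>)
qed

text \<open>The primitive vanishes to the left of the support, and the zero mean makes it vanish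
  again to the right of it, so it is itself a test function.\<close>

lemma antiderivative_test_fun:
  assumes c: "continuous_on UNIV \<xi>" and s: "compact_supp \<alpha> \<beta> \<xi>" and i: "integral {\<alpha>..\<beta>} \<xi> = 0"
  shows "\<exists>\<phi>. test_fun \<alpha> \<beta> \<phi> \<and> deriv \<phi> = \<xi>"
proof -
  obtain c d where cd: "\<alpha> < c" "c \<le> d" "d < \<beta>" and z: "\<And>z. z \<notin> {c..d} \<Longrightarrow> \<xi> z = 0"
    using s unfolding compact_supp_def by blast
  define \<phi> where "\<phi> = (\<lambda>z. integral {\<alpha>..z} \<xi>)"
  have ci: "\<xi> integrable_on {s..t}" for s t
    by (intro integrable_continuous_real continuous_on_subset[OF c]) simp
  have zero: "integral {s..t} \<xi> = 0" if "t \<le> c \<or> d \<le> s" for s t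
  proof -
    have "integral {s..t} \<xi> = integral {s..t} (\<lambda>_. 0)"
    proof (rule integral_spike[of "{c, d}"])
      fix x assume "x \<in> {s..t} - {c, d}"
      then show "0 = \<xi> x" using that z[of x] cd by auto
    qed auto
    then show ?thesis by simp
  qed
  have \<phi>0: "\<phi> z = 0" if "z \<notin> {c<..<d}" for z
  proof (cases "z \<le> c")
    case True then show ?thesis unfolding \<phi>_def by (intro zero) simp
  next
    case False
    then have "d \<le> z" using that by simp
    have "integral {\<alpha>..d} \<xi> + integral {d..z} \<xi> = integral {\<alpha>..z} \<xi>"
      "integral {\<alpha>..d} \<xi> + integral {d..\<beta>} \<xi> = integral {\<alpha>..\<beta>} \<xi>"
      using cd \<open>d \<le> z\<close> by (intro Henstock_Kurzweil_Integration.integral_combine ci; simp)+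
    then show ?thesis using i zero[of _ d] by (simp add: \<phi>_def)
  qed
  have der: "(\<phi> has_real_derivative \<xi> z) (at z)" for z
  proof (cases "z \<in> {\<alpha><..<\<beta>}")
    case True
    have "(\<phi> has_vector_derivative \<xi> z) (at z within {\<alpha>..\<beta>})"
      unfolding \<phi>_def using True by (intro integral_has_vector_derivative continuous_on_subset[OF c]) auto
    moreover have "at z within {\<alpha>..\<beta>} = at z" using True by (intro at_within_interior) simp
    ultimately show ?thesis by (simp add: has_real_derivative_iff_has_vector_derivative)
  next
    case False
    \<comment> \<open>At or beyond the end points the primitive is zero in a neighbourhood, because
      the support stays strictly inside the interval.\<close>
    have "((\<lambda>_. 0) has_real_derivative 0) (at z)" by simp
    moreover have "open (- {c..d})" "z \<in> - {c..d}" using False cd by (auto simp: open_Compl)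
    ultimately have "(\<phi> has_real_derivative 0) (at z)"
      by (rule has_field_derivative_transform_within_open) (auto simp: \<phi>0)
    moreover have "\<xi> z = 0" using \<open>z \<in> - {c..d}\<close> by (intro z) simp
    ultimately show ?thesis by simp
  qed
  have d: "deriv \<phi> = \<xi>" using der by (auto intro: DERIV_imp_deriv)
  have C1: "\<phi> C1_differentiable_on UNIV"
    unfolding C1_differentiable_on_def using der c
    by (auto simp: has_real_derivative_iff_has_vector_derivative)
  have "test_fun \<alpha> \<beta> \<phi>"
    unfolding test_fun_def
    by (rule conjI[OF C1], rule exI[of _ c], rule exI[of _ d]) (use cd in \<open>auto intro!: \<phi>0\<close>)
  then show ?thesis using d by blast
qed

text \<open>Subtracting from a compactly supported continuous function a multiple of a fixed bump
  with the same integral leaves the derivative of a test function. Hence \<open>F\<close> acts on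
  such functions like a constant \<open>k\<close>, and trapezoids extend F - k = 0 to indicators of
  intervals.\<close>

lemma du_Bois_Reymond:
  assumes ab: "\<alpha> < \<beta>" and F: "integrable (lebesgue_on {\<alpha><..<\<beta>}) F"
    and z: "\<And>\<phi>. test_fun \<alpha> \<beta> \<phi> \<Longrightarrow> (LINT z|lebesgue_on {\<alpha><..<\<beta>}. F z * deriv \<phi> z) = 0"
  shows "\<exists>k. AE z in lebesgue. z \<in> {\<alpha><..<\<beta>} \<longrightarrow> F z = k"
proof -
  let ?M = "lebesgue_on {\<alpha><..<\<beta>}"
  have Fm: "F \<in> borel_measurable ?M" using F by auto
  have cm: "\<psi> \<in> borel_measurable ?M" if "continuous_on UNIV \<psi>" for \<psi> :: "real \<Rightarrow> real"
    by (intro continuous_imp_measurable_on_sets_lebesgue continuous_on_subset[OF that]) auto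
  have ci: "\<psi> integrable_on {s..t}" if "continuous_on UNIV \<psi>" for s t and \<psi> :: "real \<Rightarrow> real"
    by (intro integrable_continuous_real continuous_on_subset[OF that]) simp
  have Fi: "integrable ?M (\<lambda>z. \<psi> z * F z)" if c: "continuous_on UNIV \<psi>" for \<psi>
  proof -
    obtain B where B: "\<forall>z\<in>{\<alpha>..\<beta>}. \<bar>\<psi> z\<bar> \<le> B"
      using compact_imp_bounded[OF compact_continuous_image[OF continuous_on_subset[OF c] compact_Icc[of \<alpha> \<beta>]]]
      by (auto simp: bounded_iff simp del: atLeastAtMost_iff)
    show ?thesis
    proof (rule Bochner_Integration.integrable_bound[of _ "\<lambda>z. B * F z"])
      show "AE z in ?M. norm (\<psi> z * F z) \<le> norm (B * F z)"
      proof (rule AE_I2)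
        fix z assume "z \<in> space ?M"
        then have "\<bar>\<psi> z\<bar> \<le> B" using B by auto
        then have "\<bar>\<psi> z\<bar> \<le> \<bar>B\<bar>" by linarith
        then show "norm (\<psi> z * F z) \<le> norm (B * F z)" by (simp add: abs_mult mult_right_mono)
      qed
    qed (use F cm[OF c] Fm in auto)
  qed
  \<comment> \<open>A tent of height 1 over the middle half of the interval. Any bump with nonzero
    integral would serve as normalisation.\<close>
  define \<psi>0 where "\<psi>0 z = max 0 (1 - \<bar>z - (\<alpha> + \<beta>) / 2\<bar> / ((\<beta> - \<alpha>) / 4))" for z
  have c0: "continuous_on UNIV \<psi>0" unfolding \<psi>0_def using ab by (intro continuous_intros) auto
  have s0: "compact_supp \<alpha> \<beta> \<psi>0"
    unfolding compact_supp_def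
  proof (intro exI conjI allI impI)
    show "\<alpha> < (\<alpha> + \<beta>) / 2 - (\<beta> - \<alpha>) / 4" "(\<alpha> + \<beta>) / 2 - (\<beta> - \<alpha>) / 4 \<le> (\<alpha> + \<beta>) / 2 + (\<beta> - \<alpha>) / 4"
      "(\<alpha> + \<beta>) / 2 + (\<beta> - \<alpha>) / 4 < \<beta>" using ab by (auto simp: field_simps)
    fix z assume z: "z \<notin> {(\<alpha> + \<beta>) / 2 - (\<beta> - \<alpha>) / 4..(\<alpha> + \<beta>) / 2 + (\<beta> - \<alpha>) / 4}"
    then have "z < (\<alpha> + \<beta>) / 2 - (\<beta> - \<alpha>) / 4 \<or> (\<alpha> + \<beta>) / 2 + (\<beta> - \<alpha>) / 4 < z" by auto
    then have "\<bar>z - (\<alpha> + \<beta>) / 2\<bar> > (\<beta> - \<alpha>) / 4" by linarith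
    then show "\<psi>0 z = 0" using ab by (simp add: \<psi>0_def field_simps)
  qed
  define K where "K = integral {\<alpha>..\<beta>} \<psi>0"
  have K: "K \<noteq> 0"
  proof
    assume "K = 0"
    then have "(\<psi>0 has_integral 0) (cbox \<alpha> \<beta>)"
      using integrable_integral[OF ci[OF c0, of \<alpha> \<beta>]] by (simp add: K_def)
    then have "\<psi>0 ((\<alpha> + \<beta>) / 2) = 0"
      using ab by (intro has_integral_0_cbox_imp_0[OF continuous_on_subset[OF c0] _ \<open>(\<psi>0 has_integral 0) _\<close>])
        (auto simp: \<psi>0_def)
    then show False by (simp add: \<psi>0_def)
  qed
  define k where "k = (LINT z|?M. \<psi>0 z * F z) / K"
  have main: "(LINT z|?M. \<psi> z * (F z - k)) = 0" if c: "continuous_on UNIV \<psi>" and s: "compact_supp \<alpha> \<beta> \<psi>" for \<psi>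
  proof -
    define I where "I = integral {\<alpha>..\<beta>} \<psi>"
    define \<xi> where "\<xi> = (\<lambda>z. \<psi> z - (I / K) * \<psi>0 z)"
    have c': "continuous_on UNIV \<xi>" unfolding \<xi>_def using c c0 by (intro continuous_intros)
    have s': "compact_supp \<alpha> \<beta> \<xi>" unfolding \<xi>_def by (rule compact_supp_diff[OF s s0])
    have "integral {\<alpha>..\<beta>} \<xi> = I - (I / K) * K"
      unfolding \<xi>_def I_def[symmetric] K_def[symmetric]
      by (subst Henstock_Kurzweil_Integration.integral_diff[OF ci[OF c] integrable_on_mult_right[OF ci[OF c0]]])
        (simp add: I_def K_def)
    then have "integral {\<alpha>..\<beta>} \<xi> = 0" using K by simp
    from antiderivative_test_fun[OF c' s' this] have "(LINT z|?M. F z * \<xi> z) = 0" using z by metis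
    also have "(LINT z|?M. F z * \<xi> z) = (LINT z|?M. \<psi> z * F z - (I / K) * (\<psi>0 z * F z))"
      by (simp add: \<xi>_def algebra_simps)
    also have "\<dots> = (LINT z|?M. \<psi> z * F z) - (I / K) * (LINT z|?M. \<psi>0 z * F z)"
      using Fi[OF c] Fi[OF c0] by simp
    finally have 1: "(LINT z|?M. \<psi> z * F z) = k * I" by (simp add: k_def)
    have \<psi>i: "integrable ?M \<psi>" by (intro L2_fun_integrable L2_fun_continuous continuous_on_subset[OF c]) simp
    have "(LINT z|?M. \<psi> z * (F z - k)) = (LINT z|?M. \<psi> z * F z - k * \<psi> z)"
      by (simp add: algebra_simps)
    also have "\<dots> = (LINT z|?M. \<psi> z * F z) - k * (LINT z|?M. \<psi> z)"
      using Fi[OF c] \<psi>i by simp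
    also have "(LINT z|?M. \<psi> z) = I" using LINT_Ioo_eq_integral[OF \<psi>i] by (simp add: I_def)
    finally show ?thesis using 1 by simp
  qed
  have Fk: "integrable ?M (\<lambda>z. F z - k)" using F integrable_const_on_Ioo[of \<alpha> \<beta> k] by simp
  have "AE z in lebesgue. z \<in> {\<alpha><..<\<beta>} \<longrightarrow> F z - k = 0"
  proof (rule AE_zero_on_Ioo[OF Fk])
    fix s assume s: "\<alpha> \<le> s" "s < \<beta>"
    \<comment> \<open>Trapezoids of slope n + 1 whose support is 1/(n+1) away from both
      \<open>s\<close> and \<beta>. They are bounded by 1 and converge pointwise to the indicator of
      the open interval.\<close>
    define \<psi> where "\<psi> n z = max 0 (min 1 (real (Suc n) * min (z - s - 1 / real (Suc n)) (\<beta> - 1 / real (Suc n) - z)))" for n z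
    have c: "continuous_on UNIV (\<psi> n)" for n unfolding \<psi>_def by (intro continuous_intros)
    have supp0: "\<psi> n z = 0" if "z \<notin> {s + 1 / real (Suc n)..\<beta> - 1 / real (Suc n)}" for n z
    proof -
      have "min (z - s - 1 / real (Suc n)) (\<beta> - 1 / real (Suc n) - z) \<le> 0" using that by auto
      then have "real (Suc n) * min (z - s - 1 / real (Suc n)) (\<beta> - 1 / real (Suc n) - z) \<le> 0"
        by (intro mult_nonneg_nonpos) auto
      then show ?thesis unfolding \<psi>_def by (simp add: max_def min_def)
    qed
    have supp: "compact_supp \<alpha> \<beta> (\<psi> n)" for n
    proof (cases "s + 1 / real (Suc n) \<le> \<beta> - 1 / real (Suc n)")
      case True
      have "1 / real (Suc n) > 0" by simp
      then have "\<alpha> < s + 1 / real (Suc n)" "\<beta> - 1 / real (Suc n) < \<beta>" using s by linarith+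
      then show ?thesis unfolding compact_supp_def using supp0[where n = n] True by blast
    next
      case False
      then have "\<psi> n z = 0" for z by (intro supp0) auto
      \<comment> \<open>For small \<open>n\<close> the prescribed support is empty and the trapezoid
        is zero, so any point of the interval serves as support.\<close>
      then show ?thesis unfolding compact_supp_def using ab by (intro exI[of _ "(\<alpha> + \<beta>) / 2"]) auto
    qed
    have lim: "(\<lambda>n. \<psi> n z) \<longlonglongrightarrow> indicator {s<..<\<beta>} z" for z
    proof (cases "z \<in> {s<..<\<beta>}")
      case True
      obtain n0 :: nat where n0: "2 / min (z - s) (\<beta> - z) < real n0" using reals_Archimedean2 by blast
      have "\<psi> n z = 1" if "n \<ge> n0" for n
      proof -
        have p: "min (z - s) (\<beta> - z) > 0" using True by simp
        have "2 < real n0 * min (z - s) (\<beta> - z)" using n0 p by (simp only: pos_divide_less_eq)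
        also have "\<dots> \<le> real (Suc n) * min (z - s) (\<beta> - z)" using that p by (intro mult_right_mono) auto
        finally have "2 < real (Suc n) * min (z - s) (\<beta> - z)" .
        moreover have "min (z - s - 1 / real (Suc n)) (\<beta> - 1 / real (Suc n) - z) = min (z - s) (\<beta> - z) - 1 / real (Suc n)"
          by (auto simp: min_def)
        moreover have "real (Suc n) * (min (z - s) (\<beta> - z) - 1 / real (Suc n)) = real (Suc n) * min (z - s) (\<beta> - z) - 1"
          by (simp add: right_diff_distrib del: of_nat_Suc)
        ultimately show ?thesis unfolding \<psi>_def by (simp only:)
      qed
      then have "\<forall>\<^sub>F n in sequentially. \<psi> n z = indicator {s<..<\<beta>} z"
        using True by (auto simp: eventually_sequentially intro!: exI[of _ n0])
      then show ?thesis by (rule tendsto_eventually)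
    next
      case False
      have "\<psi> n z = 0" for n
      proof (rule supp0, rule notI)
        assume "z \<in> {s + 1 / real (Suc n)..\<beta> - 1 / real (Suc n)}"
        moreover have "1 / real (Suc n) > 0" by simp
        ultimately have "s < z" "z < \<beta>" unfolding atLeastAtMost_iff by linarith+
        then show False using False by simp
      qed
      then show ?thesis using False by simp
    qed
    have "(\<lambda>n. LINT z|?M. \<psi> n z * (F z - k)) \<longlonglongrightarrow> (LINT z|?M. indicator {s<..<\<beta>} z * (F z - k))"
    proof (rule integral_dominated_convergence[where w = "\<lambda>z. norm (F z - k)"])
      have "{s<..<\<beta>} \<subseteq> {\<alpha><..<\<beta>}" using s by auto
      then have "{s<..<\<beta>} \<in> sets ?M" by (simp add: sets_restrict_space_iff)
      then show "(\<lambda>z. indicator {s<..<\<beta>} z * (F z - k)) \<in> borel_measurable ?M"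
        using Fm by (intro borel_measurable_times borel_measurable_indicator) auto
      show "(\<lambda>z. \<psi> n z * (F z - k)) \<in> borel_measurable ?M" for n
        using Fm cm[OF c] by (intro borel_measurable_times) auto
      show "integrable ?M (\<lambda>z. norm (F z - k))" using Fk by simp
      show "AE z in ?M. (\<lambda>n. \<psi> n z * (F z - k)) \<longlonglongrightarrow> indicator {s<..<\<beta>} z * (F z - k)"
        by (intro AE_I2 tendsto_mult lim tendsto_const)
      have "\<bar>\<psi> n z\<bar> \<le> 1" for n z unfolding \<psi>_def by (simp add: max_def min_def)
      then show "AE z in ?M. norm (\<psi> n z * (F z - k)) \<le> norm (F z - k)" for n
        by (intro AE_I2) (simp add: abs_mult mult_left_le_one_le)
    qed
    then show "(LINT z|?M. indicator {s<..<\<beta>} z * (F z - k)) = 0"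
      using main[OF c supp] by (simp add: LIMSEQ_const_iff)
  qed
  then show ?thesis by (intro exI[of _ k]) (auto elim: eventually_mono)
qed

section \<open>Weak derivatives, primitives and continuous representatives\<close>

lemma test_fun_ac:
  assumes "test_fun \<alpha> \<beta> \<phi>"
  shows "ac \<alpha> \<beta> \<phi> (deriv \<phi>)"
proof -
  obtain D where D: "\<And>z. (\<phi> has_vector_derivative D z) (at z)" "continuous_on UNIV D"
    using assms unfolding test_fun_def C1_differentiable_on_def by blast
  then have "deriv \<phi> = D"
    by (auto intro!: DERIV_imp_deriv simp: has_real_derivative_iff_has_vector_derivative)
  then show ?thesis using D
    by (intro ac_C1) (auto simp: has_real_derivative_iff_has_vector_derivative
        intro: has_vector_derivative_at_within continuous_on_subset)
qed

lemma test_fun_ends: "test_fun \<alpha> \<beta> \<phi> \<Longrightarrow> \<phi> \<alpha> = 0 \<and> \<phi> \<beta> = 0"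
  unfolding test_fun_def by auto

lemma ac_test_fun:
  assumes u: "ac \<alpha> \<beta> u g" and t: "test_fun \<alpha> \<beta> \<phi>" and ab: "\<alpha> < \<beta>"
  shows "(LINT z|lebesgue_on {\<alpha><..<\<beta>}. u z * deriv \<phi> z) = - (LINT z|lebesgue_on {\<alpha><..<\<beta>}. g z * \<phi> z)"
proof -
  note p = test_fun_ac[OF t]
  have i1: "integrable (lebesgue_on {\<alpha><..<\<beta>}) (\<lambda>z. u z * deriv \<phi> z)"
    by (intro L2_fun_mult ac_L2_fun[OF u] ac_L2[OF p])
  have i2: "integrable (lebesgue_on {\<alpha><..<\<beta>}) (\<lambda>z. g z * \<phi> z)"
    by (intro L2_fun_mult ac_L2[OF u] ac_L2_fun[OF p])
  have "(LINT z|lebesgue_on {\<alpha><..<\<beta>}. g z * \<phi> z) + (LINT z|lebesgue_on {\<alpha><..<\<beta>}. u z * deriv \<phi> z)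
    = (LINT z|lebesgue_on {\<alpha><..<\<beta>}. g z * \<phi> z + u z * deriv \<phi> z)"
    using i1 i2 by simp
  also have "\<dots> = integral {\<alpha>..\<beta>} (\<lambda>z. g z * \<phi> z + u z * deriv \<phi> z)"
    using i1 i2 by (intro LINT_Ioo_eq_integral) simp
  also have "\<dots> = 0" using ac_mult[OF u p] ab test_fun_ends[OF t] by simp
  finally show ?thesis by simp
qed

text \<open>The difference of \<open>f\<close> and the primitive of \<open>g\<close> has weak
  derivative zero, hence is constant almost everywhere.\<close>

lemma has_weak_deriv_imp_ac:
  assumes ab: "\<alpha> < \<beta>" and w: "has_weak_deriv \<alpha> \<beta> f g"
  shows "\<exists>u. ac \<alpha> \<beta> u g \<and> (AE z in lebesgue. z \<in> {\<alpha><..<\<beta>} \<longrightarrow> f z = u z)"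
proof -
  define G where "G z = 0 + integral {\<alpha>..z} g" for z
  have f: "L2_fun \<alpha> \<beta> f" and g: "L2_fun \<alpha> \<beta> g" using w by (auto simp: has_weak_deriv_def)
  have G: "ac \<alpha> \<beta> G g" unfolding G_def using g by (rule ac_indefinite)
  have "\<exists>k. AE z in lebesgue. z \<in> {\<alpha><..<\<beta>} \<longrightarrow> f z - G z = k"
  proof (rule du_Bois_Reymond[OF ab])
    show "integrable (lebesgue_on {\<alpha><..<\<beta>}) (\<lambda>z. f z - G z)"
      by (intro L2_fun_integrable L2_fun_diff f ac_L2_fun[OF G])
    fix \<phi> assume t: "test_fun \<alpha> \<beta> \<phi>"
    note p = ac_L2[OF test_fun_ac[OF t]]
    show "(LINT z|lebesgue_on {\<alpha><..<\<beta>}. (f z - G z) * deriv \<phi> z) = 0"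
      using L2_fun_mult[OF f p] L2_fun_mult[OF ac_L2_fun[OF G] p] w t ac_test_fun[OF G t ab]
      by (simp add: left_diff_distrib has_weak_deriv_def)
  qed
  then obtain k where k: "AE z in lebesgue. z \<in> {\<alpha><..<\<beta>} \<longrightarrow> f z - G z = k" by blast
  have "ac \<alpha> \<beta> (\<lambda>z. k + integral {\<alpha>..z} g) g" using g by (rule ac_indefinite)
  moreover have "AE z in lebesgue. z \<in> {\<alpha><..<\<beta>} \<longrightarrow> f z = k + integral {\<alpha>..z} g"
    using k by eventually_elim (auto simp: G_def)
  ultimately show ?thesis by blast
qed

lemma ac_imp_has_weak_deriv:
  assumes ab: "\<alpha> < \<beta>" and u: "ac \<alpha> \<beta> u g" and e: "AE z in lebesgue. z \<in> {\<alpha><..<\<beta>} \<longrightarrow> f z = u z"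
  shows "has_weak_deriv \<alpha> \<beta> f g"
  unfolding has_weak_deriv_def
proof (intro conjI allI impI)
  show f: "L2_fun \<alpha> \<beta> f"
    by (rule L2_fun_cong_AE[OF ac_L2_fun[OF u]]) (use e in eventually_elim, auto)
  show "L2_fun \<alpha> \<beta> g" by (rule ac_L2[OF u])
  fix \<phi> assume t: "test_fun \<alpha> \<beta> \<phi>"
  note p = ac_L2[OF test_fun_ac[OF t]]
  have "AE z in lebesgue_on {\<alpha><..<\<beta>}. f z = u z" using e by (simp add: AE_restrict_space_iff)
  then have "(LINT z|lebesgue_on {\<alpha><..<\<beta>}. f z * deriv \<phi> z) = (LINT z|lebesgue_on {\<alpha><..<\<beta>}. u z * deriv \<phi> z)"
    using L2_fun_mult[OF f p] L2_fun_mult[OF ac_L2_fun[OF u] p]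
    by (intro integral_cong_AE borel_measurable_integrable) (auto elim: eventually_mono)
  then show "(LINT z|lebesgue_on {\<alpha><..<\<beta>}. f z * deriv \<phi> z) = - (LINT z|lebesgue_on {\<alpha><..<\<beta>}. g z * \<phi> z)"
    using ac_test_fun[OF u t ab] by simp
qed

lemma continuous_AE_eq:
  fixes u w :: "real \<Rightarrow> real"
  assumes ab: "\<alpha> < \<beta>" and c: "continuous_on {\<alpha>..\<beta>} u" "continuous_on {\<alpha>..\<beta>} w"
    and e: "AE z in lebesgue. z \<in> {\<alpha><..<\<beta>} \<longrightarrow> u z = w z" and z: "z \<in> {\<alpha>..\<beta>}"
  shows "u z = w z"
proof -
  let ?C = "{z \<in> {\<alpha>..\<beta>}. u z - w z = 0}"
  have C: "closed ?C"
    using continuous_closed_preimage[of "{\<alpha>..\<beta>}" "\<lambda>z. u z - w z" "{0}"] c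
    by (auto simp: vimage_def Int_def intro: continuous_intros)
  have ae: "AE z in lebesgue. z \<in> {\<alpha><..<\<beta>} \<longrightarrow> z \<in> ?C"
    using e by eventually_elim auto
  have "{\<alpha><..<\<beta>} \<subseteq> ?C"
    using mem_closed_if_AE_lebesgue_open[OF _ C ae] by auto
  then have "closure {\<alpha><..<\<beta>} \<subseteq> ?C" using C by (rule closure_minimal)
  then show ?thesis using z ab by auto
qed

text \<open>Two continuous functions that agree almost everywhere on the open interval agree on its
  closure, so the choice made in \<open>cont_rep\<close> is determined up to and including the end
  points.\<close>

lemma cont_rep_eq:
  assumes ab: "\<alpha> < \<beta>" and c: "continuous_on {\<alpha>..\<beta>} u"
    and e: "AE z in lebesgue. z \<in> {\<alpha><..<\<beta>} \<longrightarrow> f z = u z" and z: "z \<in> {\<alpha>..\<beta>}"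
  shows "cont_rep \<alpha> \<beta> f z = u z"
proof -
  let ?P = "\<lambda>u. continuous_on {\<alpha>..\<beta>} u \<and> (AE z in lebesgue. z \<in> {\<alpha><..<\<beta>} \<longrightarrow> f z = u z)"
  have "?P (cont_rep \<alpha> \<beta> f)"
    unfolding cont_rep_def by (rule someI[of ?P u]) (use c e in blast)
  then have cr: "continuous_on {\<alpha>..\<beta>} (cont_rep \<alpha> \<beta> f)"
    and ce: "AE z in lebesgue. z \<in> {\<alpha><..<\<beta>} \<longrightarrow> f z = cont_rep \<alpha> \<beta> f z" by auto
  from ce e have "AE z in lebesgue. z \<in> {\<alpha><..<\<beta>} \<longrightarrow> cont_rep \<alpha> \<beta> f z = u z"
    by eventually_elim auto
  then show ?thesis by (rule continuous_AE_eq[OF ab cr c _ z])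
qed

text \<open>Equal functions have equal increments, so the difference of the derivatives integrates
  to zero over every interval ending at \<beta>.\<close>

lemma ac_deriv_unique:
  assumes ab: "\<alpha> < \<beta>" and u: "ac \<alpha> \<beta> u g" and v: "ac \<alpha> \<beta> v h"
    and e: "AE z in lebesgue. z \<in> {\<alpha><..<\<beta>} \<longrightarrow> u z = v z"
  shows "AE z in lebesgue. z \<in> {\<alpha><..<\<beta>} \<longrightarrow> g z = h z"
proof -
  have eq: "u z = v z" if "z \<in> {\<alpha>..\<beta>}" for z
    using continuous_AE_eq[OF ab ac_continuous[OF u] ac_continuous[OF v] e that] .
  have w: "ac \<alpha> \<beta> (\<lambda>z. u z - v z) (\<lambda>z. g z - h z)" by (rule ac_diff[OF u v])
  have "AE z in lebesgue. z \<in> {\<alpha><..<\<beta>} \<longrightarrow> g z - h z = 0"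
  proof (rule AE_zero_on_Ioo)
    show i: "integrable (lebesgue_on {\<alpha><..<\<beta>}) (\<lambda>z. g z - h z)" by (rule L2_fun_integrable[OF ac_L2[OF w]])
    fix s assume s: "\<alpha> \<le> s" "s < \<beta>"
    have "(LINT z|lebesgue_on {\<alpha><..<\<beta>}. indicator {s<..<\<beta>} z * (g z - h z)) = (LINT z|lebesgue_on {s<..<\<beta>}. g z - h z)"
      using s by (simp add: integral_restrict_space mult.assoc[symmetric])
        (intro Bochner_Integration.integral_cong, auto simp: indicator_def)
    also have "\<dots> = integral {s..\<beta>} (\<lambda>z. g z - h z)"
      using s by (intro LINT_Ioo_eq_integral integrable_lebesgue_on_subset[OF i]) auto
    also have "\<dots> = 0" using ac_increment[OF w, of s \<beta>] s eq[of s] eq[of \<beta>] by simp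
    finally show "(LINT z|lebesgue_on {\<alpha><..<\<beta>}. indicator {s<..<\<beta>} z * (g z - h z)) = 0" .
  qed
  then show ?thesis by eventually_elim auto
qed

lemma weak_deriv_eq:
  assumes ab: "\<alpha> < \<beta>" and u: "ac \<alpha> \<beta> u g" and e: "AE z in lebesgue. z \<in> {\<alpha><..<\<beta>} \<longrightarrow> f z = u z"
  shows "AE z in lebesgue. z \<in> {\<alpha><..<\<beta>} \<longrightarrow> weak_deriv \<alpha> \<beta> f z = g z"
proof -
  have "has_weak_deriv \<alpha> \<beta> f (weak_deriv \<alpha> \<beta> f)"
    unfolding weak_deriv_def by (rule someI[of "has_weak_deriv \<alpha> \<beta> f", OF ac_imp_has_weak_deriv[OF ab u e]])
  from has_weak_deriv_imp_ac[OF ab this] obtain v where v: "ac \<alpha> \<beta> v (weak_deriv \<alpha> \<beta> f)"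
    and ve: "AE z in lebesgue. z \<in> {\<alpha><..<\<beta>} \<longrightarrow> f z = v z" by blast
  from e ve have "AE z in lebesgue. z \<in> {\<alpha><..<\<beta>} \<longrightarrow> v z = u z"
    by eventually_elim auto
  then show ?thesis by (rule ac_deriv_unique[OF ab v u])
qed

lemma H1_iff_ac:
  assumes "\<alpha> < \<beta>"
  shows "H1 \<alpha> \<beta> f \<longleftrightarrow> (\<exists>u g. ac \<alpha> \<beta> u g \<and> (AE z in lebesgue. z \<in> {\<alpha><..<\<beta>} \<longrightarrow> f z = u z))"
  unfolding H1_def using has_weak_deriv_imp_ac[OF assms] ac_imp_has_weak_deriv[OF assms] by blast

section \<open>Port variables and power balance\<close>

text \<open>Explicit witnesses for membership in the domain: \<open>u1\<close> and \<open>v1\<close>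
  represent the first component on the left and on the right of 0, \<open>u2\<close> the second
  component throughout, each with its derivative. Traces and the values of \<open>J0\<close> are
  then computed without choice operators.\<close>

definition J0_rep :: "real \<Rightarrow> real \<Rightarrow> l2 \<Rightarrow> (real \<Rightarrow> real) \<Rightarrow> (real \<Rightarrow> real) \<Rightarrow> (real \<Rightarrow> real) \<Rightarrow> (real \<Rightarrow> real)
    \<Rightarrow> (real \<Rightarrow> real) \<Rightarrow> (real \<Rightarrow> real) \<Rightarrow> bool" where
  "J0_rep a b e u1 g1 v1 h1 u2 g2 \<longleftrightarrow>
     ac a 0 u1 g1 \<and> (AE z in lebesgue. z \<in> {a<..<0} \<longrightarrow> comp1 e z = u1 z) \<and>
     ac 0 b v1 h1 \<and> (AE z in lebesgue. z \<in> {0<..<b} \<longrightarrow> comp1 e z = v1 z) \<and>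
     ac a b u2 g2 \<and> (AE z in lebesgue. z \<in> {a<..<b} \<longrightarrow> comp2 e z = u2 z)"

lemma dom_J0_iff:
  assumes "a < 0" "0 < b"
  shows "e \<in> dom_J0 a b \<longleftrightarrow> e \<in> L2_on a b \<and> (\<exists>u1 g1 v1 h1 u2 g2. J0_rep a b e u1 g1 v1 h1 u2 g2)"
proof -
  have "a < b" using assms by simp
  then show ?thesis
    unfolding dom_J0_def J0_rep_def H1_iff_ac[OF assms(1)] H1_iff_ac[OF assms(2)] H1_iff_ac[OF \<open>a < b\<close>]
    by blast
qed

lemma AE_nonzero: "AE z in lebesgue. z \<noteq> (c::real)"
  by (intro AE_completion AE_lborel_singleton)

lemma J0_rep_values:
  assumes ab: "a < 0" "0 < b" and e: "J0_rep a b e u1 g1 v1 h1 u2 g2"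
  shows "left_value a b e = vector [u1 a, u2 a]" "right_value a b e = vector [v1 b, u2 b]"
    "flow_if a b e = u2 0" "effort_if a b e = u1 0 - v1 0"
proof -
  have ab': "a < b" using ab by simp
  have 1: "cont_rep a 0 (comp1 e) z = u1 z" if "z \<in> {a..0}" for z
    using e that by (intro cont_rep_eq[OF ab(1) ac_continuous]) (auto simp: J0_rep_def)
  have 2: "cont_rep 0 b (comp1 e) z = v1 z" if "z \<in> {0..b}" for z
    using e that by (intro cont_rep_eq[OF ab(2) ac_continuous]) (auto simp: J0_rep_def)
  have 3: "cont_rep a b (comp2 e) z = u2 z" if "z \<in> {a..b}" for z
    using e that by (intro cont_rep_eq[OF ab' ac_continuous]) (auto simp: J0_rep_def)
  show "left_value a b e = vector [u1 a, u2 a]" "right_value a b e = vector [v1 b, u2 b]"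
    "flow_if a b e = u2 0" "effort_if a b e = u1 0 - v1 0"
    using ab by (simp_all add: left_value_def right_value_def flow_if_def effort_if_def 1 2 3)
qed

lemma square_integrable_vector:
  assumes "p \<in> borel_measurable lebesgue" "q \<in> borel_measurable lebesgue"
    "integrable lebesgue (\<lambda>z. (p z)\<^sup>2)" "integrable lebesgue (\<lambda>z. (q z)\<^sup>2)"
  shows "square_integrable (\<lambda>z. vector [p z, q z])"
proof -
  have e: "(vector [p z, q z] :: real^2) = p z *\<^sub>R axis 1 1 + q z *\<^sub>R axis 2 1" for z
    by (simp add: vec_eq_iff forall_2 axis_def)
  have n: "(norm (vector [p z, q z] :: real^2))\<^sup>2 = (p z)\<^sup>2 + (q z)\<^sup>2" for z
    unfolding power2_norm_eq_inner by (simp add: inner_vec_def sum_2 power2_eq_square)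
  have "(\<lambda>z. vector [p z, q z] :: real^2) \<in> borel_measurable lebesgue"
    unfolding e using assms by (intro borel_measurable_add borel_measurable_scaleR borel_measurable_const)
  then show ?thesis unfolding square_integrable_def n using assms by auto
qed

lemma L2_fun_indicator:
  assumes "L2_fun \<alpha> \<beta> g"
  shows "(\<lambda>z. indicator {\<alpha><..<\<beta>} z * g z) \<in> borel_measurable lebesgue"
    "integrable lebesgue (\<lambda>z. (indicator {\<alpha><..<\<beta>} z * g z)\<^sup>2)"
proof -
  have "(\<lambda>z. if z \<in> {\<alpha><..<\<beta>} then g z else 0) \<in> borel_measurable lebesgue"
    using assms by (simp add: L2_fun_def borel_measurable_if del: greaterThanLessThan_iff)
  moreover have "(\<lambda>z. if z \<in> {\<alpha><..<\<beta>} then g z else 0) = (\<lambda>z. indicator {\<alpha><..<\<beta>} z * g z)"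
    by (auto simp: indicator_def)
  ultimately show "(\<lambda>z. indicator {\<alpha><..<\<beta>} z * g z) \<in> borel_measurable lebesgue" by simp
  have "integrable lebesgue (\<lambda>z. indicator {\<alpha><..<\<beta>} z * (g z)\<^sup>2)"
    using assms by (simp add: L2_fun_def integrable_restrict_space)
  moreover have "(\<lambda>z. indicator {\<alpha><..<\<beta>} z * (g z)\<^sup>2) = (\<lambda>z. (indicator {\<alpha><..<\<beta>} z * g z)\<^sup>2)"
    by (auto simp: indicator_def)
  ultimately show "integrable lebesgue (\<lambda>z. (indicator {\<alpha><..<\<beta>} z * g z)\<^sup>2)" by simp
qed

definition J0_fun :: "real \<Rightarrow> real \<Rightarrow> (real \<Rightarrow> real) \<Rightarrow> (real \<Rightarrow> real) \<Rightarrow> (real \<Rightarrow> real) \<Rightarrow> real \<Rightarrow> real^2" where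
  "J0_fun a b g1 h1 g2 z = vector [- (indicator {a<..<b} z * g2 z),
      - (indicator {a<..<0} z * g1 z + indicator {0<..<b} z * h1 z)]"

lemma J0_fun_square_integrable:
  assumes g: "L2_fun a 0 g1" "L2_fun 0 b h1" "L2_fun a b g2"
  shows "square_integrable (J0_fun a b g1 h1 g2)"
proof -
  note i = L2_fun_indicator[OF g(1)] L2_fun_indicator[OF g(2)] L2_fun_indicator[OF g(3)]
  have "(\<lambda>z. (- (indicator {a<..<0} z * g1 z + indicator {0<..<b} z * h1 z))\<^sup>2)
    = (\<lambda>z. (indicator {a<..<0} z * g1 z)\<^sup>2 + (indicator {0<..<b} z * h1 z)\<^sup>2)"
    by (auto simp: indicator_def)
  then have "integrable lebesgue (\<lambda>z. (- (indicator {a<..<0} z * g1 z + indicator {0<..<b} z * h1 z))\<^sup>2)"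
    using i by simp
  then show ?thesis
    unfolding J0_fun_def[abs_def] using i by (intro square_integrable_vector) auto
qed

lemma rep_J0:
  assumes ab: "a < 0" "0 < b" and e: "J0_rep a b e u1 g1 v1 h1 u2 g2"
  shows "AE z in lebesgue. rep_l2 (J0 a b e) z = J0_fun a b g1 h1 g2 z"
proof -
  have ab': "a < b" using ab by simp
  let ?w1 = "weak_deriv a 0 (comp1 e)" and ?w2 = "weak_deriv 0 b (comp1 e)" and ?w3 = "weak_deriv a b (comp2 e)"
  have w: "AE z in lebesgue. z \<in> {a<..<0} \<longrightarrow> ?w1 z = g1 z" "AE z in lebesgue. z \<in> {0<..<b} \<longrightarrow> ?w2 z = h1 z"
    "AE z in lebesgue. z \<in> {a<..<b} \<longrightarrow> ?w3 z = g2 z"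
    using e unfolding J0_rep_def
    by (blast intro: weak_deriv_eq[OF ab(1)] weak_deriv_eq[OF ab(2)] weak_deriv_eq[OF ab'])+
  have L: "L2_fun a 0 g1" "L2_fun 0 b h1" "L2_fun a b g2"
    using e unfolding J0_rep_def by (auto intro: ac_L2)
  have "L2_fun a 0 ?w1" "L2_fun 0 b ?w2" "L2_fun a b ?w3"
    by (rule L2_fun_cong_AE[OF L(1)] L2_fun_cong_AE[OF L(2)] L2_fun_cong_AE[OF L(3)]; use w in eventually_elim; auto)+
  then have "square_integrable (J0_fun a b ?w1 ?w2 ?w3)" by (rule J0_fun_square_integrable)
  then have "AE z in lebesgue. rep_l2 (abs_l2 (J0_fun a b ?w1 ?w2 ?w3)) z = J0_fun a b ?w1 ?w2 ?w3 z"
    by (rule rep_abs_AE)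
  moreover have "J0 a b e = abs_l2 (J0_fun a b ?w1 ?w2 ?w3)"
    by (simp add: J0_def J0_fun_def[abs_def])
  ultimately have "AE z in lebesgue. rep_l2 (J0 a b e) z = J0_fun a b ?w1 ?w2 ?w3 z" by simp
  then show ?thesis using w
    by eventually_elim (auto simp: J0_fun_def indicator_def)
qed

lemma J0_L2_on:
  assumes ab: "a < 0" "0 < b" and e: "J0_rep a b e u1 g1 v1 h1 u2 g2"
  shows "J0 a b e \<in> L2_on a b"
  unfolding L2_on_def mem_Collect_eq using rep_J0[OF assms]
proof eventually_elim
  case (elim z)
  then show ?case using ab by (auto simp: J0_fun_def vec_eq_iff forall_2)
qed

lemma comp_add:
  "AE z in lebesgue. comp1 (x + y) z = comp1 x z + comp1 y z"
  "AE z in lebesgue. comp2 (x + y) z = comp2 x z + comp2 y z"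
  unfolding comp1_def comp2_def using rep_add[of x y] by (auto elim!: eventually_mono)

lemma comp_scale:
  "AE z in lebesgue. comp1 (c *\<^sub>R x) z = c * comp1 x z"
  "AE z in lebesgue. comp2 (c *\<^sub>R x) z = c * comp2 x z"
  unfolding comp1_def comp2_def using rep_scale[of c x] by (auto elim!: eventually_mono)

lemma J0_rep_add:
  assumes "J0_rep a b e u1 g1 v1 h1 u2 g2" "J0_rep a b e' u1' g1' v1' h1' u2' g2'"
  shows "J0_rep a b (e + e') (\<lambda>z. u1 z + u1' z) (\<lambda>z. g1 z + g1' z) (\<lambda>z. v1 z + v1' z) (\<lambda>z. h1 z + h1' z)
    (\<lambda>z. u2 z + u2' z) (\<lambda>z. g2 z + g2' z)"
  using assms unfolding J0_rep_def
proof (elim conjE, intro conjI ac_add)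
  assume a: "AE z in lebesgue. z \<in> {a<..<0} \<longrightarrow> comp1 e z = u1 z" "AE z in lebesgue. z \<in> {a<..<0} \<longrightarrow> comp1 e' z = u1' z"
  show "AE z in lebesgue. z \<in> {a<..<0} \<longrightarrow> comp1 (e + e') z = u1 z + u1' z"
    using a comp_add(1)[of e e'] by eventually_elim auto
next
  assume a: "AE z in lebesgue. z \<in> {0<..<b} \<longrightarrow> comp1 e z = v1 z" "AE z in lebesgue. z \<in> {0<..<b} \<longrightarrow> comp1 e' z = v1' z"
  show "AE z in lebesgue. z \<in> {0<..<b} \<longrightarrow> comp1 (e + e') z = v1 z + v1' z"
    using a comp_add(1)[of e e'] by eventually_elim auto
next
  assume a: "AE z in lebesgue. z \<in> {a<..<b} \<longrightarrow> comp2 e z = u2 z" "AE z in lebesgue. z \<in> {a<..<b} \<longrightarrow> comp2 e' z = u2' z"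
  show "AE z in lebesgue. z \<in> {a<..<b} \<longrightarrow> comp2 (e + e') z = u2 z + u2' z"
    using a comp_add(2)[of e e'] by eventually_elim auto
qed

lemma J0_rep_scale:
  assumes "J0_rep a b e u1 g1 v1 h1 u2 g2"
  shows "J0_rep a b (c *\<^sub>R e) (\<lambda>z. c * u1 z) (\<lambda>z. c * g1 z) (\<lambda>z. c * v1 z) (\<lambda>z. c * h1 z)
    (\<lambda>z. c * u2 z) (\<lambda>z. c * g2 z)"
  using assms unfolding J0_rep_def
proof (elim conjE, intro conjI ac_scale)
  assume a: "AE z in lebesgue. z \<in> {a<..<0} \<longrightarrow> comp1 e z = u1 z"
  show "AE z in lebesgue. z \<in> {a<..<0} \<longrightarrow> comp1 (c *\<^sub>R e) z = c * u1 z"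
    using a comp_scale(1)[of c e] by eventually_elim auto
next
  assume a: "AE z in lebesgue. z \<in> {0<..<b} \<longrightarrow> comp1 e z = v1 z"
  show "AE z in lebesgue. z \<in> {0<..<b} \<longrightarrow> comp1 (c *\<^sub>R e) z = c * v1 z"
    using a comp_scale(1)[of c e] by eventually_elim auto
next
  assume a: "AE z in lebesgue. z \<in> {a<..<b} \<longrightarrow> comp2 e z = u2 z"
  show "AE z in lebesgue. z \<in> {a<..<b} \<longrightarrow> comp2 (c *\<^sub>R e) z = c * u2 z"
    using a comp_scale(2)[of c e] by eventually_elim auto
qed

lemma J0_add:
  assumes ab: "a < 0" "0 < b" and e: "J0_rep a b e u1 g1 v1 h1 u2 g2" "J0_rep a b e' u1' g1' v1' h1' u2' g2'"
  shows "J0 a b (e + e') = J0 a b e + J0 a b e'"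
proof (rule l2_eqI)
  show "AE z in lebesgue. rep_l2 (J0 a b (e + e')) z = rep_l2 (J0 a b e + J0 a b e') z"
    using rep_J0[OF ab J0_rep_add[OF e]] rep_J0[OF ab e(1)] rep_J0[OF ab e(2)] rep_add[of "J0 a b e" "J0 a b e'"]
    by eventually_elim (simp add: J0_fun_def vec_eq_iff forall_2 algebra_simps)
qed

lemma J0_scale:
  assumes ab: "a < 0" "0 < b" and e: "J0_rep a b e u1 g1 v1 h1 u2 g2"
  shows "J0 a b (c *\<^sub>R e) = c *\<^sub>R J0 a b e"
proof (rule l2_eqI)
  have s: "J0_fun a b (\<lambda>z. c * g1 z) (\<lambda>z. c * h1 z) (\<lambda>z. c * g2 z) z = c *\<^sub>R J0_fun a b g1 h1 g2 z" for z
    by (simp add: J0_fun_def vec_eq_iff forall_2 algebra_simps)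
  show "AE z in lebesgue. rep_l2 (J0 a b (c *\<^sub>R e)) z = rep_l2 (c *\<^sub>R J0 a b e) z"
    using rep_J0[OF ab J0_rep_scale[OF e, of c]] rep_J0[OF ab e] rep_scale[of c "J0 a b e"]
    by eventually_elim (simp only: s)
qed

text \<open>Pointwise, the product of e with its image under \<open>J0\<close> is minus the
  derivative of e_1 e_2. Integrating on each side of 0 leaves boundary terms, and since e_2 is
  continuous the two terms at 0 combine to e_2 times the jump of e_1.\<close>

lemma power_balance:
  assumes ab: "a < 0" "0 < b" and e: "J0_rep a b e u1 g1 v1 h1 u2 g2" and eX: "e \<in> L2_on a b"
  shows "l2_inner e (J0 a b e) = u1 a * u2 a - v1 b * u2 b - u2 0 * (u1 0 - v1 0)"
proof -
  have u1: "ac a 0 u1 g1" and v1: "ac 0 b v1 h1" and u2: "ac a b u2 g2"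
    and c: "AE z in lebesgue. z \<in> {a<..<0} \<longrightarrow> comp1 e z = u1 z" "AE z in lebesgue. z \<in> {0<..<b} \<longrightarrow> comp1 e z = v1 z"
      "AE z in lebesgue. z \<in> {a<..<b} \<longrightarrow> comp2 e z = u2 z"
    using e by (simp_all add: J0_rep_def)
  have u2l: "ac a 0 u2 g2" and u2r: "ac 0 b u2 g2" using ab by (auto intro: ac_subset[OF u2])
  define F G where "F = (\<lambda>z. g1 z * u2 z + u1 z * g2 z)" and "G = (\<lambda>z. h1 z * u2 z + v1 z * g2 z)"
  have F: "integrable (lebesgue_on {a<..<0}) F" unfolding F_def
    by (intro Bochner_Integration.integrable_add L2_fun_mult ac_L2[OF u1] ac_L2_fun[OF u2l] ac_L2_fun[OF u1] ac_L2[OF u2l])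
  have G: "integrable (lebesgue_on {0<..<b}) G" unfolding G_def
    by (intro Bochner_Integration.integrable_add L2_fun_mult ac_L2[OF v1] ac_L2_fun[OF u2r] ac_L2_fun[OF v1] ac_L2[OF u2r])
  have Fi: "integrable lebesgue (\<lambda>z. indicator {a<..<0} z * F z)" and Gi: "integrable lebesgue (\<lambda>z. indicator {0<..<b} z * G z)"
    using F G by (simp_all add: integrable_restrict_space)
  have "l2_inner e (J0 a b e) = (LINT z|lebesgue. - (indicator {a<..<0} z * F z + indicator {0<..<b} z * G z))"
    unfolding l2_inner_def
  proof (rule integral_cong_AE)
    show "AE z in lebesgue. rep_l2 e z \<bullet> rep_l2 (J0 a b e) z = - (indicator {a<..<0} z * F z + indicator {0<..<b} z * G z)"
      using rep_J0[OF ab e] c AE_nonzero[of 0]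
    proof eventually_elim
      case (elim z)
      consider "z \<in> {a<..<0}" | "z \<in> {0<..<b}" | "z \<notin> {a<..<b}" using elim(5) by force
      then show ?case
        using elim ab by cases (auto simp: J0_fun_def inner_vec_def sum_2 comp1_def comp2_def F_def G_def algebra_simps)
    qed
    show "(\<lambda>z. rep_l2 e z \<bullet> rep_l2 (J0 a b e) z) \<in> borel_measurable lebesgue" by measurable
    show "(\<lambda>z. - (indicator {a<..<0} z * F z + indicator {0<..<b} z * G z)) \<in> borel_measurable lebesgue"
      using Fi Gi by auto
  qed
  also have "\<dots> = - ((LINT z|lebesgue. indicator {a<..<0} z * F z) + (LINT z|lebesgue. indicator {0<..<b} z * G z))"
    using Fi Gi by simp
  also have "(LINT z|lebesgue. indicator {a<..<0} z * F z) = integral {a..0} F"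
    using LINT_Ioo_eq_integral[OF F] by (simp add: integral_restrict_space)
  also have "\<dots> = u1 0 * u2 0 - u1 a * u2 a"
    unfolding F_def using ac_mult[OF u1 u2l] ab by simp
  also have "(LINT z|lebesgue. indicator {0<..<b} z * G z) = integral {0..b} G"
    using LINT_Ioo_eq_integral[OF G] by (simp add: integral_restrict_space)
  also have "\<dots> = v1 b * u2 b - v1 0 * u2 0"
    unfolding G_def using ac_mult[OF v1 u2r] ab by simp
  finally show ?thesis by (simp add: algebra_simps)
qed

section \<open>The quadratic form of the ports on the kernel of W\<close>

definition port_sum :: "real^4 \<Rightarrow> real^2" where
  "port_sum v = vector [v $ 1 + v $ 3, v $ 2 + v $ 4]"

lemma Sigma_mult: "Sigma_mat *v v = vector [v $ 3, v $ 4, v $ 1, v $ 2]"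
  by (simp add: Sigma_mat_def matrix_vector_mult_def vec_eq_iff forall_4 sum_4 vector_4)

lemma Sigma_form: "v \<bullet> (Sigma_mat *v v) = 2 * (v $ 1 * v $ 3 + v $ 2 * v $ 4)"
  by (simp add: Sigma_mult inner_vec_def sum_4 vector_4)

text \<open>
  If $w\in\ker W$ had $w^\top\Sigma w>0$, then the range of $W^\top$ together with $\Sigma w$ would be a
  three-dimensional nonnegative subspace of the form $\Sigma$; it would meet the plane
  $\{v\mid v_3=-v_1,\ v_4=-v_2\}$, on which the form is negative.
\<close>

lemma kernel_nonpositive:
  fixes W :: "real^4^2"
  assumes rank: "rank W = 2" and psd: "psd (W ** Sigma_mat ** transpose W)" and w: "W *v w = 0"
  shows "w \<bullet> (Sigma_mat *v w) \<le> 0"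
proof (rule ccontr)
  assume "\<not> ?thesis"
  then have pos: "w \<bullet> (Sigma_mat *v w) > 0" by simp
  \<comment> \<open>Two coordinates of \<open>t\<close> parametrise the range of the transpose of
    \<open>W\<close>, the third is the coefficient of the additional vector. The kernel of
    \<open>port_sum\<close> is the negative plane, so a nonzero zero of \<open>f\<close>, which
    exists by dimension, gives the point of intersection.\<close>
  define f :: "real^3 \<Rightarrow> real^2" where
    "f t = port_sum (transpose W *v vector [t $ 1, t $ 2] + (t $ 3) *\<^sub>R (Sigma_mat *v w))" for t
  have "linear f"
    by (intro linearI) (simp_all add: f_def port_sum_def matrix_vector_mult_def vec_eq_iff forall_2 sum_2 algebra_simps)
  have "\<not> inj f"
  proof
    assume "inj f"
    then have "dim (f ` UNIV) = dim (UNIV :: (real^3) set)"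
      using \<open>linear f\<close> by (intro dim_image_eq) (auto intro: inj_on_subset)
    moreover have "dim (f ` UNIV) \<le> 2" using dim_subset_UNIV[of "f ` UNIV"] by simp
    ultimately show False by simp
  qed
  then obtain t where t: "f t = 0" "t \<noteq> 0"
    using linear_injective_0[OF \<open>linear f\<close>] by blast
  define y :: "real^2" where "y = vector [t $ 1, t $ 2]"
  define c where "c = t $ 3"
  define p where "p = transpose W *v y"
  define v where "v = p + c *\<^sub>R (Sigma_mat *v w)"
  have fz: "port_sum v = 0" using t(1) by (simp add: f_def v_def p_def y_def c_def)
  then have v34: "v $ 3 = - v $ 1" "v $ 4 = - v $ 2"
    by (simp_all add: port_sum_def vec_eq_iff forall_2)
  have form_v: "v \<bullet> (Sigma_mat *v v) = - 2 * ((v $ 1)\<^sup>2 + (v $ 2)\<^sup>2)"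
    by (simp add: Sigma_form v34 power2_eq_square)
  have form_p: "p \<bullet> (Sigma_mat *v p) \<ge> 0"
  proof -
    have "p \<bullet> (Sigma_mat *v p) = y \<bullet> ((W ** Sigma_mat ** transpose W) *v y)"
      unfolding p_def
      by (metis (no_types, lifting) dot_lmul_matrix matrix_vector_mul_assoc vector_transpose_matrix transpose_matrix_vector)
    then show ?thesis using psd by (simp add: psd_def)
  qed
  have pw: "p \<bullet> w = 0"
    unfolding p_def using w by (metis dot_lmul_matrix inner_zero_right transpose_matrix_vector)
  \<comment> \<open>\<open>Sigma_mat\<close> is a symmetric involution, so the cross term reduces to
    the product of \<open>p\<close> and \<open>w\<close>, and the last term is the form at
    \<open>w\<close> itself.\<close>
  have "v \<bullet> (Sigma_mat *v v) = p \<bullet> (Sigma_mat *v p) + 2 * c * (p \<bullet> w) + c\<^sup>2 * (w \<bullet> (Sigma_mat *v w))"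
    by (simp add: v_def Sigma_mult inner_vec_def sum_4 vector_4 power2_eq_square algebra_simps)
  then have eq: "- 2 * ((v $ 1)\<^sup>2 + (v $ 2)\<^sup>2) = p \<bullet> (Sigma_mat *v p) + c\<^sup>2 * (w \<bullet> (Sigma_mat *v w))"
    using form_v pw by simp
  have nn: "0 \<le> c\<^sup>2 * (w \<bullet> (Sigma_mat *v w))" "0 \<le> (v $ 1)\<^sup>2" "0 \<le> (v $ 2)\<^sup>2" using pos by auto
  have "c\<^sup>2 * (w \<bullet> (Sigma_mat *v w)) = 0" using eq form_p nn by argo
  moreover have v0: "(v $ 1)\<^sup>2 = 0" "(v $ 2)\<^sup>2 = 0" using eq form_p nn by argo+
  ultimately have c0: "c = 0" using pos by simp
  have "v = 0" using v0 v34 by (simp add: vec_eq_iff forall_4)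
  then have "transpose W *v y = 0" using c0 by (simp add: v_def p_def)
  \<comment> \<open>The intersection might come only from the parametrisation; full rank excludes
    this, so the parameters vanish together with the vector.\<close>
  moreover have "inj ((*v) (transpose W))"
    using rank full_rank_injective[of "transpose W"] by (simp add: rank_transpose)
  ultimately have "y = 0" by (metis injD matrix_vector_mult_0_right)
  then have "t = 0" using c0 by (simp add: y_def c_def vec_eq_iff forall_2 forall_3)
  then show False using t(2) by simp
qed

text \<open>The boundary condition as a function of the two end values alone, which makes its
  linearity and its sign condition finite-dimensional statements.\<close>

definition boundary_map :: "real^4^2 \<Rightarrow> real^2 \<Rightarrow> real^2 \<Rightarrow> real^2" where
  "boundary_map W L R = W *v stack ((1 / sqrt 2) *\<^sub>R (P1 *v R - P1 *v L)) ((1 / sqrt 2) *\<^sub>R (R + L))"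

lemma P1_mult: "P1 *v v = vector [- v $ 2, - v $ 1]"
  by (simp add: P1_def matrix_vector_mult_def vec_eq_iff forall_2 sum_2)

text \<open>Because \<open>P1\<close> is symmetric and both ports carry 1/sqrt 2, the product of
  flow and effort is exactly the difference of the products of the components at the two ends; the
  form of \<open>Sigma_mat\<close> is twice this product.\<close>

lemma boundary_map_nonpositive:
  assumes "rank W = 2" "psd (W ** Sigma_mat ** transpose W)" "boundary_map W L R = 0"
  shows "L $ 1 * L $ 2 - R $ 1 * R $ 2 \<le> 0"
proof -
  have "0 \<ge> 2 * (L $ 1 * L $ 2 - R $ 1 * R $ 2)"
    using kernel_nonpositive[OF assms(1,2) assms(3)[unfolded boundary_map_def]]
    by (simp add: Sigma_form stack_def vector_4 P1_mult field_simps)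
  then show ?thesis by simp
qed

lemma stack_add: "stack (f + f') (e + e') = stack f e + stack f' e'"
  by (simp add: stack_def vec_eq_iff forall_4 vector_4)

lemma stack_scale: "stack (c *\<^sub>R f) (c *\<^sub>R e) = c *\<^sub>R stack f e"
  by (simp add: stack_def vec_eq_iff forall_4 vector_4)

lemma boundary_map_add: "boundary_map W (L + L') (R + R') = boundary_map W L R + boundary_map W L' R'"
proof -
  have "(1 / sqrt 2) *\<^sub>R (P1 *v (R + R') - P1 *v (L + L'))
    = (1 / sqrt 2) *\<^sub>R (P1 *v R - P1 *v L) + (1 / sqrt 2) *\<^sub>R (P1 *v R' - P1 *v L')"
    by (simp add: matrix_vector_right_distrib flip: scaleR_add_right)
  moreover have "(1 / sqrt 2) *\<^sub>R ((R + R') + (L + L')) = (1 / sqrt 2) *\<^sub>R (R + L) + (1 / sqrt 2) *\<^sub>R (R' + L')"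
    by (simp add: algebra_simps flip: scaleR_add_right)
  ultimately show ?thesis by (simp only: boundary_map_def stack_add matrix_vector_right_distrib)
qed

lemma boundary_map_scale: "boundary_map W (c *\<^sub>R L) (c *\<^sub>R R) = c *\<^sub>R boundary_map W L R"
proof -
  have "(1 / sqrt 2) *\<^sub>R (P1 *v (c *\<^sub>R R) - P1 *v (c *\<^sub>R L)) = c *\<^sub>R ((1 / sqrt 2) *\<^sub>R (P1 *v R - P1 *v L))"
    by (simp add: matrix_vector_mult_scaleR scaleR_diff_right)
  moreover have "(1 / sqrt 2) *\<^sub>R (c *\<^sub>R R + c *\<^sub>R L) = c *\<^sub>R ((1 / sqrt 2) *\<^sub>R (R + L))"
    by (simp add: scaleR_add_right)
  ultimately show ?thesis by (simp only: boundary_map_def stack_scale matrix_vector_mult_scaleR)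
qed

section \<open>The operator in the effort variable\<close>

lemma dom_AQ_iff:
  "x \<in> dom_AQ a b Q r W \<longleftrightarrow> x \<in> L2_on a b \<and> mult_op Q x \<in> dom_J0 a b \<and>
     flow_if a b (mult_op Q x) = r * effort_if a b (mult_op Q x) \<and>
     boundary_map W (left_value a b (mult_op Q x)) (right_value a b (mult_op Q x)) = 0"
  by (simp add: dom_AQ_def boundary_map_def flow_bd_def effort_bd_def)

text \<open>This set is the same for all multipliers; the domain of the port-Hamiltonian operator is
  its preimage under multiplication by \<open>Q\<close>.\<close>

definition dom_effort :: "real \<Rightarrow> real \<Rightarrow> real \<Rightarrow> real^4^2 \<Rightarrow> l2 set" where
  "dom_effort a b r W = {e \<in> dom_J0 a b. flow_if a b e = r * effort_if a b e \<and> boundary_map W (left_value a b e) (right_value a b e) = 0}"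

lemma dom_AQ_effort: "x \<in> dom_AQ a b Q r W \<longleftrightarrow> x \<in> L2_on a b \<and> mult_op Q x \<in> dom_effort a b r W"
  by (auto simp: dom_AQ_iff dom_effort_def)

lemma dom_effort_iff:
  assumes ab: "a < 0" "0 < b"
  shows "e \<in> dom_effort a b r W \<longleftrightarrow> e \<in> L2_on a b \<and> (\<exists>u1 g1 v1 h1 u2 g2. J0_rep a b e u1 g1 v1 h1 u2 g2 \<and>
    u2 0 = r * (u1 0 - v1 0) \<and> boundary_map W (vector [u1 a, u2 a]) (vector [v1 b, u2 b]) = 0)"
proof -
  have "(flow_if a b e = r * effort_if a b e \<and> boundary_map W (left_value a b e) (right_value a b e) = 0) \<longleftrightarrow>
    u2 0 = r * (u1 0 - v1 0) \<and> boundary_map W (vector [u1 a, u2 a]) (vector [v1 b, u2 b]) = 0"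
    if "J0_rep a b e u1 g1 v1 h1 u2 g2" for u1 g1 v1 h1 u2 g2
    unfolding J0_rep_values[OF ab that] by (rule refl)
  then show ?thesis
    unfolding dom_effort_def mem_Collect_eq dom_J0_iff[OF ab] by blast
qed

lemma dom_effort_add:
  assumes ab: "a < 0" "0 < b" and e: "e \<in> dom_effort a b r W" "e' \<in> dom_effort a b r W"
  shows "e + e' \<in> dom_effort a b r W" "J0 a b (e + e') = J0 a b e + J0 a b e'"
proof -
  obtain u1 g1 v1 h1 u2 g2 where 1: "J0_rep a b e u1 g1 v1 h1 u2 g2"
    "u2 0 = r * (u1 0 - v1 0)" "boundary_map W (vector [u1 a, u2 a]) (vector [v1 b, u2 b]) = 0"
    using e(1) unfolding dom_effort_iff[OF ab] by blast
  obtain u1' g1' v1' h1' u2' g2' where 2: "J0_rep a b e' u1' g1' v1' h1' u2' g2'"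
    "u2' 0 = r * (u1' 0 - v1' 0)" "boundary_map W (vector [u1' a, u2' a]) (vector [v1' b, u2' b]) = 0"
    using e(2) unfolding dom_effort_iff[OF ab] by blast
  have v: "(vector [x + x', y + y'] :: real^2) = vector [x, y] + vector [x', y']" for x x' y y'
    by (simp add: vec_eq_iff forall_2)
  have "e + e' \<in> L2_on a b"
    using e unfolding dom_effort_iff[OF ab] by (auto intro: subspace_add[OF L2_on_subspace])
  moreover have "u2 0 + u2' 0 = r * ((u1 0 + u1' 0) - (v1 0 + v1' 0))" using 1 2 by (simp add: algebra_simps)
  moreover have "boundary_map W (vector [u1 a + u1' a, u2 a + u2' a]) (vector [v1 b + v1' b, u2 b + u2' b]) = 0"
    unfolding v boundary_map_add using 1 2 by simp
  ultimately show "e + e' \<in> dom_effort a b r W"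
    unfolding dom_effort_iff[OF ab] using J0_rep_add[OF 1(1) 2(1)] by blast
  show "J0 a b (e + e') = J0 a b e + J0 a b e'" by (rule J0_add[OF ab 1(1) 2(1)])
qed

lemma dom_effort_scale:
  assumes ab: "a < 0" "0 < b" and e: "e \<in> dom_effort a b r W"
  shows "c *\<^sub>R e \<in> dom_effort a b r W" "J0 a b (c *\<^sub>R e) = c *\<^sub>R J0 a b e"
proof -
  obtain u1 g1 v1 h1 u2 g2 where 1: "J0_rep a b e u1 g1 v1 h1 u2 g2"
    "u2 0 = r * (u1 0 - v1 0)" "boundary_map W (vector [u1 a, u2 a]) (vector [v1 b, u2 b]) = 0"
    using e(1) unfolding dom_effort_iff[OF ab] by blast
  have v: "(vector [c * x, c * y] :: real^2) = c *\<^sub>R vector [x, y]" for x y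
    by (simp add: vec_eq_iff forall_2)
  have "c *\<^sub>R e \<in> L2_on a b"
    using e unfolding dom_effort_iff[OF ab] by (auto intro: subspace_scale[OF L2_on_subspace])
  moreover have "c * u2 0 = r * (c * u1 0 - c * v1 0)" unfolding 1(2) by (simp add: algebra_simps)
  moreover have "boundary_map W (vector [c * u1 a, c * u2 a]) (vector [c * v1 b, c * u2 b]) = 0"
    unfolding v boundary_map_scale using 1 by simp
  ultimately show "c *\<^sub>R e \<in> dom_effort a b r W"
    unfolding dom_effort_iff[OF ab] using J0_rep_scale[OF 1(1)] by blast
  show "J0 a b (c *\<^sub>R e) = c *\<^sub>R J0 a b e" by (rule J0_scale[OF ab 1(1)])
qed

lemma dom_effort_dissipative:
  assumes ab: "a < 0" "0 < b" and r: "0 \<le> r" and W: "rank W = 2" "psd (W ** Sigma_mat ** transpose W)"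
    and e: "e \<in> dom_effort a b r W"
  shows "l2_inner e (J0 a b e) \<le> 0" "J0 a b e \<in> L2_on a b" "e \<in> L2_on a b"
proof -
  obtain u1 g1 v1 h1 u2 g2 where 1: "J0_rep a b e u1 g1 v1 h1 u2 g2"
    "u2 0 = r * (u1 0 - v1 0)" "boundary_map W (vector [u1 a, u2 a]) (vector [v1 b, u2 b]) = 0"
    using e(1) unfolding dom_effort_iff[OF ab] by blast
  show eX: "e \<in> L2_on a b" using e unfolding dom_effort_iff[OF ab] by blast
  show "J0 a b e \<in> L2_on a b" by (rule J0_L2_on[OF ab 1(1)])
  have "l2_inner e (J0 a b e) = (u1 a * u2 a - v1 b * u2 b) - r * (u1 0 - v1 0)\<^sup>2"
    unfolding power_balance[OF ab 1(1) eX] 1(2) by (simp add: power2_eq_square)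
  moreover have "u1 a * u2 a - v1 b * u2 b \<le> 0" using boundary_map_nonpositive[OF W 1(3)] by simp
  moreover have "0 \<le> r * (u1 0 - v1 0)\<^sup>2" using r by simp
  ultimately show "l2_inner e (J0 a b e) \<le> 0" by linarith
qed

section \<open>The resolvent equation\<close>

lemma J0_rep_exists:
  assumes ab: "a < 0" "0 < b" and u: "ac a 0 u1 g1" "ac 0 b v1 h1" "ac a b u2 g2"
  shows "\<exists>e\<in>L2_on a b. J0_rep a b e u1 g1 v1 h1 u2 g2"
proof -
  define f :: "real \<Rightarrow> real^2" where
    "f z = vector [indicator {a<..<0} z * u1 z + indicator {0<..<b} z * v1 z, indicator {a<..<b} z * u2 z]" for z
  note i = L2_fun_indicator[OF ac_L2_fun[OF u(1)]] L2_fun_indicator[OF ac_L2_fun[OF u(2)]] L2_fun_indicator[OF ac_L2_fun[OF u(3)]]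
  have "(\<lambda>z. (indicator {a<..<0} z * u1 z + indicator {0<..<b} z * v1 z)\<^sup>2)
    = (\<lambda>z. (indicator {a<..<0} z * u1 z)\<^sup>2 + (indicator {0<..<b} z * v1 z)\<^sup>2)"
    by (auto simp: indicator_def)
  then have "integrable lebesgue (\<lambda>z. (indicator {a<..<0} z * u1 z + indicator {0<..<b} z * v1 z)\<^sup>2)"
    using i by simp
  then have f: "square_integrable f"
    unfolding f_def[abs_def] using i by (intro square_integrable_vector) auto
  have "f z = 0" if "z \<notin> {a..b}" for z
    using that ab by (auto simp: f_def vec_eq_iff forall_2 indicator_def)
  then have "abs_l2 f \<in> L2_on a b" by (intro abs_l2_L2_on[OF f]) auto
  moreover have r: "AE z in lebesgue. rep_l2 (abs_l2 f) z = f z" by (rule rep_abs_AE[OF f])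
  have "J0_rep a b (abs_l2 f) u1 g1 v1 h1 u2 g2"
    unfolding J0_rep_def comp1_def comp2_def
  proof (intro conjI u)
    show "AE z in lebesgue. z \<in> {a<..<0} \<longrightarrow> rep_l2 (abs_l2 f) z $ 1 = u1 z"
      using r by eventually_elim (auto simp: f_def)
    show "AE z in lebesgue. z \<in> {0<..<b} \<longrightarrow> rep_l2 (abs_l2 f) z $ 1 = v1 z"
      using r by eventually_elim (auto simp: f_def)
    show "AE z in lebesgue. z \<in> {a<..<b} \<longrightarrow> rep_l2 (abs_l2 f) z $ 2 = u2 z"
      using r by eventually_elim (auto simp: f_def)
  qed
  ultimately show ?thesis by blast
qed

lemma ac_exp: "ac \<alpha> \<beta> (\<lambda>z. c * exp (k * z)) (\<lambda>z. k * (c * exp (k * z)))"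
  by (intro ac_C1 continuous_intros) (auto intro!: derivative_eq_intros)

text \<open>Variation of constants: the solution is \<open>exp (k * z)\<close> times the primitive
  of \<open>exp (- k * z) * f z\<close>, with the equation holding in integrated form.\<close>

lemma linear_ode_solution:
  assumes f: "L2_fun \<alpha> \<beta> f"
  shows "\<exists>p. ac \<alpha> \<beta> p (\<lambda>z. k * p z + f z)"
proof -
  define I where "I z = 0 + integral {\<alpha>..z} (\<lambda>z. exp (- k * z) * f z)" for z
  have "ac \<alpha> \<beta> I (\<lambda>z. exp (- k * z) * f z)"
    unfolding I_def by (intro ac_indefinite L2_fun_bounded_mult f continuous_intros)
  from ac_product[OF _ this, of "\<lambda>z. exp (k * z)" "\<lambda>z. k * exp (k * z)"] ac_exp[of \<alpha> \<beta> 1 k]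
  have "ac \<alpha> \<beta> (\<lambda>z. exp (k * z) * I z) (\<lambda>z. k * exp (k * z) * I z + exp (k * z) * (exp (- k * z) * f z))"
    by (simp only: mult_1)
  moreover have "k * exp (k * z) * I z + exp (k * z) * (exp (- k * z) * f z) = k * (exp (k * z) * I z) + f z" for z
    by (simp add: exp_minus mult.assoc[symmetric])
  ultimately have "ac \<alpha> \<beta> (\<lambda>z. exp (k * z) * I z) (\<lambda>z. k * (exp (k * z) * I z) + f z)"
    by (simp only:)
  then show ?thesis by blast
qed

lemma comp_L2_fun:
  "L2_fun \<alpha> \<beta> (comp1 w)" "L2_fun \<alpha> \<beta> (comp2 w)"
proof -
  have c: "continuous_on UNIV (\<lambda>v :: real^2. v $ i)" for i
    by (intro continuous_intros)
  have m: "(\<lambda>z. rep_l2 w z $ i) \<in> borel_measurable lebesgue" for i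
    using borel_measurable_continuous_onI[OF c] rep_measurable by (rule measurable_compose_rev)
  have "integrable lebesgue (\<lambda>z. (rep_l2 w z $ i)\<^sup>2)" for i
  proof (rule Bochner_Integration.integrable_bound[OF rep_integrable[of w]])
    have "(v $ i)\<^sup>2 \<le> (norm v)\<^sup>2" for v :: "real^2"
      using component_le_norm_cart[of v i] by (simp flip: abs_le_square_iff)
    then show "AE z in lebesgue. norm ((rep_l2 w z $ i)\<^sup>2) \<le> norm ((norm (rep_l2 w z))\<^sup>2)" by simp
  qed (use m in auto)
  then have "integrable (lebesgue_on {\<alpha><..<\<beta>}) (\<lambda>z. (rep_l2 w z $ i)\<^sup>2)" for i
    using integrable_lebesgue_on_subset[of UNIV "\<lambda>z. (rep_l2 w z $ i)\<^sup>2" "{\<alpha><..<\<beta>}"] by (simp add: lebesgue_on_UNIV_eq)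
  moreover have "(\<lambda>z. rep_l2 w z $ i) \<in> borel_measurable (lebesgue_on {\<alpha><..<\<beta>})" for i
    using m by (rule measurable_restrict_space1)
  ultimately show "L2_fun \<alpha> \<beta> (comp1 w)" "L2_fun \<alpha> \<beta> (comp2 w)"
    by (auto simp: L2_fun_def comp1_def[abs_def] comp2_def[abs_def])
qed

text \<open>Half the sum and half the difference lead back to e_1 and e_2. The derivatives obtained
  are e_1' = w_2 - \<mu> e_2 and e_2' = w_1 - \<mu> e_1, the two components of the resolvent
  equation.\<close>

lemma characteristic_variables:
  assumes p: "ac \<alpha> \<beta> p (\<lambda>z. - \<mu> * p z + (w1 z + w2 z))" and q: "ac \<alpha> \<beta> q (\<lambda>z. \<mu> * q z + (w2 z - w1 z))"
  shows "ac \<alpha> \<beta> (\<lambda>z. (p z + q z) / 2) (\<lambda>z. w2 z - \<mu> * ((p z - q z) / 2))"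
    "ac \<alpha> \<beta> (\<lambda>z. (p z - q z) / 2) (\<lambda>z. w1 z - \<mu> * ((p z + q z) / 2))"
proof -
  show "ac \<alpha> \<beta> (\<lambda>z. (p z + q z) / 2) (\<lambda>z. w2 z - \<mu> * ((p z - q z) / 2))"
    by (rule ac_cong[OF ac_scale[OF ac_add[OF p q], of "1/2"]]) (auto simp: field_simps)
  show "ac \<alpha> \<beta> (\<lambda>z. (p z - q z) / 2) (\<lambda>z. w1 z - \<mu> * ((p z + q z) / 2))"
    by (rule ac_cong[OF ac_scale[OF ac_diff[OF p q], of "1/2"]]) (auto simp: field_simps)
qed

text \<open>
  With $p=e_1+e_2$ and $q=e_1-e_2$ the resolvent equation decouples. A solution has two free
  constants on each side of the interface; continuity of $e_2$ at $0$ determines the last one from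
  the other three.
\<close>

definition pl :: "real \<Rightarrow> (real \<Rightarrow> real) \<Rightarrow> real^3 \<Rightarrow> real \<Rightarrow> real" where
  "pl \<mu> p c z = p z + c $ 1 * exp (- \<mu> * z)"
definition ql :: "real \<Rightarrow> (real \<Rightarrow> real) \<Rightarrow> real^3 \<Rightarrow> real \<Rightarrow> real" where
  "ql \<mu> q c z = q z + c $ 2 * exp (\<mu> * z)"
definition pr :: "real \<Rightarrow> (real \<Rightarrow> real) \<Rightarrow> real^3 \<Rightarrow> real \<Rightarrow> real" where
  "pr \<mu> p c z = p z + c $ 3 * exp (- \<mu> * z)"
text \<open>The coefficient is the solution of c_1 - c_2 = c_3 - x, which equates the values of (p -
  q)/2 from both sides at 0.\<close>

definition qr :: "real \<Rightarrow> (real \<Rightarrow> real) \<Rightarrow> real^3 \<Rightarrow> real \<Rightarrow> real" where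
  "qr \<mu> q c z = q z + (c $ 3 - c $ 1 + c $ 2) * exp (\<mu> * z)"

text \<open>The first entry is the defect in the interface condition, the others are the defects in
  the boundary conditions. With the particular solutions as arguments the map is jointly linear, and
  setting them to zero isolates the linear part in \<open>c\<close>.\<close>

definition conditions :: "real \<Rightarrow> real \<Rightarrow> real \<Rightarrow> real^4^2 \<Rightarrow> real \<Rightarrow> (real \<Rightarrow> real) \<Rightarrow> (real \<Rightarrow> real) \<Rightarrow> real^3 \<Rightarrow> real^3" where
  "conditions a b r W \<mu> p q c = (let
      L = vector [(pl \<mu> p c a + ql \<mu> q c a) / 2, (pl \<mu> p c a - ql \<mu> q c a) / 2];
      R = vector [(pr \<mu> p c b + qr \<mu> q c b) / 2, (pr \<mu> p c b - qr \<mu> q c b) / 2];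
      B = boundary_map W L R
    in vector [(pl \<mu> p c 0 - ql \<mu> q c 0) / 2 - r * ((pl \<mu> p c 0 + ql \<mu> q c 0) / 2 - (pr \<mu> p c 0 + qr \<mu> q c 0) / 2),
      B $ 1, B $ 2])"

lemma conditions_add:
  "conditions a b r W \<mu> (\<lambda>z. p z + p' z) (\<lambda>z. q z + q' z) (c + c') = conditions a b r W \<mu> p q c + conditions a b r W \<mu> p' q' c'"
proof -
  have pq: "pl \<mu> (\<lambda>z. p z + p' z) (c + c') z = pl \<mu> p c z + pl \<mu> p' c' z" "ql \<mu> (\<lambda>z. q z + q' z) (c + c') z = ql \<mu> q c z + ql \<mu> q' c' z"
    "pr \<mu> (\<lambda>z. p z + p' z) (c + c') z = pr \<mu> p c z + pr \<mu> p' c' z" "qr \<mu> (\<lambda>z. q z + q' z) (c + c') z = qr \<mu> q c z + qr \<mu> q' c' z" for z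
    by (simp_all add: pl_def ql_def pr_def qr_def algebra_simps)
  have v: "(vector [(x + x' + (y + y')) / 2, (x + x' - (y + y')) / 2] :: real^2)
    = vector [(x + y) / 2, (x - y) / 2] + vector [(x' + y') / 2, (x' - y') / 2]" for x x' y y' :: real
    by (simp add: vec_eq_iff forall_2 field_simps)
  show ?thesis
    unfolding conditions_def Let_def pq v boundary_map_add
    by (simp add: vec_eq_iff forall_3 field_simps)
qed

lemma conditions_scale:
  "conditions a b r W \<mu> (\<lambda>z. 0) (\<lambda>z. 0) (k *\<^sub>R c) = k *\<^sub>R conditions a b r W \<mu> (\<lambda>z. 0) (\<lambda>z. 0) c"
proof -
  have pq: "pl \<mu> (\<lambda>z. 0) (k *\<^sub>R c) z = k * pl \<mu> (\<lambda>z. 0) c z" "ql \<mu> (\<lambda>z. 0) (k *\<^sub>R c) z = k * ql \<mu> (\<lambda>z. 0) c z"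
    "pr \<mu> (\<lambda>z. 0) (k *\<^sub>R c) z = k * pr \<mu> (\<lambda>z. 0) c z" "qr \<mu> (\<lambda>z. 0) (k *\<^sub>R c) z = k * qr \<mu> (\<lambda>z. 0) c z" for z
    by (simp_all add: pl_def ql_def pr_def qr_def algebra_simps)
  have v: "(vector [(k * x + k * y) / 2, (k * x - k * y) / 2] :: real^2) = k *\<^sub>R vector [(x + y) / 2, (x - y) / 2]" for x y :: real
    by (simp add: vec_eq_iff forall_2 field_simps)
  show ?thesis
    unfolding conditions_def Let_def pq v boundary_map_scale
    by (simp add: vec_eq_iff forall_3 field_simps)
qed

lemma resolvent_family:
  assumes ab: "a < 0" "0 < b" and w: "w \<in> L2_on a b"
    and p: "ac a b p (\<lambda>z. - \<mu> * p z + (comp1 w z + comp2 w z))"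
    and q: "ac a b q (\<lambda>z. \<mu> * q z + (comp2 w z - comp1 w z))"
  shows "\<exists>e g1 h1 u2 g2. e \<in> L2_on a b \<and>
    J0_rep a b e (\<lambda>z. (pl \<mu> p c z + ql \<mu> q c z) / 2) g1 (\<lambda>z. (pr \<mu> p c z + qr \<mu> q c z) / 2) h1 u2 g2 \<and>
    (\<forall>z\<le>0. u2 z = (pl \<mu> p c z - ql \<mu> q c z) / 2) \<and> (\<forall>z\<ge>0. u2 z = (pr \<mu> p c z - qr \<mu> q c z) / 2) \<and>
    \<mu> *\<^sub>R e - J0 a b e = w"
proof -
  let ?w1 = "comp1 w" and ?w2 = "comp2 w"
  have add: "ac \<alpha> \<beta> (\<lambda>z. s z + k * exp (d * z)) (\<lambda>z. d * (s z + k * exp (d * z)) + f z)"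
    if "ac a b s (\<lambda>z. d * s z + f z)" "a \<le> \<alpha>" "\<beta> \<le> b" for \<alpha> \<beta> s d k f
    by (rule ac_cong[OF ac_add[OF ac_subset[OF that] ac_exp[of \<alpha> \<beta> k d]]]) (auto simp: algebra_simps)
  have pl: "ac a 0 (pl \<mu> p c) (\<lambda>z. - \<mu> * pl \<mu> p c z + (?w1 z + ?w2 z))" and ql: "ac a 0 (ql \<mu> q c) (\<lambda>z. \<mu> * ql \<mu> q c z + (?w2 z - ?w1 z))"
    and pr: "ac 0 b (pr \<mu> p c) (\<lambda>z. - \<mu> * pr \<mu> p c z + (?w1 z + ?w2 z))" and qr: "ac 0 b (qr \<mu> q c) (\<lambda>z. \<mu> * qr \<mu> q c z + (?w2 z - ?w1 z))"
    unfolding pl_def[abs_def] ql_def[abs_def] pr_def[abs_def] qr_def[abs_def] using ab by (intro add[OF p] add[OF q]; simp)+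
  note L = characteristic_variables[OF pl ql] and R = characteristic_variables[OF pr qr]
  define u1 v1 where "u1 = (\<lambda>z. (pl \<mu> p c z + ql \<mu> q c z) / 2)" and "v1 = (\<lambda>z. (pr \<mu> p c z + qr \<mu> q c z) / 2)"
  \<comment> \<open>The branches agree at 0 by the choice of the coefficient in \<open>qr\<close>,
    so \<open>ac_glue\<close> produces one H1 function on the whole interval.\<close>
  define u2 where "u2 z = (if z \<le> 0 then (pl \<mu> p c z - ql \<mu> q c z) / 2 else (pr \<mu> p c z - qr \<mu> q c z) / 2)" for z
  define g2 where "g2 z = (if z \<le> 0 then ?w1 z - \<mu> * u1 z else ?w1 z - \<mu> * v1 z)" for z
  have at0: "(pl \<mu> p c 0 - ql \<mu> q c 0) / 2 = (pr \<mu> p c 0 - qr \<mu> q c 0) / 2"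
    by (simp add: pl_def ql_def pr_def qr_def)
  have u2r: "u2 z = (pr \<mu> p c z - qr \<mu> q c z) / 2" if "z \<ge> 0" for z
    using that at0 by (cases "z = 0") (auto simp: u2_def)
  have u2l: "u2 z = (pl \<mu> p c z - ql \<mu> q c z) / 2" if "z \<le> 0" for z
    using that by (simp add: u2_def)
  have "ac a 0 u2 g2"
    by (rule ac_cong[OF L(2)]) (simp_all add: u2l g2_def u1_def)
  moreover have "ac 0 b u2 g2"
  proof (rule ac_cong[OF R(2)])
    show "(pr \<mu> p c z - qr \<mu> q c z) / 2 = u2 z" if "z \<in> {0..b}" for z
      using that u2r by simp
    have "?w1 z - \<mu> * ((pr \<mu> p c z + qr \<mu> q c z) / 2) = g2 z" if "z \<in> {0<..<b}" for z
      using that by (simp only: g2_def v1_def) simp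
    then show "AE z in lebesgue. z \<in> {0<..<b} \<longrightarrow> ?w1 z - \<mu> * ((pr \<mu> p c z + qr \<mu> q c z) / 2) = g2 z"
      by (intro AE_I2) blast
  qed
  ultimately have u2: "ac a b u2 g2" by (rule ac_glue) (use ab in simp_all)
  define g1 h1 where "g1 = (\<lambda>z. ?w2 z - \<mu> * ((pl \<mu> p c z - ql \<mu> q c z) / 2))" and "h1 = (\<lambda>z. ?w2 z - \<mu> * ((pr \<mu> p c z - qr \<mu> q c z) / 2))"
  obtain e where e: "e \<in> L2_on a b" "J0_rep a b e u1 g1 v1 h1 u2 g2"
    using J0_rep_exists[OF ab _ _ u2, of u1 g1 v1 h1] L(1) R(1) unfolding u1_def v1_def g1_def h1_def by blast
  have c: "AE z in lebesgue. z \<in> {a<..<0} \<longrightarrow> comp1 e z = u1 z" "AE z in lebesgue. z \<in> {0<..<b} \<longrightarrow> comp1 e z = v1 z"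
      "AE z in lebesgue. z \<in> {a<..<b} \<longrightarrow> comp2 e z = u2 z"
    using e by (simp_all add: J0_rep_def)
  have "\<mu> *\<^sub>R e - J0 a b e = w"
  proof (rule l2_eqI)
    have "AE z in lebesgue. z \<notin> {a..b} \<longrightarrow> rep_l2 w z = 0" "AE z in lebesgue. z \<notin> {a..b} \<longrightarrow> rep_l2 e z = 0"
      using w e by (simp_all add: L2_on_def)
    then show "AE z in lebesgue. rep_l2 (\<mu> *\<^sub>R e - J0 a b e) z = rep_l2 w z"
      using rep_diff[of "\<mu> *\<^sub>R e" "J0 a b e"] rep_scale[of \<mu> e] rep_J0[OF ab e(2)] c AE_nonzero[of 0] AE_nonzero[of a] AE_nonzero[of b]
    proof eventually_elim
      case (elim z)
      consider "z \<in> {a<..<0}" | "z \<in> {0<..<b}" | "z \<notin> {a..b}" using elim(9-11) by force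
      then show ?case
      proof cases
        case 1
        then have "rep_l2 e z $ 1 = u1 z" "rep_l2 e z $ 2 = u2 z" using elim ab by (auto simp: comp1_def comp2_def)
        then show ?thesis using 1 elim ab
          by (simp add: J0_fun_def vec_eq_iff forall_2 g2_def g1_def u2l comp1_def comp2_def)
      next
        case 2
        then have "rep_l2 e z $ 1 = v1 z" "rep_l2 e z $ 2 = u2 z" using elim ab by (auto simp: comp1_def comp2_def)
        then show ?thesis using 2 elim ab
          by (simp add: J0_fun_def vec_eq_iff forall_2 g2_def h1_def u2r comp1_def comp2_def)
      next
        case 3
        then show ?thesis using elim ab by (auto simp: J0_fun_def vec_eq_iff forall_2 indicator_def)
      qed
    qed
  qed
  then show ?thesis using e u2l u2r unfolding u1_def v1_def by blast
qed

lemma conditions_zero_iff: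
  assumes ab: "a < 0" "0 < b" and eX: "e \<in> L2_on a b" and e: "J0_rep a b e (\<lambda>z. (pl \<mu> p c z + ql \<mu> q c z) / 2) g1 (\<lambda>z. (pr \<mu> p c z + qr \<mu> q c z) / 2) h1 u2 g2"
    and u2: "\<forall>z\<le>0. u2 z = (pl \<mu> p c z - ql \<mu> q c z) / 2" "\<forall>z\<ge>0. u2 z = (pr \<mu> p c z - qr \<mu> q c z) / 2"
    and z: "conditions a b r W \<mu> p q c = 0"
  shows "e \<in> dom_effort a b r W"
proof -
  let ?L = "vector [(pl \<mu> p c a + ql \<mu> q c a) / 2, u2 a]" and ?R = "vector [(pr \<mu> p c b + qr \<mu> q c b) / 2, u2 b]"
  have u: "u2 a = (pl \<mu> p c a - ql \<mu> q c a) / 2" "u2 b = (pr \<mu> p c b - qr \<mu> q c b) / 2" "u2 0 = (pl \<mu> p c 0 - ql \<mu> q c 0) / 2"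
    using u2 ab by auto
  have "u2 0 = r * ((pl \<mu> p c 0 + ql \<mu> q c 0) / 2 - (pr \<mu> p c 0 + qr \<mu> q c 0) / 2)" "boundary_map W ?L ?R = 0"
    using z unfolding conditions_def Let_def u[symmetric] by (simp_all add: vec_eq_iff forall_3 forall_2)
  then show ?thesis unfolding dom_effort_iff[OF ab] using eX e by blast
qed

text \<open>A homogeneous solution meeting all conditions satisfies
  \<open>J0 a b e = \<mu> *\<^sub>R e\<close> with \<mu> > 0, which dissipativity permits only for e
  = 0.\<close>

lemma conditions_injective:
  assumes ab: "a < 0" "0 < b" and r: "0 \<le> r" and W: "rank W = 2" "psd (W ** Sigma_mat ** transpose W)" and mu: "0 < \<mu>"
    and z: "conditions a b r W \<mu> (\<lambda>z. 0) (\<lambda>z. 0) c = 0"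
  shows "c = 0"
proof -
  have w0: "(0::l2) \<in> L2_on a b" by (rule subspace_0[OF L2_on_subspace])
  have c0: "AE z in lebesgue. comp1 0 z = 0 \<and> comp2 0 z = 0"
    using rep_zero by eventually_elim (simp add: comp1_def comp2_def)
  have z0: "ac a b (\<lambda>z. 0) (\<lambda>z. 0)" using ac_exp[of a b 0 0] by simp
  have p: "ac a b (\<lambda>z. 0) (\<lambda>z. - \<mu> * 0 + (comp1 0 z + comp2 0 z))" and q: "ac a b (\<lambda>z. 0) (\<lambda>z. \<mu> * 0 + (comp2 0 z - comp1 0 z))"
    using c0 by (auto intro!: ac_cong[OF z0 refl] elim: eventually_mono)
  obtain e g1 h1 u2 g2 where e: "e \<in> L2_on a b"
    and rep: "J0_rep a b e (\<lambda>z. (pl \<mu> (\<lambda>z. 0) c z + ql \<mu> (\<lambda>z. 0) c z) / 2) g1 (\<lambda>z. (pr \<mu> (\<lambda>z. 0) c z + qr \<mu> (\<lambda>z. 0) c z) / 2) h1 u2 g2"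
    and u2: "\<forall>z\<le>0. u2 z = (pl \<mu> (\<lambda>z. 0) c z - ql \<mu> (\<lambda>z. 0) c z) / 2" "\<forall>z\<ge>0. u2 z = (pr \<mu> (\<lambda>z. 0) c z - qr \<mu> (\<lambda>z. 0) c z) / 2"
    and eq: "\<mu> *\<^sub>R e - J0 a b e = 0"
    using resolvent_family[OF ab w0 p q, of c] by blast
  have "e \<in> dom_effort a b r W" by (rule conditions_zero_iff[OF ab e rep u2 z])
  moreover have "J0 a b e = \<mu> *\<^sub>R e" using eq by simp
  ultimately have "\<mu> * sq_norm e \<le> 0"
    using dom_effort_dissipative(1)[OF ab r W, of e] by (simp add: l2_inner_scale_right l2_inner_self)
  then have "sq_norm e = 0" using mu sq_norm_nonneg[of e] by (simp add: mult_le_0_iff)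
  then have "e = 0" by (rule sq_norm_eq_0)
  then have ez: "AE z in lebesgue. comp1 e z = 0 \<and> comp2 e z = 0" using c0 by simp
  define u1 v1 where "u1 = (\<lambda>z. (pl \<mu> (\<lambda>z. 0) c z + ql \<mu> (\<lambda>z. 0) c z) / 2)"
    and "v1 = (\<lambda>z. (pr \<mu> (\<lambda>z. 0) c z + qr \<mu> (\<lambda>z. 0) c z) / 2)"
  note rep = rep[folded u1_def v1_def]
  have "u1 0 = 0"
  proof (rule continuous_AE_eq[of a 0 u1 "\<lambda>_. 0"])
    show "continuous_on {a..0} u1" using rep by (auto simp: J0_rep_def intro: ac_continuous)
    have "AE z in lebesgue. z \<in> {a<..<0} \<longrightarrow> comp1 e z = u1 z"
      using rep by (simp add: J0_rep_def)
    with ez show "AE z in lebesgue. z \<in> {a<..<0} \<longrightarrow> u1 z = 0"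
      by eventually_elim auto
  qed (use ab in auto)
  moreover have "v1 0 = 0"
  proof (rule continuous_AE_eq[of 0 b v1 "\<lambda>_. 0"])
    show "continuous_on {0..b} v1" using rep by (auto simp: J0_rep_def intro: ac_continuous)
    have "AE z in lebesgue. z \<in> {0<..<b} \<longrightarrow> comp1 e z = v1 z"
      using rep by (simp add: J0_rep_def)
    with ez show "AE z in lebesgue. z \<in> {0<..<b} \<longrightarrow> v1 z = 0"
      by eventually_elim auto
  qed (use ab in auto)
  moreover have "u2 0 = 0"
  proof (rule continuous_AE_eq[of a b u2 "\<lambda>_. 0"])
    show "continuous_on {a..b} u2" using rep by (auto simp: J0_rep_def intro: ac_continuous)
    have "AE z in lebesgue. z \<in> {a<..<b} \<longrightarrow> comp2 e z = u2 z" using rep by (simp add: J0_rep_def)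
    with ez show "AE z in lebesgue. z \<in> {a<..<b} \<longrightarrow> u2 z = 0" by eventually_elim auto
  qed (use ab in auto)
  \<comment> \<open>The three values at 0 are (c_1 + c_2)/2, (2 c_3 - c_1 + c_2)/2 and (c_1 -
    c_2)/2; together they determine \<open>c\<close>.\<close>
  ultimately show "c = 0"
    using u2 by (auto simp: u1_def v1_def pl_def ql_def pr_def qr_def vec_eq_iff forall_3)
qed

lemma effort_range:
  assumes ab: "a < 0" "0 < b" and r: "0 \<le> r" and W: "rank W = 2" "psd (W ** Sigma_mat ** transpose W)" and mu: "0 < \<mu>"
    and w: "w \<in> L2_on a b"
  shows "\<exists>e\<in>dom_effort a b r W. \<mu> *\<^sub>R e - J0 a b e = w"
proof -
  let ?L = "conditions a b r W \<mu> (\<lambda>z. 0) (\<lambda>z. 0)"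
  have lin: "linear ?L"
    using conditions_add[of a b r W \<mu> "\<lambda>z. 0" "\<lambda>z. 0" "\<lambda>z. 0" "\<lambda>z. 0"] conditions_scale
    by (intro linearI) auto
  have "inj ?L"
    using linear_injective_0[OF lin] conditions_injective[OF ab r W mu] by blast
  then have "surj ?L" by (rule linear_injective_imp_surjective[OF lin _ refl])
  obtain p where p: "ac a b p (\<lambda>z. - \<mu> * p z + (comp1 w z + comp2 w z))"
    using linear_ode_solution[OF L2_fun_add[OF comp_L2_fun(1) comp_L2_fun(2)]] by blast
  obtain q where q: "ac a b q (\<lambda>z. \<mu> * q z + (comp2 w z - comp1 w z))"
    using linear_ode_solution[OF L2_fun_diff[OF comp_L2_fun(2) comp_L2_fun(1)]] by blast
  obtain c where c: "?L c = - conditions a b r W \<mu> p q 0"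
    using \<open>surj ?L\<close> by (metis surjD)
  have "conditions a b r W \<mu> p q c = 0"
    using conditions_add[of a b r W \<mu> p "\<lambda>z. 0" q "\<lambda>z. 0" 0 c] c by simp
  then show ?thesis
    using resolvent_family[OF ab w p q, of c] conditions_zero_iff[OF ab] by blast
qed

text \<open>Taking the range condition as a hypothesis lets this statement serve twice: for the
  identity matrix, where the condition is solved explicitly, and for general \<open>Q\<close>, where
  it rests on the first case.\<close>

lemma (in coercive_multiplier) port_dissipative:
  assumes ab: "a < 0" "0 < b" and r: "0 \<le> r" and W: "rank W = 2" "psd (W ** Sigma_mat ** transpose W)"
    and range: "\<And>h y. h > 0 \<Longrightarrow> y \<in> X \<Longrightarrow> \<exists>x\<in>dom_AQ a b Q r W. x - h *\<^sub>R AQ a b Q x = y"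
  shows "dissipative_operator X (energy_inner a b Q) (energy_norm a b Q) (dom_AQ a b Q r W) (AQ a b Q)"
proof (rule dissipative_operator.intro[OF energy_space_axioms], unfold dissipative_operator_axioms_def,
    intro conjI allI impI)
  let ?D = "dom_AQ a b Q r W"
  have D: "x \<in> X" "M x \<in> dom_effort a b r W" if "x \<in> ?D" for x
    using that by (simp_all add: dom_AQ_effort)
  show "subspace ?D"
    unfolding subspace_def
  proof (intro conjI ballI allI)
    \<comment> \<open>The range condition supplies some element of the domain; scaling it by 0 shows
      that the domain contains 0.\<close>
    have z: "\<exists>x. x \<in> ?D" using range[of 1 0] by auto
    show add: "x + y \<in> ?D" if "x \<in> ?D" "y \<in> ?D" for x y
      using D[OF that(1)] D[OF that(2)] dom_effort_add(1)[OF ab] by (simp add: dom_AQ_effort M_add)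
    show scale: "c *\<^sub>R x \<in> ?D" if "x \<in> ?D" for c x
      using D[OF that] dom_effort_scale(1)[OF ab] by (simp add: dom_AQ_effort M_scale)
    show "0 \<in> ?D" using z scale[of _ 0] by auto
  qed
  show "?D \<subseteq> X" using D by blast
  show "AQ a b Q x \<in> X" if "x \<in> ?D" for x
    using dom_effort_dissipative(2)[OF ab r W D(2)[OF that]] by (simp add: AQ_def)
  show "AQ a b Q (x + y) = AQ a b Q x + AQ a b Q y" if "x \<in> ?D" "y \<in> ?D" for x y
    using D[OF that(1)] D[OF that(2)] dom_effort_add(2)[OF ab] by (simp add: AQ_def M_add)
  show "AQ a b Q (c *\<^sub>R x) = c *\<^sub>R AQ a b Q x" if "x \<in> ?D" for c x
    using D[OF that] dom_effort_scale(2)[OF ab] by (simp add: AQ_def M_scale)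
  show "energy_inner a b Q (AQ a b Q x) x \<le> 0" if "x \<in> ?D" for x
  proof -
    note d = dom_effort_dissipative[OF ab r W D(2)[OF that]]
    \<comment> \<open>Symmetry moves the multiplier from the image to the argument, so the energy
      form of the operator is half the plain form of \<open>J0\<close> at the effort.\<close>
    have "energy_inner a b Q (AQ a b Q x) x = l2_inner (M x) (J0 a b (M x)) / 2"
      using d(2) D(1)[OF that] M_sym[of x "J0 a b (M x)"] by (simp add: energy_inner_eq AQ_def)
    then show ?thesis using d(1) by simp
  qed
  show "\<exists>x\<in>?D. x - h *\<^sub>R AQ a b Q x = y" if "0 < h" "y \<in> X" for h y using range[OF that] .
qed

lemma identity_dissipative:
  assumes ab: "a < 0" "0 < b" and r: "0 \<le> r" and W: "rank W = 2" "psd (W ** Sigma_mat ** transpose W)"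
  shows "dissipative_operator (L2_on a b) (energy_inner a b (\<lambda>_. mat 1)) (energy_norm a b (\<lambda>_. mat 1))
    (dom_effort a b r W) (J0 a b)"
proof -
  interpret coercive_multiplier a b 1 1 "\<lambda>_. mat 1" by (rule identity_multiplier)
  have D: "dom_AQ a b (\<lambda>_. mat 1) r W = dom_effort a b r W"
    using dom_effort_dissipative(3)[OF ab r W] by (auto simp: dom_AQ_effort mult_op_identity)
  have A: "AQ a b (\<lambda>_. mat 1) = J0 a b" by (simp add: fun_eq_iff AQ_def mult_op_identity)
  show ?thesis
  proof (rule port_dissipative[OF ab r W, unfolded D A])
    fix h :: real and y assume h: "h > 0" and y: "y \<in> X"
    then obtain e where e: "e \<in> dom_effort a b r W" "(1 / h) *\<^sub>R e - J0 a b e = (1 / h) *\<^sub>R y"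
      using effort_range[OF ab r W, of "1 / h" "(1 / h) *\<^sub>R y"] by auto
    have "e - h *\<^sub>R J0 a b e = h *\<^sub>R ((1 / h) *\<^sub>R e - J0 a b e)"
      using h by (simp add: scaleR_diff_right)
    also have "\<dots> = y" using h by (simp add: e(2))
    finally show "\<exists>x\<in>dom_effort a b r W. x - h *\<^sub>R J0 a b x = y" using e(1) by blast
  qed
qed

text \<open>
  In terms of the effort $e=\mathcal Q x$ the resolvent equation is
  $\mathcal Q^{-1}e-h\mathcal J_0e=y$, that is $e=(I-\tau h\mathcal J_0)^{-1}(\tau y+e-\tau\mathcal Q^{-1}e)$;
  for small $\tau$ the right-hand side is a strict contraction in $e$.
\<close>

lemma (in coercive_multiplier) port_range:
  assumes ab: "a < 0" "0 < b" and r: "0 \<le> r" and W: "rank W = 2" "psd (W ** Sigma_mat ** transpose W)"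
    and h: "0 < h" and y: "y \<in> X"
  shows "\<exists>x\<in>dom_AQ a b Q r W. x - h *\<^sub>R AQ a b Q x = y"
proof -
  interpret I: dissipative_operator X "energy_inner a b (\<lambda>_. mat 1)" "energy_norm a b (\<lambda>_. mat 1)"
    "dom_effort a b r W" "J0 a b"
    by (rule identity_dissipative[OF ab r W])
  interpret I': coercive_multiplier a b 1 1 "\<lambda>_. mat 1" by (rule identity_multiplier)
  have ipI: "energy_inner a b (\<lambda>_. mat 1) x y = l2_inner y x / 2" if "x \<in> X" for x y
    using I'.energy_inner_eq[OF that] by (simp add: mult_op_identity)
  \<comment> \<open>\<open>C\<close> is the inverse of multiplication by \<open>Q\<close>; existence
    is surjectivity of \<open>M\<close>, and coercivity gives uniqueness and hence compatibility
    with differences.\<close>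
  define C where "C e = (SOME x. x \<in> X \<and> M x = e)" for e
  have C: "C e \<in> X" "M (C e) = e" if "e \<in> X" for e
  proof -
    have "\<exists>x. x \<in> X \<and> M x = e" using M_surjective[OF that] by blast
    from someI_ex[OF this] show "C e \<in> X" "M (C e) = e" by (simp_all add: C_def)
  qed
  have C_diff: "C (e - e') = C e - C e'" if "e \<in> X" "e' \<in> X" for e e'
  proof -
    let ?d = "C (e - e') - (C e - C e')"
    have d: "?d \<in> X" using that C by simp
    have "M ?d = 0" using that C by (simp add: M_diff)
    then have "m * sq_norm ?d \<le> 0" using M_lower[OF d] l2_inner_scale_right[of ?d 0 0] by simp
    then have "sq_norm ?d = 0" using m_pos sq_norm_nonneg[of ?d] by (simp add: mult_le_0_iff)
    then have "?d = 0" by (rule sq_norm_eq_0)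
    then show ?thesis by simp
  qed
  have "\<exists>\<tau>>0. \<exists>q. 0 \<le> q \<and> q < 1 \<and>
      (\<forall>x\<in>X. energy_norm a b (\<lambda>_. mat 1) (x - \<tau> *\<^sub>R C x) \<le> q * energy_norm a b (\<lambda>_. mat 1) x)"
  \<comment> \<open>The constants are the monotonicity constant and the norm bound of the inverse
    multiplier.\<close>
  proof (rule I.scaled_contraction[of C "m / K\<^sup>2" "1 / m"])
    show "C x \<in> X" if "x \<in> X" for x using C[OF that] by blast
    show "0 < m / K\<^sup>2" "0 < 1 / m" using m_pos K_pos by auto
    show "m / K\<^sup>2 * energy_inner a b (\<lambda>_. mat 1) x x \<le> energy_inner a b (\<lambda>_. mat 1) (C x) x" if "x \<in> X" for x
      using M_lower_image[OF C(1)[OF that]] C[OF that] that by (simp add: ipI l2_inner_self l2_inner_commute[of x])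
    show "energy_inner a b (\<lambda>_. mat 1) (C x) (C x) \<le> (1 / m)\<^sup>2 * energy_inner a b (\<lambda>_. mat 1) x x" if "x \<in> X" for x
      using M_expansive[OF C(1)[OF that]] C[OF that] that by (simp add: ipI l2_inner_self)
  qed
  then obtain \<tau> q where t: "\<tau> > 0" and q: "0 \<le> q" "q < 1"
    and c: "\<And>x. x \<in> X \<Longrightarrow> energy_norm a b (\<lambda>_. mat 1) (x - \<tau> *\<^sub>R C x) \<le> q * energy_norm a b (\<lambda>_. mat 1) x"
    by blast
  \<comment> \<open>The resolvent of \<open>J0\<close> is a contraction for every step, so the
    factor \<open>q\<close> of the inner map survives and \<open>h\<close> stays arbitrary.\<close>
  let ?F = "\<lambda>e. I.J (\<tau> * h) (\<tau> *\<^sub>R y + e - \<tau> *\<^sub>R C e)"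
  have th: "\<tau> * h > 0" using t h by simp
  have "\<exists>e\<in>X. ?F e = e"
  proof (rule I.contraction_fixpoint[OF _ q])
    show "?F e \<in> X" if "e \<in> X" for e using that C y th by simp
    fix e e' assume e: "e \<in> X" "e' \<in> X"
    have "?F e - ?F e' = I.J (\<tau> * h) ((\<tau> *\<^sub>R y + e - \<tau> *\<^sub>R C e) - (\<tau> *\<^sub>R y + e' - \<tau> *\<^sub>R C e'))"
      using e C y th by (intro I.J_diff[symmetric]) auto
    also have "(\<tau> *\<^sub>R y + e - \<tau> *\<^sub>R C e) - (\<tau> *\<^sub>R y + e' - \<tau> *\<^sub>R C e') = (e - e') - \<tau> *\<^sub>R C (e - e')"
      using e by (simp add: C_diff scaleR_diff_right)
    finally have "energy_norm a b (\<lambda>_. mat 1) (?F e - ?F e')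
      = energy_norm a b (\<lambda>_. mat 1) (I.J (\<tau> * h) ((e - e') - \<tau> *\<^sub>R C (e - e')))" by (rule arg_cong)
    also have "\<dots> \<le> energy_norm a b (\<lambda>_. mat 1) ((e - e') - \<tau> *\<^sub>R C (e - e'))"
      using e C(1)[of "e - e'"] th by (intro I.J_contr) auto
    also have "\<dots> \<le> q * energy_norm a b (\<lambda>_. mat 1) (e - e')" using e by (intro c) simp
    finally show "energy_norm a b (\<lambda>_. mat 1) (?F e - ?F e') \<le> q * energy_norm a b (\<lambda>_. mat 1) (e - e')" .
  qed
  then obtain e where e: "e \<in> X" "?F e = e" by blast
  let ?w = "\<tau> *\<^sub>R y + e - \<tau> *\<^sub>R C e"
  have w: "?w \<in> X" using e C y by simp
  have eD: "e \<in> dom_effort a b r W" using I.J_D[OF th w] e(2) by simp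
  have "e - (\<tau> * h) *\<^sub>R J0 a b e = ?w" using I.J_eq[OF th w] e(2) by simp
  then have "\<tau> *\<^sub>R (C e - h *\<^sub>R J0 a b e - y) = 0" by (simp add: algebra_simps)
  then have "C e - h *\<^sub>R J0 a b e = y" using t by simp
  then show ?thesis
    using C[OF e(1)] eD by (intro bexI[of _ "C e"]) (simp_all add: dom_AQ_effort AQ_def)
qed

section \<open>From matrix inequalities to a coercive multiplier\<close>

lemma psd_shift_lower:
  fixes A :: "real^2^2"
  assumes "psd (A - m *\<^sub>R mat 1)"
  shows "m * (v \<bullet> v) \<le> v \<bullet> (A *v v)"
proof -
  have "0 \<le> v \<bullet> ((A - m *\<^sub>R mat 1) *v v)" using assms by (simp add: psd_def)
  also have "(A - m *\<^sub>R mat 1) *v v = A *v v - m *\<^sub>R v"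
    by (simp add: matrix_vector_mult_diff_rdistrib scaleR_matrix_vector_assoc[symmetric])
  finally show ?thesis by (simp add: inner_diff_right)
qed

lemma psd_shift_upper:
  fixes A :: "real^2^2"
  assumes "psd (M *\<^sub>R mat 1 - A)"
  shows "v \<bullet> (A *v v) \<le> M * (v \<bullet> v)"
proof -
  have "0 \<le> v \<bullet> ((M *\<^sub>R mat 1 - A) *v v)" using assms by (simp add: psd_def)
  also have "(M *\<^sub>R mat 1 - A) *v v = M *\<^sub>R v - A *v v"
    by (simp add: matrix_vector_mult_diff_rdistrib scaleR_matrix_vector_assoc[symmetric])
  finally show ?thesis by (simp add: inner_diff_right)
qed

text \<open>Expand $0\le\langle Mv-w,A(Mv-w)\rangle$ for $w=Av$.\<close>

lemma psd_norm_bound: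
  fixes A :: "real^2^2"
  assumes sym: "transpose A = A" and pos: "\<And>v. 0 \<le> v \<bullet> (A *v v)" and up: "\<And>v. v \<bullet> (A *v v) \<le> M * (v \<bullet> v)"
    and M: "0 < M"
  shows "norm (A *v v) \<le> M * norm v"
proof -
  define w where "w = A *v v"
  have s: "x \<bullet> (A *v y) = (A *v x) \<bullet> y" for x y
    using sym by (metis dot_lmul_matrix transpose_matrix_vector)
  have "0 \<le> (M *\<^sub>R v - w) \<bullet> (A *v (M *\<^sub>R v - w))" by (rule pos)
  also have "\<dots> = M\<^sup>2 * (v \<bullet> (A *v v)) - 2 * M * (w \<bullet> w) + w \<bullet> (A *v w)"
    using s[of v w]
    by (simp add: matrix_vector_mult_diff_distrib matrix_vector_mult_scaleR inner_diff_left inner_diff_right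
        w_def[symmetric] power2_eq_square algebra_simps inner_commute)
  also have "\<dots> \<le> M\<^sup>2 * (M * (v \<bullet> v)) - 2 * M * (w \<bullet> w) + M * (w \<bullet> w)"
    using up M by (intro add_mono diff_right_mono mult_left_mono) auto
  finally have "M * (w \<bullet> w) \<le> M * (M\<^sup>2 * (v \<bullet> v))" by (simp add: algebra_simps)
  then have "w \<bullet> w \<le> M\<^sup>2 * (v \<bullet> v)" using M by simp
  then have "(norm w)\<^sup>2 \<le> (M * norm v)\<^sup>2" by (simp add: power2_norm_eq_inner power_mult_distrib)
  then show ?thesis using M by (simp add: w_def power2_le_iff_abs_le)
qed

lemma Q0_measurable:
  assumes "a < 0" "0 < b" "Qm \<in> borel_measurable (lebesgue_on {a..b})" "Qp \<in> borel_measurable (lebesgue_on {a..b})"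
  shows "Q0 a b Qm Qp \<in> borel_measurable lebesgue"
proof -
  have ext: "(\<lambda>z. indicator S z *\<^sub>R A z) \<in> borel_measurable lebesgue"
    if "S \<subseteq> {a..b}" "S \<in> sets lebesgue" "A \<in> borel_measurable (lebesgue_on {a..b})" for S and A :: "real \<Rightarrow> real^2^2"
  proof -
    have "A \<in> borel_measurable (lebesgue_on S)"
      using that by (auto intro: measurable_restrict_mono)
    then show ?thesis using that by (subst borel_measurable_restrict_space_iff[symmetric]) auto
  qed
  have "(\<lambda>z. indicator {a..<0} z *\<^sub>R Qm z + indicator {0<..b} z *\<^sub>R Qp z) \<in> borel_measurable lebesgue"
    using assms by (intro borel_measurable_add ext) auto
  then show ?thesis by (simp add: Q0_def[abs_def])
qed

theorem theorem5p14:
  fixes a b m M r :: real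
    and Qm Qp :: "real \<Rightarrow> real^2^2"
    and W :: "real^4^2"
  assumes "a < 0" and "0 < b"
    and "Qm \<in> borel_measurable (lebesgue_on {a..b})"
    and "Qp \<in> borel_measurable (lebesgue_on {a..b})"
    and "\<And>z. z \<in> {a..b} \<Longrightarrow> transpose (Qm z) = Qm z"
    and "\<And>z. z \<in> {a..b} \<Longrightarrow> transpose (Qp z) = Qp z"
    and "0 < m" and "m \<le> M"
    and "AE z in lebesgue_on {a..b}. psd (Qm z - m *\<^sub>R mat 1) \<and> psd (M *\<^sub>R mat 1 - Qm z)"
    and "AE z in lebesgue_on {a..b}. psd (Qp z - m *\<^sub>R mat 1) \<and> psd (M *\<^sub>R mat 1 - Qp z)"
    and "0 \<le> r"
    and "rank W = 2"
    and "psd (W ** Sigma_mat ** transpose W)"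
  shows "generates_contraction_semigroup (L2_on a b) (energy_norm a b (Q0 a b Qm Qp))
           (dom_AQ a b (Q0 a b Qm Qp) r W) (AQ a b (Q0 a b Qm Qp)) \<and>
         well_posed (L2_on a b) (energy_norm a b (Q0 a b Qm Qp))
           (dom_AQ a b (Q0 a b Qm Qp) r W) (AQ a b (Q0 a b Qm Qp))"
proof -
  let ?Q = "Q0 a b Qm Qp"
  note ab = assms(1,2)
  have "AE z in lebesgue. z \<in> {a..b} \<longrightarrow> psd (Qm z - m *\<^sub>R mat 1) \<and> psd (M *\<^sub>R mat 1 - Qm z)"
    "AE z in lebesgue. z \<in> {a..b} \<longrightarrow> psd (Qp z - m *\<^sub>R mat 1) \<and> psd (M *\<^sub>R mat 1 - Qp z)"
    by (rule AE_restrict_space_iff[THEN iffD1, OF _ assms(9)] AE_restrict_space_iff[THEN iffD1, OF _ assms(10)], simp)+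
  then have Q: "AE z in lebesgue. z \<in> {a..b} \<longrightarrow> transpose (?Q z) = ?Q z \<and>
      psd (?Q z - m *\<^sub>R mat 1) \<and> psd (M *\<^sub>R mat 1 - ?Q z)"
    \<comment> \<open>At 0 both indicators vanish and \<open>Q0\<close> is the zero matrix, so
      coercivity fails at this single point, which is discarded as a null set.\<close>
    using AE_nonzero[of 0]
  proof eventually_elim
    case (elim z)
    show ?case
    proof
      assume z: "z \<in> {a..b}"
      show "transpose (?Q z) = ?Q z \<and> psd (?Q z - m *\<^sub>R mat 1) \<and> psd (M *\<^sub>R mat 1 - ?Q z)"
      proof (cases "z < 0")
        case True
        then have "?Q z = Qm z" using z by (simp add: Q0_def)
        then show ?thesis using elim z assms(5)[OF z] by simp
      next
        case False
        then have "?Q z = Qp z" using z elim by (simp add: Q0_def)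
        then show ?thesis using elim z assms(6)[OF z] by simp
      qed
    qed
  qed
  interpret coercive_multiplier a b m M ?Q
  proof
    show "0 < m" "0 < M" using assms(7,8) by auto
    show "?Q \<in> borel_measurable lebesgue" by (rule Q0_measurable[OF ab assms(3,4)])
    show "AE z in lebesgue. z \<in> {a..b} \<longrightarrow> transpose (?Q z) = ?Q z" using Q by eventually_elim blast
    show "AE z in lebesgue. z \<in> {a..b} \<longrightarrow> (\<forall>v. m * (v \<bullet> v) \<le> v \<bullet> (?Q z *v v))"
      using Q by eventually_elim (blast intro: psd_shift_lower)
    show "AE z in lebesgue. z \<in> {a..b} \<longrightarrow> (\<forall>v. norm (?Q z *v v) \<le> M * norm v)"
      using Q
    proof eventually_elim
      case (elim z)
      show ?case
      proof (intro impI allI)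
        fix v assume z: "z \<in> {a..b}"
        have "0 \<le> u \<bullet> (?Q z *v u)" for u
        proof -
          have "0 \<le> m * (u \<bullet> u)" using assms(7) by simp
          also have "\<dots> \<le> u \<bullet> (?Q z *v u)" using elim z by (intro psd_shift_lower) blast
          finally show ?thesis .
        qed
        then show "norm (?Q z *v v) \<le> M * norm v"
          using elim z assms(7,8) by (intro psd_norm_bound) (auto intro: psd_shift_upper)
      qed
    qed
  qed
  interpret dissipative_operator "L2_on a b" "energy_inner a b ?Q" "energy_norm a b ?Q" "dom_AQ a b ?Q r W" "AQ a b ?Q"
    by (rule port_dissipative[OF ab assms(11-13) port_range[OF ab assms(11-13)]])
  show ?thesis using generates well_posed by blast
qed

end
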